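(* Let $a>0$, $b>c>d>0$ and let $$Q_3=\Big\{(x,y,z,t)\in\mathbb R^4:\ \frac{x^2}{a^2}-\frac{y^2}{b^2}-\frac{z^2}{c^2}-\frac{t^2}{d^2}-1=0\Big\},$$ positively oriented by the unit normal directed by $\nabla\big(\frac{x^2}{a^2}-\frac{y^2}{b^2}-\frac{z^2}{c^2}-\frac{t^2}{d^2}\big)$. Each connected component of $Q_3$ has empty umbilic set, and its partially umbilic set consists of three curves $\mathcal P_{23}^1,\mathcal P_{23}^2\subset\mathcal P_{23}$ and $\mathcal P_{12}$. In the chart $(u,v,w)$ given by $(u,v,w)\mapsto(\pm a\sqrt{1+u^2+v^2+w^2},\,bu,\,cv,\,dw)$ (one sign for each component) they are defined by $E(v,w)=0,\ u=0$ and $H(u,w)=0,\ v=0$, where $$E(v,w)=\frac{(a^2+c^2)v^2}{b^2-c^2}+\frac{(a^2+d^2)w^2}{b^2-d^2}-1,\qquad H(u,w)=-\frac{(a^2+b^2)u^2}{b^2-c^2}+\frac{(a^2+d^2)w^2}{c^2-d^2}-1 .$$ On each connected component of $Q_3$ the following hold. (i) The principal foliation $\mathcal F_1$ is singular on $\mathcal P_{12}$, $\mathcal F_3$ is singular on $\mathcal P_{23}^1\cup\mathcal P_{23}^2$ and $\mathcal F_2$ is singular on $\mathcal P_{12}\cup\mathcal P_{23}^1\cup\mathcal P_{23}^2$. The partially umbilic curves $\mathcal P_{23}^1$ and $\mathcal P_{23}^2$ are of type $D_1$; their partially umbilic separatrix surfaces for $\mathcal F_3$ span an open band $W_{23}$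 such that $\partial W_{23}=\mathcal P_{23}^1\cup\mathcal P_{23}^2$. All the leaves of $\mathcal F_1$ are arcs diffeomorphic to $\mathbb R$. All the leaves of $\mathcal F_3$ outside the band $W_{23}$ are compact. (ii) For the principal foliation $\mathcal F_2$, singular at $\mathcal P_{12}\cup\mathcal P_{23}^1\cup\mathcal P_{23}^2$, the partially umbilic separatrix surfaces $W_{23}^1$ and $W_{23}^2$ of $\mathcal P_{23}^1$ and $\mathcal P_{23}^2$ are unbounded punctured open disks, and the partially umbilic separatrix surface $W_{12}$ of $\mathcal P_{12}$ is diffeomorphic to an (open) unit disk with two points removed. All the leaves of $\mathcal F_2$ outside these partially umbilic separatrix surfaces are closed. Moreover, $W_{23}^1$ and $W_{23}^2$ intersect $W_{12}$ transversally along open arcs.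
   Context: For an oriented hypersurface $M\subset\mathbb R^4$ with unit normal $N$, the principal curvatures $k_1\le k_2\le k_3$ are the eigenvalues of $D(-N)$ on the tangent bundle. Umbilic set: $\mathcal U=\{k_1=k_2=k_3\}$. Partially umbilic set: $\mathcal P_{12}\cup\mathcal P_{23}$, with $\mathcal P_{12}=\{k_1=k_2<k_3\}$ and $\mathcal P_{23}=\{k_1<k_2=k_3\}$. The eigenline field $\mathcal L_i$ of $k_i$ is defined off $\mathcal U\cup\mathcal P_{12}$ for $i=1$, off $\mathcal U\cup\mathcal P_{23}$ for $i=3$, and off $\mathcal U\cup\mathcal P_{12}\cup\mathcal P_{23}$ for $i=2$; $\mathcal F_i$ is the foliation of that domain by the integral curves (principal lines) of $\mathcal L_i$; "singular on" a set means not defined there. Type $D_1$: let $p$ be a partially umbilic point, and $e_1,e_2,e_3$ an orthonormal basis of $T_pM$ with $e_1,e_2$ spanning the two-dimensional eigenspace (double principal curvature). Near $p$, $M=\{p+x_1e_1+x_2e_2+x_3e_3+h(x_1,x_2,x_3)N(p)\}$. After a suitable rotation of $e_1,e_2$ the third-order part of $h(x_1,x_2,0)$ is $\frac16(Ax_1^3+3Bx_1x_2^2+Cx_2^3)$. The point is of (Darbouxian) type $D_1$ if $B(B-A)\neq0$ and $\frac AB>\big(\frac{C}{2B}\big)^2+2$. A partially umbilic curve is of type $D_1$ if it is a regular curve all of whose points are of type $D_1$. Partially umbilic separatrix surface: for a partially umbilic curve $\mathcal C\subset\mathcal P_{ij}$ and $k\in\{i,j\}$, the separatrix surface of $\mathcal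 F_k$ at $\mathcal C$ is the union of those leaves of $\mathcal F_k$ having a point of $\mathcal C$ as a limiting endpoint. An open band here is a surface diffeomorphic to $\mathbb R\times(0,1)$, and $\partial W$ denotes the topological boundary $\overline W\setminus W$ in $Q_3$. *)

theory Defs
  imports "HOL-Analysis.Analysis"
begin

section \<open>Smooth maps and diffeomorphisms between subsets of Euclidean spaces\<close>

definition dir_deriv ::
    "'a::euclidean_space \<Rightarrow> ('a \<Rightarrow> 'b::real_normed_vector) \<Rightarrow> 'a \<Rightarrow> 'b" where
  "dir_deriv v f = (\<lambda>x. frechet_derivative f (at x) v)"

text \<open>Class \<open>C\<^sup>k\<close> on an open set \<open>U\<close>.\<close>

primrec Ck_on :: "nat \<Rightarrow> 'a::euclidean_space set \<Rightarrow> ('a \<Rightarrow> 'b::euclidean_space) \<Rightarrow> bool" where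
  "Ck_on 0 U f \<longleftrightarrow> continuous_on U f"
| "Ck_on (Suc k) U f \<longleftrightarrow> (\<forall>x\<in>U. f differentiable (at x)) \<and> (\<forall>v. Ck_on k U (dir_deriv v f))"

definition smooth_on :: "'a::euclidean_space set \<Rightarrow> ('a \<Rightarrow> 'b::euclidean_space) \<Rightarrow> bool" where
  "smooth_on U f \<longleftrightarrow> (\<forall>k. Ck_on k U f)"

text \<open>On an arbitrary subset, a map is smooth if it extends locally to a smooth map of an
  open subset of the ambient space; for embedded submanifolds this is smoothness in charts.\<close>

definition smooth_map_on :: "'a::euclidean_space set \<Rightarrow> ('a \<Rightarrow> 'b::euclidean_space) \<Rightarrow> bool" where
  "smooth_map_on A f \<longleftrightarrow>
     (\<forall>x\<in>A. \<exists>U g. open U \<and> x \<in> U \<and> smooth_on U g \<and> (\<forall>y\<in>A \<inter> U. g y = f y))"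

definition diffeomorphic :: "'a::euclidean_space set \<Rightarrow> 'b::euclidean_space set \<Rightarrow> bool" where
  "diffeomorphic A B \<longleftrightarrow>
     (\<exists>f g. homeomorphism A B f g \<and> smooth_map_on A f \<and> smooth_map_on B g)"

text \<open>A connected embedded one-dimensional submanifold.\<close>

definition regular_curve :: "'a::euclidean_space set \<Rightarrow> bool" where
  "regular_curve C \<longleftrightarrow> C \<noteq> {} \<and> connected C \<and>
     (\<forall>p\<in>C. \<exists>V. open V \<and> p \<in> V \<and> diffeomorphic (C \<inter> V) (UNIV :: real set))"

definition tangent_space :: "'a::euclidean_space set \<Rightarrow> 'a \<Rightarrow> 'a set" where
  "tangent_space S p =
     {v. \<exists>\<gamma>. \<gamma> 0 = p \<and> (\<forall>\<^sub>F s in nhds (0::real). \<gamma> s \<in> S) \<and> (\<gamma> has_vector_derivative v) (at 0)}"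

definition transversal_in ::
    "'a::euclidean_space set \<Rightarrow> 'a set \<Rightarrow> 'a set \<Rightarrow> bool" where
  "transversal_in M A B \<longleftrightarrow>
     (\<forall>p\<in>A \<inter> B. {v + w |v w. v \<in> tangent_space A p \<and> w \<in> tangent_space B p} = tangent_space M p)"


section \<open>Principal curvatures of a hypersurface oriented by a unit normal field\<close>

text \<open>The derivative is taken within \<open>M\<close>, so only the values of \<open>N\<close> on \<open>M\<close> matter. Such a
  derivative is determined only on vectors tangent to \<open>M\<close>; it is never applied to others.\<close>

definition shape_operator ::
    "(real^4) set \<Rightarrow> (real^4 \<Rightarrow> real^4) \<Rightarrow> real^4 \<Rightarrow> real^4 \<Rightarrow> real^4" where
  "shape_operator M N p v = frechet_derivative (\<lambda>q. - N q) (at p within M) v"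

definition principal_curvatures ::
    "(real^4) set \<Rightarrow> (real^4 \<Rightarrow> real^4) \<Rightarrow> real^4 \<Rightarrow> real^3" where
  "principal_curvatures M N p =
     (THE k. k$1 \<le> k$2 \<and> k$2 \<le> k$3 \<and>
        (\<exists>e :: 3 \<Rightarrow> real^4.
           (\<forall>i j. e i \<bullet> e j = (if i = j then 1 else 0)) \<and>
           span (range e) = tangent_space M p \<and>
           (\<forall>i. shape_operator M N p (e i) = k$i *\<^sub>R e i)))"

definition eigenspace ::
    "(real^4) set \<Rightarrow> (real^4 \<Rightarrow> real^4) \<Rightarrow> real^4 \<Rightarrow> real \<Rightarrow> (real^4) set" where
  "eigenspace M N p \<kappa> = {v \<in> tangent_space M p. shape_operator M N p v = \<kappa> *\<^sub>R v}"

definition umbilic_set :: "(real^4) set \<Rightarrow> (real^4 \<Rightarrow> real^4) \<Rightarrow> (real^4) set" where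
  "umbilic_set M N =
     {p \<in> M. let k = principal_curvatures M N p in k$1 = k$2 \<and> k$2 = k$3}"

definition partially_umbilic_set12 :: "(real^4) set \<Rightarrow> (real^4 \<Rightarrow> real^4) \<Rightarrow> (real^4) set" where
  "partially_umbilic_set12 M N =
     {p \<in> M. let k = principal_curvatures M N p in k$1 = k$2 \<and> k$2 < k$3}"

definition partially_umbilic_set23 :: "(real^4) set \<Rightarrow> (real^4 \<Rightarrow> real^4) \<Rightarrow> (real^4) set" where
  "partially_umbilic_set23 M N =
     {p \<in> M. let k = principal_curvatures M N p in k$1 < k$2 \<and> k$2 = k$3}"


section \<open>Principal foliations\<close>

text \<open>The index \<open>i\<close> ranges over the type \<open>3\<close>, whose elements are 1, 2 and 3.\<close>

definition singular_set :: "(real^4) set \<Rightarrow> (real^4 \<Rightarrow> real^4) \<Rightarrow> 3 \<Rightarrow> (real^4) set" where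
  "singular_set M N i =
     umbilic_set M N \<union>
     (if i = 1 then partially_umbilic_set12 M N
      else if i = 3 then partially_umbilic_set23 M N
      else partially_umbilic_set12 M N \<union> partially_umbilic_set23 M N)"

definition foliation_domain :: "(real^4) set \<Rightarrow> (real^4 \<Rightarrow> real^4) \<Rightarrow> 3 \<Rightarrow> (real^4) set" where
  "foliation_domain M N i = M - singular_set M N i"

text \<open>The line of \<open>\<L>\<^sub>i\<close> at a point of its domain.\<close>

definition eigenline ::
    "(real^4) set \<Rightarrow> (real^4 \<Rightarrow> real^4) \<Rightarrow> 3 \<Rightarrow> real^4 \<Rightarrow> (real^4) set" where
  "eigenline M N i p = eigenspace M N p (principal_curvatures M N p $ i)"

definition principal_line ::
    "(real^4) set \<Rightarrow> (real^4 \<Rightarrow> real^4) \<Rightarrow> 3 \<Rightarrow> real set \<Rightarrow> (real \<Rightarrow> real^4) \<Rightarrow> bool" where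
  "principal_line M N i I \<gamma> \<longleftrightarrow>
     open I \<and> is_interval I \<and> smooth_on I \<gamma> \<and>
     (\<forall>s\<in>I. \<gamma> s \<in> foliation_domain M N i \<and>
            vector_derivative \<gamma> (at s) \<noteq> 0 \<and>
            vector_derivative \<gamma> (at s) \<in> eigenline M N i (\<gamma> s))"

text \<open>The leaf through \<open>p\<close> is the union of the principal lines through \<open>p\<close>, that is, the trace
  of the maximal one.\<close>

definition leaf ::
    "(real^4) set \<Rightarrow> (real^4 \<Rightarrow> real^4) \<Rightarrow> 3 \<Rightarrow> real^4 \<Rightarrow> (real^4) set" where
  "leaf M N i p = \<Union> {\<gamma> ` I |\<gamma> I. principal_line M N i I \<gamma> \<and> p \<in> \<gamma> ` I}"

definition leaves :: "(real^4) set \<Rightarrow> (real^4 \<Rightarrow> real^4) \<Rightarrow> 3 \<Rightarrow> (real^4) set set" where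
  "leaves M N i = leaf M N i ` foliation_domain M N i"

definition closed_leaf :: "(real^4) set \<Rightarrow> bool" where
  "closed_leaf L \<longleftrightarrow> diffeomorphic L (sphere (0::real^2) 1)"

definition limiting_endpoint ::
    "(real^4) set \<Rightarrow> (real^4 \<Rightarrow> real^4) \<Rightarrow> 3 \<Rightarrow> (real^4) set \<Rightarrow> real^4 \<Rightarrow> bool" where
  "limiting_endpoint M N i L q \<longleftrightarrow>
     (\<exists>\<gamma>. principal_line M N i {0<..<1} \<gamma> \<and> \<gamma> ` {0<..<1} = L \<and>
          ((\<gamma> \<longlongrightarrow> q) (at_right 0) \<or> (\<gamma> \<longlongrightarrow> q) (at_left 1)))"

definition separatrix_surface ::
    "(real^4) set \<Rightarrow> (real^4 \<Rightarrow> real^4) \<Rightarrow> 3 \<Rightarrow> (real^4) set \<Rightarrow> (real^4) set" where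
  "separatrix_surface M N i C =
     \<Union> {L \<in> leaves M N i. \<exists>q\<in>C. limiting_endpoint M N i L q}"


section \<open>Partially umbilic curves of type \<open>D\<^sub>1\<close>\<close>

definition taylor_part ::
    "nat \<Rightarrow> ('a::euclidean_space \<Rightarrow> real) \<Rightarrow> 'a \<Rightarrow> 'a \<Rightarrow> real" where
  "taylor_part n f x v = (dir_deriv v ^^ n) f x / fact n"

definition local_graph ::
    "(real^4) set \<Rightarrow> (real^4 \<Rightarrow> real^4) \<Rightarrow> real^4 \<Rightarrow> (3 \<Rightarrow> real^4) \<Rightarrow> (real^3 \<Rightarrow> real) \<Rightarrow> bool" where
  "local_graph M N p e h \<longleftrightarrow>
     (\<exists>U V. open U \<and> 0 \<in> U \<and> open V \<and> p \<in> V \<and> smooth_on U h \<and>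
        M \<inter> V = (\<lambda>x. p + x$1 *\<^sub>R e 1 + x$2 *\<^sub>R e 2 + x$3 *\<^sub>R e 3 + h x *\<^sub>R N p) ` U)"

text \<open>The rotation of \<open>e\<^sub>1, e\<^sub>2\<close> is absorbed into the choice of the orthonormal frame.\<close>

definition type_D1_point :: "(real^4) set \<Rightarrow> (real^4 \<Rightarrow> real^4) \<Rightarrow> real^4 \<Rightarrow> bool" where
  "type_D1_point M N p \<longleftrightarrow>
     p \<in> partially_umbilic_set12 M N \<union> partially_umbilic_set23 M N \<and>
     (\<exists>(e :: 3 \<Rightarrow> real^4) h A B C.
        (\<forall>i j. e i \<bullet> e j = (if i = j then 1 else 0)) \<and>
        span (range e) = tangent_space M p \<and>
        span {e 1, e 2} = eigenspace M N p (principal_curvatures M N p $ 2) \<and>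
        local_graph M N p e h \<and>
        (\<forall>x1 x2. taylor_part 3 h 0 (vector [x1, x2, 0]) =
                   (A * x1^3 + 3 * B * x1 * x2^2 + C * x2^3) / 6) \<and>
        B * (B - A) \<noteq> 0 \<and> A / B > (C / (2 * B))^2 + 2)"

definition type_D1_curve :: "(real^4) set \<Rightarrow> (real^4 \<Rightarrow> real^4) \<Rightarrow> (real^4) set \<Rightarrow> bool" where
  "type_D1_curve M N C \<longleftrightarrow> regular_curve C \<and> (\<forall>p\<in>C. type_D1_point M N p)"


section \<open>The quadric\<close>

definition Q3_form :: "real \<Rightarrow> real \<Rightarrow> real \<Rightarrow> real \<Rightarrow> real^4 \<Rightarrow> real" where
  "Q3_form a b c d p = (p$1)^2 / a^2 - (p$2)^2 / b^2 - (p$3)^2 / c^2 - (p$4)^2 / d^2"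

definition Q3 :: "real \<Rightarrow> real \<Rightarrow> real \<Rightarrow> real \<Rightarrow> (real^4) set" where
  "Q3 a b c d = {p. Q3_form a b c d p - 1 = 0}"

definition Q3_gradient :: "real \<Rightarrow> real \<Rightarrow> real \<Rightarrow> real \<Rightarrow> real^4 \<Rightarrow> real^4" where
  "Q3_gradient a b c d p =
     vector [2 * p$1 / a^2, - 2 * p$2 / b^2, - 2 * p$3 / c^2, - 2 * p$4 / d^2]"

definition Q3_normal :: "real \<Rightarrow> real \<Rightarrow> real \<Rightarrow> real \<Rightarrow> real^4 \<Rightarrow> real^4" where
  "Q3_normal a b c d p = sgn (Q3_gradient a b c d p)"

definition Q3_chart ::
    "real \<Rightarrow> real \<Rightarrow> real \<Rightarrow> real \<Rightarrow> real \<Rightarrow> real \<Rightarrow> real \<Rightarrow> real \<Rightarrow> real^4" where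
  "Q3_chart a b c d \<sigma> u v w =
     vector [\<sigma> * a * sqrt (1 + u^2 + v^2 + w^2), b * u, c * v, d * w]"

definition Q3_sheet :: "real \<Rightarrow> real \<Rightarrow> real \<Rightarrow> real \<Rightarrow> real \<Rightarrow> (real^4) set" where
  "Q3_sheet a b c d \<sigma> = {Q3_chart a b c d \<sigma> u v w |u v w. True}"

definition E_fun :: "real \<Rightarrow> real \<Rightarrow> real \<Rightarrow> real \<Rightarrow> real \<Rightarrow> real \<Rightarrow> real" where
  "E_fun a b c d v w =
     (a^2 + c^2) * v^2 / (b^2 - c^2) + (a^2 + d^2) * w^2 / (b^2 - d^2) - 1"

definition H_fun :: "real \<Rightarrow> real \<Rightarrow> real \<Rightarrow> real \<Rightarrow> real \<Rightarrow> real \<Rightarrow> real" where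
  "H_fun a b c d u w =
     - ((a^2 + b^2) * u^2 / (b^2 - c^2)) + (a^2 + d^2) * w^2 / (c^2 - d^2) - 1"

lemma vector_4 [simp]:
  "(vector [x, y, z, t] :: ('a::zero)^4) $ 1 = x"
  "(vector [x, y, z, t] :: ('a::zero)^4) $ 2 = y"
  "(vector [x, y, z, t] :: ('a::zero)^4) $ 3 = z"
  "(vector [x, y, z, t] :: ('a::zero)^4) $ 4 = t"
  unfolding vector_def by simp_all

lemma GDERIV_Q3_form: "GDERIV (Q3_form a b c d) p :> Q3_gradient a b c d p"
proof -
  have "(Q3_form a b c d has_derivative
          (\<lambda>h. 2 * p$1 * h$1 / a^2 - 2 * p$2 * h$2 / b^2
                 - 2 * p$3 * h$3 / c^2 - 2 * p$4 * h$4 / d^2)) (at p)"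
    unfolding Q3_form_def
    by (auto intro!: derivative_eq_intros bounded_linear.has_derivative[OF bounded_linear_vec_nth]
        simp: divide_inverse algebra_simps)
  moreover have "(\<lambda>h. 2 * p$1 * h$1 / a^2 - 2 * p$2 * h$2 / b^2
                 - 2 * p$3 * h$3 / c^2 - 2 * p$4 * h$4 / d^2) =
      (\<lambda>h. h \<bullet> Q3_gradient a b c d p)"
    by (simp add: fun_eq_iff inner_vec_def sum_4 Q3_gradient_def mult_ac)
  ultimately show ?thesis by (simp add: gderiv_def)
qed

end

theory Submission
  imports Defs
begin

text \<open>In the linear coordinates \<open>X = \<surd>(a\<^sup>2 + b\<^sup>2) u\<close>, \<open>Y = \<surd>(a\<^sup>2 + c\<^sup>2) v\<close>, \<open>Z = \<surd>(a\<^sup>2 + d\<^sup>2) w\<close> on a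
  sheet, the principal directions are the eigenvectors of \<open>diag(b\<^sup>2, c\<^sup>2, d\<^sup>2) + U U\<^sup>T\<close> with
  \<open>U = (X, Y, Z)\<close>, and the principal curvature \<open>k\<^sub>i\<close> is a common positive factor divided by the \<open>i\<close>-th
  largest eigenvalue \<open>m\<^sub>i\<close>. Hence the principal lines are the coordinate curves of the classical
  ellipsoidal coordinates \<open>m\<^sub>1 \<ge> b\<^sup>2 \<ge> m\<^sub>2 \<ge> c\<^sup>2 \<ge> m\<^sub>3 \<ge> d\<^sup>2\<close> of three-dimensional space: along a line of \<open>\<F>\<^sub>i\<close>
  the other two coordinates are constant, and every leaf has an explicit parametrization. The
  partially umbilic curves are the focal ellipse \<open>m\<^sub>1 = m\<^sub>2 = b\<^sup>2\<close> and the focal hyperbola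
  \<open>m\<^sub>2 = m\<^sub>3 = c\<^sup>2\<close>, and the separatrix surfaces are, up to isolated points, the regions into which
  these curves divide the coordinate planes \<open>X = 0\<close> and \<open>Y = 0\<close>.\<close>

subsection \<open>Calculus of smooth maps\<close>

text \<open>A leaf is the union of all principal lines through a point, so an explicit curve is a
  leaf only once it is known to be maximal. Invariants settle this in place of a uniqueness theorem
  for integral curves: along every principal line two ellipsoidal coordinates and the signs of
  certain linear coordinates are constant, and an explicit line that exhausts the set cut out by
  these invariants must be the whole leaf. Constancy of the coordinates cannot be shown by
  differentiating them: a line of the first foliation may lie where the other two roots coincide,
  and there they need not be differentiable. It is shown through the value of the characteristic
  polynomial at a fixed argument, which is polynomial in X, Y, Z. Type D1 comes from the fact that
  the height of a quadric over a tangent space solves a quadratic equation, so that the cubic part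
  of the graph can be computed without coordinates of the point.\<close>

lemma Ck_on_cong:
  assumes "open U" "\<And>x. x \<in> U \<Longrightarrow> f x = g x" "Ck_on k U f"
  shows "Ck_on k U g"
  using assms(2,3)
proof (induction k arbitrary: f g)
  case 0
  then show ?case by (metis Ck_on.simps(1) continuous_on_cong)
next
  case (Suc k)
  have D: "(g has_derivative frechet_derivative f (at x)) (at x)" if "x \<in> U" for x
    using Suc.prems that frechet_derivative_works has_derivative_transform_within_open[OF _ \<open>open U\<close> that]
    by (metis Ck_on.simps(2))
  moreover have "Ck_on k U (dir_deriv v g)" for v
    by (rule Suc.IH[of "dir_deriv v f"])
      (use Suc.prems in \<open>auto simp: dir_deriv_def frechet_derivative_at[OF D, symmetric]\<close>)
  ultimately show ?case by (auto simp: differentiable_def)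
qed

text \<open>Derivatives at points of an open set are unique, so any formula for them may replace the
  chosen \<open>frechet_derivative\<close>. Most closure rules below raise the order in this
  way.\<close>

lemma Ck_on_SucI:
  assumes "open U" "\<And>x. x \<in> U \<Longrightarrow> (f has_derivative f' x) (at x)" "\<And>v. Ck_on k U (\<lambda>x. f' x v)"
  shows "Ck_on (Suc k) U f"
proof -
  have "Ck_on k U (dir_deriv v f)" for v
    by (rule Ck_on_cong[OF assms(1) _ assms(3)[of v]])
      (metis assms(2) dir_deriv_def frechet_derivative_at)
  then show ?thesis using assms(2) by (auto simp: differentiable_def)
qed

lemma Ck_on_SucD:
  assumes "Ck_on (Suc k) U f"
  shows "\<And>x. x \<in> U \<Longrightarrow> (f has_derivative (\<lambda>v. dir_deriv v f x)) (at x)"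
    "\<And>v. Ck_on k U (dir_deriv v f)"
  using assms by (auto simp: dir_deriv_def eta_contract_eq frechet_derivative_works[symmetric])

lemma Ck_on_Suc_imp: "Ck_on (Suc k) U f \<Longrightarrow> Ck_on k U f"
proof (induction k arbitrary: f)
  case 0
  then show ?case
    by (auto intro!: continuous_at_imp_continuous_on differentiable_imp_continuous_within)
next
  case (Suc k)
  then show ?case by (metis Ck_on.simps(2))
qed

lemma Ck_on_subset: "Ck_on k U f \<Longrightarrow> V \<subseteq> U \<Longrightarrow> Ck_on k V f"
  by (induction k arbitrary: f) (auto intro: continuous_on_subset)

lemma Ck_on_const: "Ck_on k U (\<lambda>x. c)"
proof (induction k arbitrary: c)
  case (Suc k)
  then show ?case by (simp add: dir_deriv_def)
qed simp

lemma Ck_on_linear: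
  assumes "bounded_linear f" "open U"
  shows "Ck_on k U f"
proof (cases k)
  case 0
  then show ?thesis using assms by (simp add: linear_continuous_on)
next
  case (Suc j)
  show ?thesis unfolding Suc
    by (rule Ck_on_SucI[OF assms(2)])
      (use assms in \<open>auto intro: bounded_linear_imp_has_derivative Ck_on_const\<close>)
qed

lemma Ck_on_add:
  "open U \<Longrightarrow> Ck_on k U f \<Longrightarrow> Ck_on k U g \<Longrightarrow> Ck_on k U (\<lambda>x. f x + g x)"
proof (induction k arbitrary: f g)
  case 0
  then show ?case by (auto intro: continuous_intros)
next
  case (Suc k)
  show ?case
    by (rule Ck_on_SucI[OF Suc.prems(1)
          has_derivative_add[OF Ck_on_SucD(1)[OF Suc.prems(2)] Ck_on_SucD(1)[OF Suc.prems(3)]]])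
      (use Suc in \<open>auto intro!: Suc.IH\<close>)
qed

lemma Ck_on_minus:
  fixes f :: "'a::euclidean_space \<Rightarrow> 'b::euclidean_space"
  assumes "open U" "Ck_on k U f"
  shows "Ck_on k U (\<lambda>x. - f x)"
  using assms(2)
proof (induction k arbitrary: f)
  case 0
  then show ?case by (auto intro: continuous_intros)
next
  case (Suc k)
  show ?case
    by (rule Ck_on_SucI[OF assms(1) has_derivative_minus[OF Ck_on_SucD(1)[OF Suc.prems]]])
      (auto intro!: Suc.IH Ck_on_SucD(2)[OF Suc.prems])
qed

text \<open>The Leibniz rule keeps one factor undifferentiated, which the induction hypothesis
  accepts because order \<open>Suc k\<close> implies order \<open>k\<close>. One proof serves scalar
  multiples, products and inner products.\<close>

lemma Ck_on_bilinear:
  assumes "bounded_bilinear pr" "open U"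
  shows "Ck_on k U f \<Longrightarrow> Ck_on k U g \<Longrightarrow> Ck_on k U (\<lambda>x. pr (f x) (g x))"
proof (induction k arbitrary: f g)
  case 0
  then show ?case using bounded_bilinear.continuous_on[OF assms(1)] by auto
next
  case (Suc k)
  show ?case
    by (rule Ck_on_SucI[OF assms(2) bounded_bilinear.FDERIV[OF assms(1)
            Ck_on_SucD(1)[OF Suc.prems(1)] Ck_on_SucD(1)[OF Suc.prems(2)]]])
      (auto intro!: Ck_on_add assms Suc.IH Ck_on_SucD(2)[OF Suc.prems(1)]
          Ck_on_SucD(2)[OF Suc.prems(2)] Ck_on_Suc_imp[OF Suc.prems(1)] Ck_on_Suc_imp[OF Suc.prems(2)])
qed

lemma Ck_on_sum:
  "open U \<Longrightarrow> (\<And>i. i \<in> I \<Longrightarrow> Ck_on k U (f i)) \<Longrightarrow> Ck_on k U (\<lambda>x. \<Sum>i\<in>I. f i x)"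
  by (induction I rule: infinite_finite_induct) (auto intro: Ck_on_const Ck_on_add)

text \<open>In the chain rule the direction in which \<open>g\<close> is differentiated varies with
  the point, while \<open>dir_deriv\<close> takes a fixed one. Expanding that direction in
  \<open>Basis\<close> leaves derivatives of \<open>g\<close> along constant vectors, to which the
  induction hypothesis applies.\<close>

lemma Ck_on_compose:
  assumes "open U" "open V"
  shows "Ck_on k U f \<Longrightarrow> Ck_on k V g \<Longrightarrow> f ` U \<subseteq> V \<Longrightarrow> Ck_on k U (\<lambda>x. g (f x))"
proof (induction k arbitrary: f g)
  case 0
  then show ?case by (auto intro: continuous_on_compose2)
next
  case (Suc k)
  let ?f' = "\<lambda>x v. \<Sum>b\<in>Basis. (dir_deriv v f x \<bullet> b) *\<^sub>R dir_deriv b g (f x)"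
  have "((\<lambda>x. g (f x)) has_derivative ?f' x) (at x)" if "x \<in> U" for x
  proof -
    have g': "(g has_derivative (\<lambda>v. dir_deriv v g (f x))) (at (f x))"
      using Ck_on_SucD(1)[OF Suc.prems(2)] Suc.prems(3) that by auto
    then interpret G: bounded_linear "\<lambda>v. dir_deriv v g (f x)" by (rule has_derivative_bounded_linear)
    have "dir_deriv (dir_deriv v f x) g (f x) = ?f' x v" for v
      using G.sum[of "\<lambda>b. (dir_deriv v f x \<bullet> b) *\<^sub>R b" Basis]
      by (simp add: G.scaleR euclidean_representation)
    then show ?thesis
      using has_derivative_compose[OF Ck_on_SucD(1)[OF Suc.prems(1) that] g'] by presburger
  qed
  moreover have "Ck_on k U (\<lambda>x. ?f' x v)" for v
  proof (rule Ck_on_sum[OF assms(1)])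
    fix b :: 'b
    show "Ck_on k U (\<lambda>x. (dir_deriv v f x \<bullet> b) *\<^sub>R dir_deriv b g (f x))"
      by (rule Ck_on_bilinear[OF bounded_bilinear_scaleR assms(1)
            Ck_on_bilinear[OF bounded_bilinear_inner assms(1) Ck_on_SucD(2)[OF Suc.prems(1)] Ck_on_const]
            Suc.IH[OF Ck_on_Suc_imp[OF Suc.prems(1)] Ck_on_SucD(2)[OF Suc.prems(2)] Suc.prems(3)]])
  qed
  ultimately show ?case by (rule Ck_on_SucI[OF assms(1)])
qed

section \<open>Closure rules for smooth maps\<close>

named_theorems smooth_intros

lemma smooth_on_cong: "open U \<Longrightarrow> (\<And>x. x \<in> U \<Longrightarrow> f x = g x) \<Longrightarrow> smooth_on U f \<Longrightarrow> smooth_on U g"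
  unfolding smooth_on_def by (blast intro: Ck_on_cong)

lemma smooth_on_subset: "smooth_on U f \<Longrightarrow> V \<subseteq> U \<Longrightarrow> smooth_on V f"
  unfolding smooth_on_def by (blast intro: Ck_on_subset)

lemma smooth_on_const [smooth_intros]: "smooth_on U (\<lambda>x. c)"
  by (simp add: smooth_on_def Ck_on_const)

lemma smooth_on_linear: "bounded_linear f \<Longrightarrow> open U \<Longrightarrow> smooth_on U f"
  by (simp add: smooth_on_def Ck_on_linear)

lemma smooth_on_ident [smooth_intros]: "open U \<Longrightarrow> smooth_on U (\<lambda>x. x)"
  by (rule smooth_on_linear[OF bounded_linear_ident])

lemma smooth_on_compose:
  "smooth_on U f \<Longrightarrow> smooth_on V g \<Longrightarrow> f ` U \<subseteq> V \<Longrightarrow> open U \<Longrightarrow> open V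
    \<Longrightarrow> smooth_on U (\<lambda>x. g (f x))"
  by (auto simp: smooth_on_def intro: Ck_on_compose)

lemma smooth_on_bounded_linear:
  "bounded_linear L \<Longrightarrow> open U \<Longrightarrow> smooth_on U f \<Longrightarrow> smooth_on U (\<lambda>x. L (f x))"
  by (rule smooth_on_compose[of _ _ UNIV L]) (auto intro: smooth_on_linear)

lemma smooth_on_add [smooth_intros]:
  "smooth_on U f \<Longrightarrow> smooth_on U g \<Longrightarrow> open U \<Longrightarrow> smooth_on U (\<lambda>x. f x + g x)"
  by (simp add: smooth_on_def Ck_on_add)

lemma smooth_on_scaleR [smooth_intros]:
  "smooth_on U f \<Longrightarrow> smooth_on U g \<Longrightarrow> open U \<Longrightarrow> smooth_on U (\<lambda>x. f x *\<^sub>R g x)"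
  by (simp add: smooth_on_def Ck_on_bilinear[OF bounded_bilinear_scaleR])

lemma smooth_on_mult [smooth_intros]:
  fixes f g :: "'a::euclidean_space \<Rightarrow> real"
  shows "smooth_on U f \<Longrightarrow> smooth_on U g \<Longrightarrow> open U \<Longrightarrow> smooth_on U (\<lambda>x. f x * g x)"
  by (simp add: smooth_on_def Ck_on_bilinear[OF bounded_bilinear_mult])

lemma smooth_on_minus [smooth_intros]:
  "smooth_on U f \<Longrightarrow> open U \<Longrightarrow> smooth_on U (\<lambda>x. - f x)"
  by (simp add: smooth_on_def Ck_on_minus)

lemma smooth_on_diff [smooth_intros]:
  "smooth_on U f \<Longrightarrow> smooth_on U g \<Longrightarrow> open U \<Longrightarrow> smooth_on U (\<lambda>x. f x - g x)"
  using smooth_on_add[of U f "\<lambda>x. - g x"] smooth_on_minus[of U g] by simp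

lemma smooth_on_power [smooth_intros]:
  fixes f :: "'a::euclidean_space \<Rightarrow> real"
  shows "smooth_on U f \<Longrightarrow> open U \<Longrightarrow> smooth_on U (\<lambda>x. f x ^ n)"
  by (induction n) (auto intro: smooth_intros)

lemma smooth_on_inner_left [smooth_intros]:
  "smooth_on U f \<Longrightarrow> open U \<Longrightarrow> smooth_on U (\<lambda>x. f x \<bullet> c)"
  by (rule smooth_on_bounded_linear[OF bounded_linear_inner_left])

lemma smooth_on_nth [smooth_intros]:
  fixes f :: "'a::euclidean_space \<Rightarrow> real^'n"
  shows "smooth_on U f \<Longrightarrow> open U \<Longrightarrow> smooth_on U (\<lambda>x. f x $ i)"
  by (rule smooth_on_bounded_linear[OF bounded_linear_vec_nth])

lemma smooth_on_fst [smooth_intros]: "smooth_on U f \<Longrightarrow> open U \<Longrightarrow> smooth_on U (\<lambda>x. fst (f x))"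
  by (rule smooth_on_bounded_linear[OF bounded_linear_fst])

lemma smooth_on_snd [smooth_intros]: "smooth_on U f \<Longrightarrow> open U \<Longrightarrow> smooth_on U (\<lambda>x. snd (f x))"
  by (rule smooth_on_bounded_linear[OF bounded_linear_snd])

lemma smooth_on_Pair [smooth_intros]:
  assumes "smooth_on U f" "smooth_on U g" "open U"
  shows "smooth_on U (\<lambda>x. (f x, g x))"
proof -
  have "bounded_linear (\<lambda>x::'b. (x, 0::'c))" "bounded_linear (\<lambda>x::'c. (0::'b, x))"
    by (auto intro: bounded_linear_Pair bounded_linear_ident bounded_linear_zero)
  then show ?thesis
    using smooth_on_add[OF smooth_on_bounded_linear smooth_on_bounded_linear] assms by fastforce
qed

lemma smooth_on_vec:
  fixes f :: "'a::euclidean_space \<Rightarrow> real^'n"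
  assumes "\<And>i. smooth_on U (\<lambda>x. f x $ i)" "open U"
  shows "smooth_on U f"
proof -
  have "smooth_on U (\<lambda>x. \<Sum>i\<in>UNIV. (f x $ i) *\<^sub>R axis i (1::real))"
    unfolding smooth_on_def
    by (intro allI Ck_on_sum assms(2))
      (use assms(1) in \<open>auto simp: smooth_on_def
          intro!: Ck_on_bilinear[OF bounded_bilinear_scaleR assms(2)] Ck_on_const\<close>)
  moreover have "(\<Sum>i\<in>UNIV. (f x $ i) *\<^sub>R axis i (1::real)) = f x" for x
    using basis_expansion[of "f x"] by (simp add: scalar_mult_eq_scaleR)
  ultimately show ?thesis by simp
qed

lemma smooth_on_vector2 [smooth_intros]:
  "smooth_on U f1 \<Longrightarrow> smooth_on U f2 \<Longrightarrow> open U
    \<Longrightarrow> smooth_on U (\<lambda>x. vector [f1 x, f2 x] :: real^2)"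
  by (rule smooth_on_vec) (metis (no_types, lifting) exhaust_2 vector_2 ext)+

lemma smooth_on_vector3 [smooth_intros]:
  assumes "smooth_on U f1" "smooth_on U f2" "smooth_on U f3" "open U"
  shows "smooth_on U (\<lambda>x. vector [f1 x, f2 x, f3 x] :: real^3)"
proof (rule smooth_on_vec)
  fix i :: 3 show "smooth_on U (\<lambda>x. (vector [f1 x, f2 x, f3 x] :: real^3) $ i)"
    using exhaust_3[of i] assms by auto
qed fact

lemma smooth_on_vector4 [smooth_intros]:
  assumes "smooth_on U f1" "smooth_on U f2" "smooth_on U f3" "smooth_on U f4" "open U"
  shows "smooth_on U (\<lambda>x. vector [f1 x, f2 x, f3 x, f4 x] :: real^4)"
proof (rule smooth_on_vec)
  fix i :: 4 show "smooth_on U (\<lambda>x. (vector [f1 x, f2 x, f3 x, f4 x] :: real^4) $ i)"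
    using exhaust_4[of i] assms by auto
qed fact

section \<open>Smoothness of elementary functions\<close>

lemma smooth_on_exp [smooth_intros]: "smooth_on UNIV (exp :: real \<Rightarrow> real)"
proof -
  have "Ck_on k UNIV (exp :: real \<Rightarrow> real)" for k
  proof (induction k)
    case (Suc k)
    have "(exp has_derivative (\<lambda>v. exp x * v)) (at x)" for x :: real
      using DERIV_exp[of x] by (simp add: has_field_derivative_def)
    then show ?case
      by (rule Ck_on_SucI[OF open_UNIV])
        (auto intro!: Ck_on_bilinear[OF bounded_bilinear_mult] Ck_on_minus Ck_on_const Suc)
  qed (auto intro: continuous_intros)
  then show ?thesis by (simp add: smooth_on_def)
qed

text \<open>Each function is up to sign the derivative of the other, so the induction on the order
  has to treat both at once.\<close>

lemma smooth_on_sin_cos: "smooth_on UNIV (sin :: real \<Rightarrow> real)" "smooth_on UNIV (cos :: real \<Rightarrow> real)"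
proof -
  have "Ck_on k UNIV (sin :: real \<Rightarrow> real) \<and> Ck_on k UNIV (cos :: real \<Rightarrow> real)" for k
  proof (induction k)
    case (Suc k)
    have s: "(sin has_derivative (\<lambda>v. cos x * v)) (at x)" for x :: real
      using DERIV_sin[of x] by (simp add: has_field_derivative_def)
    have "(cos has_derivative (*) (- sin x)) (at x)" for x :: real
      using DERIV_cos[of x] by (simp add: has_field_derivative_def)
    then have "Ck_on (Suc k) UNIV (cos :: real \<Rightarrow> real)"
      by (rule Ck_on_SucI[OF open_UNIV])
        (use Suc in \<open>auto intro!: Ck_on_bilinear[OF bounded_bilinear_mult] Ck_on_minus Ck_on_const\<close>)
    moreover have "Ck_on (Suc k) UNIV (sin :: real \<Rightarrow> real)"
      by (rule Ck_on_SucI[OF open_UNIV s])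
        (use Suc in \<open>auto intro!: Ck_on_bilinear[OF bounded_bilinear_mult] Ck_on_minus Ck_on_const\<close>)
    ultimately show ?case by simp
  qed (auto intro: continuous_intros)
  then show "smooth_on UNIV (sin :: real \<Rightarrow> real)" "smooth_on UNIV (cos :: real \<Rightarrow> real)"
    by (auto simp: smooth_on_def)
qed

text \<open>The derivative is minus the product of the function with itself, so the product rule
  alone raises the order.\<close>

lemma smooth_on_inverse_real: "smooth_on (- {0}) (inverse :: real \<Rightarrow> real)"
proof -
  have "Ck_on k (- {0}) (inverse :: real \<Rightarrow> real)" for k
  proof (induction k)
    case (Suc k)
    have "(inverse has_derivative (*) (- (inverse x * inverse x))) (at x)" if "x \<in> - {0}" for x :: real
      using DERIV_inverse[of x] that by (simp add: has_field_derivative_def power2_eq_square)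
    then show ?case
      by (rule Ck_on_SucI[rotated])
        (auto intro!: Ck_on_bilinear[OF bounded_bilinear_mult] Ck_on_minus Ck_on_const Suc)
  qed (auto intro!: continuous_intros)
  then show ?thesis by (simp add: smooth_on_def)
qed

lemma smooth_on_ln_real: "smooth_on {0<..} (ln :: real \<Rightarrow> real)"
proof -
  have "Ck_on k {0<..} (ln :: real \<Rightarrow> real)" for k
  proof (cases k)
    case (Suc j)
    have "(ln has_derivative (\<lambda>v. inverse x * v)) (at x)" if "x \<in> {0<..}" for x :: real
      using DERIV_ln[of x] that by (simp add: has_field_derivative_def)
    moreover have "Ck_on j {0<..} (inverse :: real \<Rightarrow> real)"
      using smooth_on_subset[OF smooth_on_inverse_real, of "{0<..}"] by (auto simp: smooth_on_def)
    ultimately show ?thesis unfolding Suc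
      by (intro Ck_on_SucI[where f' = "\<lambda>x v. inverse x * v"]) (auto intro!: Ck_on_bilinear[OF bounded_bilinear_mult] Ck_on_minus Ck_on_const)
  qed (auto intro!: continuous_intros)
  then show ?thesis by (simp add: smooth_on_def)
qed

lemma smooth_on_inverse [smooth_intros]:
  fixes f :: "'a::euclidean_space \<Rightarrow> real"
  shows "smooth_on U f \<Longrightarrow> open U \<Longrightarrow> (\<And>x. x \<in> U \<Longrightarrow> f x \<noteq> 0) \<Longrightarrow> smooth_on U (\<lambda>x. inverse (f x))"
  by (rule smooth_on_compose[OF _ smooth_on_inverse_real]) auto

lemma smooth_on_divide [smooth_intros]:
  fixes f :: "'a::euclidean_space \<Rightarrow> real"
  shows "smooth_on U f \<Longrightarrow> smooth_on U g \<Longrightarrow> open U \<Longrightarrow> (\<And>x. x \<in> U \<Longrightarrow> g x \<noteq> 0)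
    \<Longrightarrow> smooth_on U (\<lambda>x. f x / g x)"
  unfolding divide_inverse by (intro smooth_intros)

lemma smooth_on_ln [smooth_intros]:
  fixes f :: "'a::euclidean_space \<Rightarrow> real"
  shows "smooth_on U f \<Longrightarrow> open U \<Longrightarrow> (\<And>x. x \<in> U \<Longrightarrow> f x > 0) \<Longrightarrow> smooth_on U (\<lambda>x. ln (f x))"
  by (rule smooth_on_compose[OF _ smooth_on_ln_real]) auto

lemma smooth_on_exp_comp [smooth_intros]:
  fixes f :: "'a::euclidean_space \<Rightarrow> real"
  shows "smooth_on U f \<Longrightarrow> open U \<Longrightarrow> smooth_on U (\<lambda>x. exp (f x))"
  by (rule smooth_on_compose[OF _ smooth_on_exp]) auto

lemma smooth_on_sin [smooth_intros]: "smooth_on U f \<Longrightarrow> open U \<Longrightarrow> smooth_on U (\<lambda>x. sin (f x :: real))"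
  and smooth_on_cos [smooth_intros]: "smooth_on U f \<Longrightarrow> open U \<Longrightarrow> smooth_on U (\<lambda>x. cos (f x :: real))"
  by (auto intro!: smooth_on_compose[OF _ smooth_on_sin_cos(1)] smooth_on_compose[OF _ smooth_on_sin_cos(2)])

text \<open>On positive values the root is an exponential of a logarithm, which reduces it to the
  rules already available.\<close>

lemma smooth_on_sqrt [smooth_intros]:
  fixes f :: "'a::euclidean_space \<Rightarrow> real"
  assumes "smooth_on U f" "open U" "\<And>x. x \<in> U \<Longrightarrow> f x > 0"
  shows "smooth_on U (\<lambda>x. sqrt (f x))"
proof (rule smooth_on_cong[OF assms(2)])
  show "exp (ln (f x) * (1/2)) = sqrt (f x)" if "x \<in> U" for x
    using assms(3)[OF that] by (simp add: powr_half_sqrt[symmetric] powr_def mult.commute)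
  show "smooth_on U (\<lambda>x. exp (ln (f x) * (1/2)))"
    by (intro smooth_intros assms)
qed

lemma smooth_on_continuous: "smooth_on U f \<Longrightarrow> continuous_on U f"
  unfolding smooth_on_def by (metis Ck_on.simps(1))

lemma smooth_on_differentiable: "smooth_on U f \<Longrightarrow> x \<in> U \<Longrightarrow> f differentiable (at x)"
  unfolding smooth_on_def by (metis Ck_on.simps(2))

lemma smooth_on_has_vector_derivative:
  "smooth_on I (f :: real \<Rightarrow> 'a::euclidean_space) \<Longrightarrow> s \<in> I
    \<Longrightarrow> (f has_vector_derivative vector_derivative f (at s)) (at s)"
  using smooth_on_differentiable vector_derivative_works by blast

section \<open>Smooth maps and diffeomorphisms on arbitrary subsets\<close>

lemma smooth_map_onI:
  "open U \<Longrightarrow> A \<subseteq> U \<Longrightarrow> smooth_on U f \<Longrightarrow> smooth_map_on A f"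
  unfolding smooth_map_on_def by blast

lemma smooth_map_on_continuous: 
  assumes "smooth_map_on A f" shows "continuous_on A f"
proof (rule continuous_on_eq_continuous_within[THEN iffD2], rule ballI)
  fix x assume "x \<in> A"
  then obtain U g where U: "open U" "x \<in> U" "smooth_on U g" "\<forall>y\<in>A \<inter> U. g y = f y"
    using assms unfolding smooth_map_on_def by blast
  then have "continuous (at x within A) g"
    using smooth_on_continuous continuous_on_eq_continuous_at continuous_at_imp_continuous_at_within by blast
  then have "(g \<longlongrightarrow> f x) (at x within A)"
    using U \<open>x \<in> A\<close> by (simp add: continuous_within)
  moreover have "\<forall>\<^sub>F y in at x within A. g y = f y"
    unfolding eventually_at_topological using U by blast
  ultimately show "continuous (at x within A) f"
    unfolding continuous_within by (rule Lim_transform_eventually)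
qed

text \<open>Smooth maps on subsets are continuous, so mutually inverse smooth maps already form the
  homeomorphism that the definition asks for.\<close>

lemma diffeomorphicI:
  assumes "smooth_map_on A f" "smooth_map_on B g"
    "\<And>x. x \<in> A \<Longrightarrow> f x \<in> B" "\<And>y. y \<in> B \<Longrightarrow> g y \<in> A"
    "\<And>x. x \<in> A \<Longrightarrow> g (f x) = x" "\<And>y. y \<in> B \<Longrightarrow> f (g y) = y"
  shows "diffeomorphic A B"
proof -
  have "f ` A = B" "g ` B = A" using assms(3-6) by force+
  then have "homeomorphism A B f g"
    using assms(5,6) smooth_map_on_continuous[OF assms(1)] smooth_map_on_continuous[OF assms(2)]
    unfolding homeomorphism_def by blast
  then show ?thesis using assms(1,2) unfolding diffeomorphic_def by blast
qed

lemma smooth_map_on_compose: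
  assumes "smooth_map_on A f" "smooth_map_on B g" "f ` A \<subseteq> B"
  shows "smooth_map_on A (\<lambda>x. g (f x))"
  unfolding smooth_map_on_def
proof
  fix x assume x: "x \<in> A"
  obtain U F where U: "open U" "x \<in> U" "smooth_on U F" "\<forall>y\<in>A \<inter> U. F y = f y"
    using assms(1) x unfolding smooth_map_on_def by blast
  obtain V G where V: "open V" "f x \<in> V" "smooth_on V G" "\<forall>y\<in>B \<inter> V. G y = g y"
    using assms(2,3) x unfolding smooth_map_on_def by blast
  \<comment> \<open>Shrinking \<open>U\<close> makes the extension \<open>F\<close> take values
    where \<open>G\<close> is defined, also at points outside \<open>A\<close>.\<close>
  let ?W = "U \<inter> F -` V"
  have "open ?W"
    using continuous_open_preimage[OF smooth_on_continuous[OF U(3)] U(1) V(1)] .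
  moreover have "x \<in> ?W" using U V x by auto
  moreover have "smooth_on ?W (\<lambda>x. G (F x))"
    using smooth_on_compose[OF smooth_on_subset[OF U(3)] V(3), of ?W] \<open>open ?W\<close> V(1) by auto
  moreover have "\<forall>y\<in>A \<inter> ?W. G (F y) = g (f y)"
    using U(4) V(4) assms(3) by (auto simp: image_subset_iff)
  ultimately show "\<exists>U h. open U \<and> x \<in> U \<and> smooth_on U h \<and> (\<forall>y\<in>A \<inter> U. h y = g (f y))"
    by blast
qed

lemma diffeomorphic_trans:
  assumes "diffeomorphic A B" "diffeomorphic B C"
  shows "diffeomorphic A C"
proof -
  obtain f g where fg: "homeomorphism A B f g" "smooth_map_on A f" "smooth_map_on B g"
    using assms(1) unfolding diffeomorphic_def by blast
  obtain h k where hk: "homeomorphism B C h k" "smooth_map_on B h" "smooth_map_on C k"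
    using assms(2) unfolding diffeomorphic_def by blast
  show ?thesis
    by (rule diffeomorphicI[OF smooth_map_on_compose[OF fg(2) hk(2)] smooth_map_on_compose[OF hk(3) fg(3)]])
      (use fg(1) hk(1) in \<open>auto simp: homeomorphism_def\<close>)
qed

text \<open>The maps are the logit of the relative position in the interval and a rescaled logistic
  function.\<close>

lemma diffeomorphic_interval_UNIV:
  fixes l u :: real
  assumes "l < u"
  shows "diffeomorphic {l<..<u} (UNIV :: real set)"
proof (rule diffeomorphicI)
  show "smooth_map_on {l<..<u} (\<lambda>t. ln ((t - l) / (u - t)))"
    by (rule smooth_map_onI[of "{l<..<u}"]) (auto intro!: smooth_intros)
  show "smooth_map_on UNIV (\<lambda>s. (u * exp s + l) / (1 + exp s))"
  proof (rule smooth_map_onI[of UNIV])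
    have "1 + exp s \<noteq> 0" for s :: real using exp_gt_zero[of s] by linarith
    then show "smooth_on UNIV (\<lambda>s. (u * exp s + l) / (1 + exp s))"
      by (intro smooth_intros open_UNIV)
  qed auto
  show "(u * exp s + l) / (1 + exp s) \<in> {l<..<u}" for s
  proof -
    have "1 + exp s > 0" by (simp add: add_pos_pos)
    then show ?thesis using assms
      by (simp add: pos_less_divide_eq pos_divide_less_eq algebra_simps)
  qed
  show "(u * exp (ln ((t - l) / (u - t))) + l) / (1 + exp (ln ((t - l) / (u - t)))) = t"
    if "t \<in> {l<..<u}" for t
  proof -
    have p: "t - l > 0" "u - t > 0" "u - l > 0" using that assms by auto
    have "1 + (t - l) / (u - t) = (u - l) / (u - t)"
      "u * ((t - l) / (u - t)) + l = t * (u - l) / (u - t)"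
      using p by (simp_all add: field_simps)
    then show ?thesis using p by simp
  qed
  show "ln (((u * exp s + l) / (1 + exp s) - l) / (u - (u * exp s + l) / (1 + exp s))) = s" for s
  proof -
    have e: "1 + exp s > 0" by (simp add: add_pos_pos)
    have "(u * exp s + l) / (1 + exp s) - l = (u - l) * exp s / (1 + exp s)"
      "u - (u * exp s + l) / (1 + exp s) = (u - l) / (1 + exp s)"
      using e by (simp_all add: field_simps)
    then show ?thesis using assms e by simp
  qed
qed auto

lemma diffeomorphic_greaterThan_UNIV: "diffeomorphic {0::real<..} (UNIV :: real set)"
proof (rule diffeomorphicI)
  show "smooth_map_on {0<..} (ln :: real \<Rightarrow> real)"
    by (rule smooth_map_onI[of "{0<..}"]) (auto intro: smooth_on_ln_real)
  show "smooth_map_on UNIV (exp :: real \<Rightarrow> real)"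
    by (rule smooth_map_onI[of UNIV]) (auto intro: smooth_on_exp)
qed auto

text \<open>The sign of \<open>f\<close> makes both pieces relatively open in the union, so no
  connected subset meets both. This serves the two sheets and the two branches of the focal
  hyperbola.\<close>

lemma components_two_signs:
  fixes f :: "'a::topological_space \<Rightarrow> real"
  assumes "connected A" "connected B" "A \<noteq> {}" "B \<noteq> {}"
    "\<And>x. x \<in> A \<Longrightarrow> f x > 0" "\<And>x. x \<in> B \<Longrightarrow> f x < 0" "continuous_on (A \<union> B) f"
  shows "components (A \<union> B) = {A, B}"
proof -
  have opn: "openin (top_of_set (A \<union> B)) ((A \<union> B) \<inter> f -` {0<..})"
    "openin (top_of_set (A \<union> B)) ((A \<union> B) \<inter> f -` {..<0})"
    by (auto intro!: continuous_openin_preimage_gen assms(7))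
  have eq: "(A \<union> B) \<inter> f -` {0<..} = A" "(A \<union> B) \<inter> f -` {..<0} = B"
    using assms(5,6) by (auto simp: not_less[symmetric] dest: less_asym)
  have oA: "openin (top_of_set (A \<union> B)) A" and oB: "openin (top_of_set (A \<union> B)) B"
    using opn by (simp_all only: eq)
  have disj: "A \<inter> B = {}" using assms(5,6) by (force dest: less_asym)
  have max: "T = S" if T: "connected T" "S \<subseteq> T" "T \<subseteq> A \<union> B" and S: "S = A \<or> S = B" "S \<noteq> {}" for S T
  proof (rule ccontr)
    assume ne: "T \<noteq> S"
    obtain A' B' where "open A'" "A = (A \<union> B) \<inter> A'" "open B'" "B = (A \<union> B) \<inter> B'"
      using oA oB unfolding openin_open by blast
    then have "T \<inter> A = T \<inter> A'" "T \<inter> B = T \<inter> B'" using T(3) by blast+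
    then have "openin (top_of_set T) (T \<inter> A)" "openin (top_of_set T) (T \<inter> B)"
      using \<open>open A'\<close> \<open>open B'\<close> unfolding openin_open by blast+
    moreover have "T \<inter> A \<noteq> {}" "T \<inter> B \<noteq> {}" using T S ne disj by auto
    moreover have "T \<subseteq> (T \<inter> A) \<union> (T \<inter> B)" using T by auto
    ultimately show False using T(1) disj unfolding connected_openin by blast
  qed
  have AB: "A \<in> components (A \<union> B)" "B \<in> components (A \<union> B)"
    unfolding in_components_maximal using assms(1-4) max[of _ A] max[of _ B] by auto
  moreover have "S \<in> {A, B}" if S: "S \<in> components (A \<union> B)" for S
  proof -
    obtain x where "x \<in> S" using in_components_nonempty[OF S] by blast
    then have "x \<in> A \<or> x \<in> B" using in_components_subset[OF S] by blast
    then show ?thesis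
      using components_eq[OF S AB(1)] components_eq[OF S AB(2)] \<open>x \<in> S\<close> by auto
  qed
  ultimately show ?thesis by blast
qed

text \<open>An integrating factor turns the equation into \<open>(f e\<^sup>-\<^sup>H)' = 0\<close>.\<close>

lemma linear_ode_zero:
  fixes f h :: "real \<Rightarrow> real"
  assumes I: "is_interval I" "s0 \<in> I" "s1 \<in> I"
    and h: "continuous_on I h"
    and f: "\<And>s. s \<in> I \<Longrightarrow> (f has_real_derivative h s * f s) (at s)"
    and z: "f s0 = 0"
  shows "f s1 = 0"
proof -
  define l u where "l = min s0 s1" and "u = max s0 s1"
  have sub: "{l..u} \<subseteq> I"
  proof
    fix x assume "x \<in> {l..u}"
    then have "s0 \<le> x \<and> x \<le> s1 \<or> s1 \<le> x \<and> x \<le> s0" by (auto simp: l_def u_def)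
    then show "x \<in> I" using I unfolding is_interval_1 by blast
  qed
  obtain H where H: "\<And>x. x \<in> {l..u} \<Longrightarrow> (H has_vector_derivative h x) (at x within {l..u})"
    using antiderivative_continuous[OF continuous_on_subset[OF h sub]] by blast
  have "((\<lambda>s. f s * exp (- H s)) has_derivative (\<lambda>h. 0)) (at s within {l..u})" if "s \<in> {l..u}" for s
  proof -
    have "((\<lambda>s. f s * exp (- H s)) has_real_derivative
       h s * f s * exp (- H s) + exp (- H s) * (- h s) * f s) (at s within {l..u})"
      using H[OF that, folded has_real_derivative_iff_has_vector_derivative]
        f[THEN has_field_derivative_at_within, of s "{l..u}"] that sub
      by (auto intro!: derivative_eq_intros)
    then show ?thesis by (simp add: has_field_derivative_def lambda_zero)
  qed
  then obtain k where k: "\<And>s. s \<in> {l..u} \<Longrightarrow> f s * exp (- H s) = k"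
    using has_derivative_zero_constant[of "{l..u}" "\<lambda>s. f s * exp (- H s)"] by auto
  have "s0 \<in> {l..u}" "s1 \<in> {l..u}" by (auto simp: l_def u_def)
  then show ?thesis using k[of s0] k[of s1] z by simp
qed

subsection \<open>Diagonalization of a self-adjoint map on a three-dimensional subspace\<close>

text \<open>The Rayleigh quotient attains its maximum on the compact unit sphere of
  \<open>S\<close>, and there its first variation in orthogonal directions vanishes. The bound in
  the conclusion is what orders the eigenvalues later.\<close>

lemma max_eigenvector:
  fixes f :: "'a::euclidean_space \<Rightarrow> 'a"
  assumes f: "linear f" and S: "subspace S" "S \<noteq> {0}" "f ` S \<subseteq> S"
    and sym: "\<And>x y. x \<in> S \<Longrightarrow> y \<in> S \<Longrightarrow> f x \<bullet> y = x \<bullet> f y"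
  obtains e k where "e \<in> S" "norm e = 1" "f e = k *\<^sub>R e" "\<And>x. x \<in> S \<Longrightarrow> x \<bullet> f x \<le> k * (x \<bullet> x)"
proof -
  let ?K = "S \<inter> sphere 0 1"
  obtain x0 where x0: "x0 \<in> S" "x0 \<noteq> 0" using S subspace_0 by blast
  have "sgn x0 \<in> ?K" using x0 S(1) by (auto simp: sgn_div_norm norm_sgn subspace_scale)
  moreover have "compact ?K"
    by (intro closed_Int_compact closed_subspace S(1) compact_sphere)
  moreover have "continuous_on ?K (\<lambda>x. x \<bullet> f x)"
    using linear_continuous_on[of f] f by (intro continuous_intros) (auto simp: linear_conv_bounded_linear)
  ultimately obtain e where e: "e \<in> ?K" "\<And>y. y \<in> ?K \<Longrightarrow> y \<bullet> f y \<le> e \<bullet> f e"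
    using continuous_attains_sup[of ?K "\<lambda>x. x \<bullet> f x"] by blast
  define k where "k = e \<bullet> f e"
  have le: "x \<bullet> f x \<le> k * (x \<bullet> x)" if "x \<in> S" for x
  proof (cases "x = 0")
    case False
    have "sgn x \<in> ?K" using that S(1) False by (auto simp: sgn_div_norm norm_sgn subspace_scale)
    then have "sgn x \<bullet> f (sgn x) \<le> k" using e k_def by blast
    then have "(x \<bullet> f x) / (norm x)^2 \<le> k"
      by (simp add: sgn_div_norm linear_scale[OF f] power2_eq_square divide_inverse mult_ac)
    then show ?thesis using False by (simp add: dot_square_norm field_simps)
  qed (simp add: linear_0[OF f])
  have ort: "y \<bullet> f e = 0" if y: "y \<in> S" "y \<bullet> e = 0" for y
  proof (rule ccontr)
    assume ne: "y \<bullet> f e \<noteq> 0"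
    \<comment> \<open>\<open>q\<close> dominates the coefficient of the second-order term, so with
      the step \<open>t\<close> below the first-order gain would outweigh that term and contradict
      maximality.\<close>
    define q where "q = \<bar>k * (y \<bullet> y) - y \<bullet> f y\<bar> + 1"
    have "q > 0" by (simp add: q_def)
    define t where "t = (y \<bullet> f e) / q"
    have "e + t *\<^sub>R y \<in> S" using e y S(1) by (auto intro: subspace_add subspace_scale)
    have nrm: "(e + t *\<^sub>R y) \<bullet> (e + t *\<^sub>R y) = 1 + t^2 * (y \<bullet> y)"
      using e(1) y(2) by (simp add: inner_add_left inner_add_right inner_commute[of e y]
          dot_square_norm[of e] power2_eq_square)
    have "(e + t *\<^sub>R y) \<bullet> f (e + t *\<^sub>R y) = k + 2 * t * (y \<bullet> f e) + t^2 * (y \<bullet> f y)"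
      using sym[of e y] e(1) y(1)
      by (simp add: linear_add[OF f] linear_scale[OF f] inner_add_left inner_add_right
          k_def inner_commute[of "f e" y] power2_eq_square algebra_simps)
    with le[OF \<open>e + t *\<^sub>R y \<in> S\<close>] have "2 * t * (y \<bullet> f e) \<le> t^2 * (k * (y \<bullet> y) - y \<bullet> f y)"
      unfolding nrm by (simp add: algebra_simps)
    also have "\<dots> \<le> t^2 * q" unfolding q_def by (intro mult_left_mono) auto
    also have "t^2 * q = t * (y \<bullet> f e)" using \<open>q > 0\<close> by (simp add: t_def power2_eq_square)
    finally have "t * (y \<bullet> f e) \<le> 0" by simp
    moreover have "t * (y \<bullet> f e) > 0" using ne \<open>q > 0\<close>
      by (auto simp: t_def zero_less_divide_iff zero_less_mult_iff)
    ultimately show False by simp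
  qed
  define r where "r = f e - k *\<^sub>R e"
  have "r \<in> S" using S e unfolding r_def by (auto intro!: subspace_diff subspace_scale)
  moreover have re: "r \<bullet> e = 0"
    using e by (simp add: r_def inner_diff_left k_def inner_commute[of "f e" e] dot_square_norm)
  ultimately have "r \<bullet> f e = 0" using ort by blast
  then have "r \<bullet> r = 0" using re by (simp add: r_def inner_diff_right)
  then have "f e = k *\<^sub>R e" by (simp add: r_def)
  then show ?thesis using that e le by auto
qed

lemma subspace_orthogonal_Int: "subspace S \<Longrightarrow> subspace {x \<in> S. x \<bullet> e = (0::real)}"
  by (auto simp: subspace_def inner_add_left)

lemma orthonormal3_span:
  fixes e :: "3 \<Rightarrow> 'a::euclidean_space"
  assumes ort: "\<And>i j. e i \<bullet> e j = (if i = j then 1 else 0)"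
    and S: "subspace S" "dim S = 3" "range e \<subseteq> S"
  shows "span (range e) = S"
proof -
  have inj: "inj e"
    by (rule injI) (metis ort zero_neq_one)
  have "pairwise orthogonal (range e)"
    using ort by (auto simp: pairwise_def orthogonal_def)
  moreover have "0 \<notin> range e" using ort by (metis imageE inner_zero_left zero_neq_one)
  ultimately have "independent (range e)" by (rule pairwise_orthogonal_independent)
  moreover have "card (range e) = 3" using inj by (simp add: card_image)
  ultimately show ?thesis
    using S subspace_dim_equal[OF subspace_span S(1) span_minimal[OF _ S(1)], of "range e"]
    by (simp add: dim_eq_card_independent)
qed

text \<open>The difference of both sides lies in the span and is orthogonal to it, hence to
  itself.\<close>

lemma orthonormal3_expansion:
  fixes e :: "3 \<Rightarrow> 'a::euclidean_space"
  assumes ort: "\<And>i j. e i \<bullet> e j = (if i = j then 1 else 0)" and v: "v \<in> span (range e)"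
  shows "v = (v \<bullet> e 1) *\<^sub>R e 1 + (v \<bullet> e 2) *\<^sub>R e 2 + (v \<bullet> e 3) *\<^sub>R e 3"
proof -
  define w where "w = v - ((v \<bullet> e 1) *\<^sub>R e 1 + (v \<bullet> e 2) *\<^sub>R e 2 + (v \<bullet> e 3) *\<^sub>R e 3)"
  have "w \<bullet> e i = 0" for i
    using exhaust_3[of i] by (auto simp: w_def inner_diff_left inner_add_left ort)
  then have orth: "orthogonal w x" if "x \<in> range e" for x using that by (auto simp: orthogonal_def)
  have "w \<in> span (range e)"
    unfolding w_def by (intro span_diff v span_add span_scale span_base) auto
  then have "orthogonal w w" using orthogonal_to_span[OF _ orth] by blast
  then show ?thesis by (simp add: orthogonal_def w_def)
qed

text \<open>The Rayleigh quotient is maximized on \<open>S\<close>, then on the part of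
  \<open>S\<close> orthogonal to the first maximizer, then once more. Symmetry keeps each complement
  invariant, and the nesting orders the eigenvalues.\<close>

lemma orthonormal_eigenbasis3:
  fixes f :: "'a::euclidean_space \<Rightarrow> 'a"
  assumes f: "linear f" and S: "subspace S" "dim S = 3" "f ` S \<subseteq> S"
    and sym: "\<And>x y. x \<in> S \<Longrightarrow> y \<in> S \<Longrightarrow> f x \<bullet> y = x \<bullet> f y"
  obtains e :: "3 \<Rightarrow> 'a" and k :: "real^3" where
    "\<And>i j. e i \<bullet> e j = (if i = j then 1 else 0)" "span (range e) = S"
    "\<And>i. f (e i) = k$i *\<^sub>R e i" "k$1 \<le> k$2" "k$2 \<le> k$3"
proof -
  \<comment> \<open>Two orthogonality conditions cannot exhaust a three-dimensional space, by the
    dimension formula for sums. Taking both vectors equal covers a single condition.\<close>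
  have nz: "{x \<in> S. x \<bullet> u = 0 \<and> x \<bullet> v = 0} \<noteq> {0}" for u v
  proof
    assume "{x \<in> S. x \<bullet> u = 0 \<and> x \<bullet> v = 0} = {0}"
    then have "S \<inter> {x. x \<bullet> u = 0 \<and> x \<bullet> v = 0} = {0}" by auto
    moreover have "{x. x \<bullet> u = 0 \<and> x \<bullet> v = 0} = {x. \<forall>y\<in>span {u,v}. orthogonal x y}"
    proof -
      have "x \<bullet> u = 0 \<and> x \<bullet> v = 0 \<longleftrightarrow> (\<forall>y\<in>span {u,v}. orthogonal x y)" for x
        using orthogonal_to_span[of _ "{u,v}" x] 
        by (auto simp: orthogonal_def span_base) 
      then show ?thesis by blast
    qed
    ultimately have 0: "S \<inter> {x. \<forall>y\<in>span {u,v}. orthogonal x y} = {0}" by simp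
    have sub: "subspace {x. \<forall>y\<in>span {u,v}. orthogonal x y}"
      by (auto simp: subspace_def orthogonal_def inner_add_left)
    have "dim {x. \<forall>y\<in>span {u,v}. orthogonal x y} + dim (span {u,v}) = DIM('a)"
      using dim_subspace_orthogonal_to_vectors[of "span {u,v}" UNIV]
      by (simp add: orthogonal_commute)
    moreover have "dim (span {u,v}) \<le> 2"
      using dim_le_card'[of "{u,v}"] by (simp add: card_insert_if split: if_splits)
    moreover have "dim {x + y |x y. x \<in> S \<and> y \<in> {x. \<forall>y\<in>span {u,v}. orthogonal x y}}
        + dim (S \<inter> {x. \<forall>y\<in>span {u,v}. orthogonal x y}) = dim S + dim {x. \<forall>y\<in>span {u,v}. orthogonal x y}"
      by (rule dim_sums_Int[OF S(1) sub])
    ultimately show False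
      using S(2) 0 dim_subset_UNIV[of "{x + y |x y. x \<in> S \<and> y \<in> {x. \<forall>y\<in>span {u,v}. orthogonal x y}}"] by simp
  qed
  have "S \<noteq> {0}" using S(2) by auto
  then obtain u k3 where u: "u \<in> S" "norm u = 1" "f u = k3 *\<^sub>R u" "\<And>x. x \<in> S \<Longrightarrow> x \<bullet> f x \<le> k3 * (x \<bullet> x)"
    using max_eigenvector[OF f S(1) _ S(3) sym] by blast
  let ?S2 = "{x \<in> S. x \<bullet> u = 0}"
  have S2: "subspace ?S2" "f ` ?S2 \<subseteq> ?S2"
    using subspace_orthogonal_Int[OF S(1)] S(3) sym[of _ u] u by auto
  moreover have "?S2 \<noteq> {0}" using nz[of u u] by simp
  ultimately obtain v k2 where v: "v \<in> ?S2" "norm v = 1" "f v = k2 *\<^sub>R v" "\<And>x. x \<in> ?S2 \<Longrightarrow> x \<bullet> f x \<le> k2 * (x \<bullet> x)"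
    using max_eigenvector[OF f, of ?S2] sym by (smt (verit) mem_Collect_eq)
  let ?S3 = "{x \<in> ?S2. x \<bullet> v = 0}"
  have S3: "subspace ?S3" "f ` ?S3 \<subseteq> ?S3"
    using subspace_orthogonal_Int[OF S2(1)] S2(2) sym[of _ v] v by auto
  moreover have "?S3 \<noteq> {0}" using nz[of u v] by (simp add: conj_assoc)
  ultimately obtain w k1 where w: "w \<in> ?S3" "norm w = 1" "f w = k1 *\<^sub>R w"
    using max_eigenvector[OF f, of ?S3] sym by (smt (verit) mem_Collect_eq)
  \<comment> \<open>The order is reversed because the successive maxima decrease.\<close>
  define e :: "3 \<Rightarrow> 'a" where "e i = (if i = 1 then w else if i = 2 then v else u)" for i
  define k :: "real^3" where "k = vector [k1, k2, k3]"
  have e: "e 1 = w" "e 2 = v" "e 3 = u" by (auto simp: e_def)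
  have k: "k$1 = k1" "k$2 = k2" "k$3 = k3" by (auto simp: k_def)
  have ort: "e i \<bullet> e j = (if i = j then 1 else 0)" for i j
    using exhaust_3[of i] exhaust_3[of j] u v w
    by (auto simp: e dot_square_norm inner_commute[of u v] inner_commute[of u w] inner_commute[of v w])
  have "range e \<subseteq> S" using u v w by (auto simp: e_def)
  then have "span (range e) = S" by (rule orthonormal3_span[OF ort S(1,2)])
  moreover have "f (e i) = k$i *\<^sub>R e i" for i
    using exhaust_3[of i] u v w by (auto simp: e k)
  moreover have "k$1 \<le> k$2" "k$2 \<le> k$3"
    using v(4)[of w] u(4)[of v] v w by (auto simp: k dot_square_norm)
  ultimately show ?thesis using that ort by blast
qed

subsection \<open>Ellipsoidal coordinates\<close>

locale confocal =
  fixes B C D :: real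
  assumes BC: "C < B" and CD: "D < C" and D0: "0 < D"
begin

text \<open>The numbers \<open>m$1 \<ge> m$2 \<ge> m$3\<close> are the ellipsoidal coordinates of \<open>(x, y, z)\<close>, the
  roots of \<open>x\<^sup>2 / (m - B) + y\<^sup>2 / (m - C) + z\<^sup>2 / (m - D) = 1\<close>; equivalently, the eigenvalues of
  \<open>diag(B, C, D) + U U\<^sup>T\<close> for \<open>U = (x, y, z)\<close>, with characteristic polynomial \<open>chi\<close>.\<close>

definition ell :: "real \<Rightarrow> real \<Rightarrow> real \<Rightarrow> real^3 \<Rightarrow> bool" where
  "ell x y z m \<longleftrightarrow> D \<le> m$3 \<and> m$3 \<le> C \<and> C \<le> m$2 \<and> m$2 \<le> B \<and> B \<le> m$1 \<and>
     x^2 * ((B - C) * (B - D)) = (m$1 - B) * (B - m$2) * (B - m$3) \<and>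
     y^2 * ((B - C) * (C - D)) = (m$1 - C) * (m$2 - C) * (C - m$3) \<and>
     z^2 * ((B - D) * (C - D)) = (m$1 - D) * (m$2 - D) * (m$3 - D)"

definition chi :: "real \<Rightarrow> real \<Rightarrow> real \<Rightarrow> real \<Rightarrow> real" where
  "chi x y z m = (m - B) * (m - C) * (m - D) - x^2 * ((m - C) * (m - D))
     - y^2 * ((m - B) * (m - D)) - z^2 * ((m - B) * (m - C))"

lemma pos: "B - C > 0" "C - D > 0" "B - D > 0"
  using BC CD by auto

lemma ell_ranges:
  assumes "ell x y z m"
  shows "D \<le> m$3" "m$3 \<le> C" "C \<le> m$2" "m$2 \<le> B" "B \<le> m$1" "m$3 < m$1"
  using assms pos unfolding ell_def by auto

text \<open>The three equations of \<open>ell\<close> say that the two monic cubics in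
  \<open>t\<close> agree at B, C and D, which forces equality. \<open>?V\<close> is the Vandermonde
  product that clears the denominators of the interpolation.\<close>

lemma ell_chi:
  assumes "ell x y z m"
  shows "chi x y z t = (t - m$1) * (t - m$2) * (t - m$3)"
proof -
  let ?V = "(B - C) * (B - D) * (C - D)"
  have "?V * chi x y z t = ?V * ((t - B) * (t - C) * (t - D))
      - (x^2 * ((B - C) * (B - D))) * (C - D) * ((t - C) * (t - D))
      - (y^2 * ((B - C) * (C - D))) * (B - D) * ((t - B) * (t - D))
      - (z^2 * ((B - D) * (C - D))) * (B - C) * ((t - B) * (t - C))"
    unfolding chi_def by algebra
  also have "\<dots> = ?V * ((t - m$1) * (t - m$2) * (t - m$3))"
    using assms unfolding ell_def by algebra
  finally show ?thesis using pos by simp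
qed

text \<open>This is the coefficient of \<open>t^2\<close> in the characteristic polynomial,
  extracted from three of its values.\<close>

lemma ell_trace:
  assumes "ell x y z m"
  shows "x^2 + y^2 + z^2 = m$1 + m$2 + m$3 - B - C - D"
  using ell_chi[OF assms, of 0] ell_chi[OF assms, of 1] ell_chi[OF assms, of "-1"]
  unfolding chi_def by algebra

text \<open>Equal cubics have the same largest and the same smallest root, and the ranges leave no
  choice even when roots coincide. The middle root follows from the trace.\<close>

lemma ell_unique:
  assumes m: "ell x y z m" and n: "ell x y z n"
  shows "m = n"
proof -
  have eq: "(t - m$1) * (t - m$2) * (t - m$3) = (t - n$1) * (t - n$2) * (t - n$3)" for t
    using ell_chi[OF m] ell_chi[OF n] by metis
  note r = ell_ranges[OF m] ell_ranges[OF n]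
  have "m$1 = n$1" using eq[of "m$1"] eq[of "n$1"] r by auto
  moreover have "m$3 = n$3" using eq[of "m$3"] eq[of "n$3"] r by auto
  moreover have "m$2 = n$2" using ell_trace[OF m] ell_trace[OF n] calculation by simp
  ultimately show ?thesis by (simp add: vec_eq_iff forall_3)
qed

text \<open>At B, C and D the polynomial is a square times a constant of known sign. A root outside
  its interval would give one of the three products in \<open>nn\<close> the wrong sign.\<close>

lemma ell_if_chi:
  assumes "\<And>t. chi x y z t = (t - m$1) * (t - m$2) * (t - m$3)" "m$3 \<le> m$2" "m$2 \<le> m$1"
  shows "ell x y z m"
proof -
  have at: "x^2 * ((B - C) * (B - D)) = (m$1 - B) * (B - m$2) * (B - m$3)"
    "y^2 * ((B - C) * (C - D)) = (m$1 - C) * (m$2 - C) * (C - m$3)"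
    "z^2 * ((B - D) * (C - D)) = (m$1 - D) * (m$2 - D) * (m$3 - D)"
    using assms(1)[of B] assms(1)[of C] assms(1)[of D] unfolding chi_def by algebra+
  have nn: "0 \<le> (m$1 - B) * (B - m$2) * (B - m$3)" "0 \<le> (m$1 - C) * (m$2 - C) * (C - m$3)"
    "0 \<le> (m$1 - D) * (m$2 - D) * (m$3 - D)"
    using pos by (simp_all flip: at)
  have m1: "B \<le> m$1"
  proof (rule ccontr)
    assume "\<not> B \<le> m$1"
    then have "(m$1 - B) * (B - m$2) * (B - m$3) < 0"
      using assms(2,3) by (intro mult_neg_pos[OF mult_neg_pos]) auto
    then show False using nn by simp
  qed
  have m3: "m$3 \<le> C"
  proof (rule ccontr)
    assume "\<not> m$3 \<le> C"
    then have "(m$1 - C) * (m$2 - C) * (C - m$3) < 0"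
      using assms(2,3) by (intro mult_pos_neg) auto
    then show False using nn by simp
  qed
  have m2: "m$2 \<le> B"
  proof (rule ccontr)
    assume "\<not> m$2 \<le> B"
    then have "(m$1 - B) * (B - m$2) * (B - m$3) < 0"
      using assms(2,3) m3 pos by (intro mult_neg_pos[OF mult_pos_neg]) auto
    then show False using nn by simp
  qed
  have m2': "C \<le> m$2"
  proof (rule ccontr)
    assume "\<not> C \<le> m$2"
    then have "(m$1 - C) * (m$2 - C) * (C - m$3) < 0"
      using assms(2,3) m1 pos by (intro mult_neg_pos[OF mult_pos_neg]) auto
    then show False using nn by simp
  qed
  have "D \<le> m$3"
  proof (rule ccontr)
    assume "\<not> D \<le> m$3"
    then have "(m$1 - D) * (m$2 - D) * (m$3 - D) < 0"
      using m2' m1 pos by (intro mult_pos_neg) auto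
    then show False using nn by simp
  qed
  then show ?thesis unfolding ell_def using at m1 m2 m2' m3 by blast
qed

text \<open>The hypotheses say that the \<open>W j\<close> form an eigenbasis. Comparing
  determinants in \<open>A ** P = P ** L\<close> then counts the eigenvalues with multiplicity, so
  repeated ones are no exception.\<close>

lemma chi_eigenbasis:
  fixes W :: "3 \<Rightarrow> real^3"
  assumes W: "\<And>j. (m$j - B) * W j $ 1 = (x * W j $ 1 + y * W j $ 2 + z * W j $ 3) * x"
    "\<And>j. (m$j - C) * W j $ 2 = (x * W j $ 1 + y * W j $ 2 + z * W j $ 3) * y"
    "\<And>j. (m$j - D) * W j $ 3 = (x * W j $ 1 + y * W j $ 2 + z * W j $ 3) * z"
    and ind: "\<And>r. (\<Sum>j\<in>UNIV. r$j *\<^sub>R W j) = 0 \<Longrightarrow> r = 0"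
  shows "chi x y z t = (t - m$1) * (t - m$2) * (t - m$3)"
proof -
  define P :: "real^3^3" where "P = (\<chi> i j. W j $ i)"
  define A :: "real^3^3" where "A = vector [vector [t - B - x * x, - (x * y), - (x * z)],
    vector [- (y * x), t - C - y * y, - (y * z)], vector [- (z * x), - (z * y), t - D - z * z]]"
  define L :: "real^3^3" where "L = (\<chi> i j. if i = j then t - m$j else 0)"
  have "A ** P = P ** L"
    using W[of 1] W[of 2] W[of 3]
    by (simp add: vec_eq_iff forall_3 matrix_matrix_mult_def sum_3 A_def P_def L_def) algebra
  then have "det A * det P = det P * det L" by (metis det_mul)
  moreover have "det P \<noteq> 0"
  proof -
    have "P *v r = (\<Sum>j\<in>UNIV. r$j *\<^sub>R W j)" for r
      by (simp add: vec_eq_iff matrix_vector_mult_def P_def mult.commute)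
    then have "\<forall>r. P *v r = 0 \<longrightarrow> r = 0" using ind by metis
    then show ?thesis
      by (metis invertible_def invertible_det_nz invertible_left_inverse matrix_left_invertible_ker)
  qed
  moreover have "det L = (t - m$1) * (t - m$2) * (t - m$3)"
    by (simp add: det_3 L_def)
  moreover have "det A = chi x y z t"
    unfolding det_3 A_def chi_def by (simp add: algebra_simps power2_eq_square)
  ultimately show ?thesis by simp
qed

lemma neg_factor: "q > 0 \<Longrightarrow> p * q < 0 \<Longrightarrow> p < 0" and pos_factor: "q > 0 \<Longrightarrow> p * q > 0 \<Longrightarrow> p > 0"
  for p q :: real
  by (simp_all add: mult_less_0_iff zero_less_mult_iff)

text \<open>The two outer roots are located by the sign of \<open>chi\<close> at a nearby argument
  beyond B or C, where the other two factors have a fixed sign; the middle root follows from the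
  trace. Coinciding roots are thus included.\<close>

lemma ell_continuous:
  fixes x y z :: "'a::metric_space \<Rightarrow> real"
  assumes c: "continuous_on S x" "continuous_on S y" "continuous_on S z"
    and e: "\<And>s. s \<in> S \<Longrightarrow> ell (x s) (y s) (z s) (m s)"
  shows "continuous_on S (\<lambda>s. m s $ i)"
proof -
  have chi: "((\<lambda>s. chi (x s) (y s) (z s) t) \<longlongrightarrow> (t - m s0 $ 1) * (t - m s0 $ 2) * (t - m s0 $ 3)) (at s0 within S)"
    if "s0 \<in> S" for s0 t
  proof -
    have "continuous_on S (\<lambda>s. chi (x s) (y s) (z s) t)"
      unfolding chi_def by (intro continuous_intros c)
    then show ?thesis
      unfolding ell_chi[OF e[OF that], symmetric] using that by (simp add: continuous_on_def)
  qed
  have ev: "\<forall>\<^sub>F s in at s0 within S. s \<in> S" for s0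
    by (simp add: eventually_at_filter)
  have m1: "continuous_on S (\<lambda>s. m s $ 1)"
    unfolding continuous_on_def
  proof (intro ballI order_tendstoI)
    fix s0 r assume s0: "s0 \<in> S" and r: "r < m s0 $ 1"
    show "\<forall>\<^sub>F s in at s0 within S. r < m s $ 1"
    proof (cases "r < B")
      case True
      show ?thesis using ev by eventually_elim (use ell_ranges(5)[OF e] True in force)
    next
      case False
      \<comment> \<open>Unlike \<open>r\<close>, the midpoint lies strictly above B also when
        \<open>r = B\<close>, so the other two factors do not vanish.\<close>
      define t where "t = (r + m s0 $ 1) / 2"
      have t: "r < t" "t < m s0 $ 1" "B < t" using r False by (auto simp: t_def)
      then have "(t - m s0 $ 1) * (t - m s0 $ 2) * (t - m s0 $ 3) < 0"
        using ell_ranges[OF e[OF s0]] by (intro mult_neg_pos) auto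
      from order_tendstoD(2)[OF chi[OF s0] this] ev show ?thesis
      proof eventually_elim
        case (elim s)
        have "(t - m s $ 2) * (t - m s $ 3) > 0"
          using ell_ranges[OF e[OF elim(2)]] t by (intro mult_pos_pos) auto
        then show ?case using elim ell_chi[OF e[OF elim(2)], of t] t(1)
          using neg_factor[of "(t - m s $ 2) * (t - m s $ 3)" "t - m s $ 1"] by (simp add: mult.assoc)
      qed
    qed
  next
    fix s0 r assume s0: "s0 \<in> S" and r: "m s0 $ 1 < r"
    then have "(r - m s0 $ 1) * (r - m s0 $ 2) * (r - m s0 $ 3) > 0"
      using ell_ranges[OF e[OF s0]] by (intro mult_pos_pos) auto
    from order_tendstoD(1)[OF chi[OF s0] this] ev show "\<forall>\<^sub>F s in at s0 within S. m s $ 1 < r"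
    proof eventually_elim
      case (elim s)
      have "(r - m s $ 2) * (r - m s $ 3) > 0"
        using ell_ranges[OF e[OF elim(2)]] ell_ranges[OF e[OF s0]] r by (intro mult_pos_pos) auto
      then show ?case using elim ell_chi[OF e[OF elim(2)], of r]
          pos_factor[of "(r - m s $ 2) * (r - m s $ 3)" "r - m s $ 1"] by (simp add: mult.assoc)
    qed
  qed
  have m3: "continuous_on S (\<lambda>s. m s $ 3)"
    unfolding continuous_on_def
  proof (intro ballI order_tendstoI)
    fix s0 r assume s0: "s0 \<in> S" and r: "m s0 $ 3 < r"
    show "\<forall>\<^sub>F s in at s0 within S. m s $ 3 < r"
    proof (cases "C < r")
      case True
      show ?thesis using ev by eventually_elim (use ell_ranges(2)[OF e] True in force)
    next
      case False
      define t where "t = (r + m s0 $ 3) / 2"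
      have t: "t < r" "m s0 $ 3 < t" "t < C" using r False by (auto simp: t_def)
      then have "(t - m s0 $ 1) * (t - m s0 $ 2) * (t - m s0 $ 3) > 0"
        using ell_ranges[OF e[OF s0]] pos by (intro mult_pos_pos[OF mult_neg_neg]) auto
      from order_tendstoD(1)[OF chi[OF s0] this] ev show ?thesis
      proof eventually_elim
        case (elim s)
        have "(t - m s $ 1) * (t - m s $ 2) > 0"
          using ell_ranges[OF e[OF elim(2)]] t pos by (intro mult_neg_neg) auto
        then show ?case using elim ell_chi[OF e[OF elim(2)], of t] t(1)
          pos_factor[of "(t - m s $ 1) * (t - m s $ 2)" "t - m s $ 3"] by (simp add: mult.commute)
      qed
    qed
  next
    fix s0 r assume s0: "s0 \<in> S" and r: "r < m s0 $ 3"
    then have "(r - m s0 $ 1) * (r - m s0 $ 2) * (r - m s0 $ 3) < 0"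
      using ell_ranges[OF e[OF s0]] pos by (intro mult_pos_neg[OF mult_neg_neg]) auto
    from order_tendstoD(2)[OF chi[OF s0] this] ev show "\<forall>\<^sub>F s in at s0 within S. r < m s $ 3"
    proof eventually_elim
      case (elim s)
      have "(r - m s $ 1) * (r - m s $ 2) > 0"
        using ell_ranges[OF e[OF elim(2)]] ell_ranges[OF e[OF s0]] r pos by (intro mult_neg_neg) auto
      then show ?case using elim ell_chi[OF e[OF elim(2)], of r]
        neg_factor[of "(r - m s $ 1) * (r - m s $ 2)" "r - m s $ 3"] by (simp add: mult.commute)
    qed
  qed
  have "continuous_on S (\<lambda>s. (x s)^2 + (y s)^2 + (z s)^2 + B + C + D - m s $ 1 - m s $ 3)"
    by (intro continuous_intros c m1 m3)
  then have "continuous_on S (\<lambda>s. m s $ 2)"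
    by (rule continuous_on_cong[THEN iffD1, OF refl, rotated]) (use ell_trace[OF e] in force)
  then show ?thesis using m1 m3 exhaust_3[of i] by auto
qed

definition is_eigvec :: "real \<Rightarrow> real \<Rightarrow> real \<Rightarrow> real \<Rightarrow> real \<Rightarrow> real \<Rightarrow> real \<Rightarrow> bool" where
  "is_eigvec x y z m x' y' z' \<longleftrightarrow> (let h = x * x' + y * y' + z * z' in
     (m - B) * x' = h * x \<and> (m - C) * y' = h * y \<and> (m - D) * z' = h * z)"

text \<open>Along an integral curve of the \<open>i\<close>-th eigenvector field, \<open>chi t\<close> solves a linear equation
  as long as the \<open>i\<close>-th eigenvalue avoids \<open>t\<close>, so being a root is preserved. The other
  eigenvalues therefore take finitely many values.\<close>

lemma eigenvalues_constant:
  assumes I: "is_interval I" "s0 \<in> I" "s1 \<in> I"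
    and dx: "\<And>s. s \<in> I \<Longrightarrow> (x has_real_derivative x' s) (at s)"
    and dy: "\<And>s. s \<in> I \<Longrightarrow> (y has_real_derivative y' s) (at s)"
    and dz: "\<And>s. s \<in> I \<Longrightarrow> (z has_real_derivative z' s) (at s)"
    and c': "continuous_on I x'" "continuous_on I y'" "continuous_on I z'"
    and e: "\<And>s. s \<in> I \<Longrightarrow> ell (x s) (y s) (z s) (m s)"
    and v: "\<And>s. s \<in> I \<Longrightarrow> is_eigvec (x s) (y s) (z s) (m s $ i) (x' s) (y' s) (z' s)"
    and j: "j \<noteq> i"
  shows "m s0 $ j = m s1 $ j"
proof -
  have c: "continuous_on I x" "continuous_on I y" "continuous_on I z"
    using dx dy dz by (meson DERIV_isCont continuous_at_imp_continuous_on)+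
  have cm: "continuous_on I (\<lambda>s. m s $ k)" for k by (rule ell_continuous[OF c e])
  let ?h = "\<lambda>s. x s * x' s + y s * y' s + z s * z' s"
  have root: "chi (x s') (y s') (z s') t = 0"
    if t: "\<And>s. s \<in> I \<Longrightarrow> m s $ i \<noteq> t" and s: "s \<in> I" "s' \<in> I" "chi (x s) (y s) (z s) t = 0" for t s s'
  proof (rule linear_ode_zero[where f = "\<lambda>s. chi (x s) (y s) (z s) t", OF I(1) s(1,2) _ _ s(3)])
    show "continuous_on I (\<lambda>s. - 2 * ?h s / (t - m s $ i))"
      using t by (intro continuous_intros c c' cm) force
    fix r assume r: "r \<in> I"
    have "((\<lambda>s. chi (x s) (y s) (z s) t) has_real_derivative
      - (2 * x r * x' r * ((t - C) * (t - D))) - 2 * y r * y' r * ((t - B) * (t - D))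
        - 2 * z r * z' r * ((t - B) * (t - C))) (at r)"
      unfolding chi_def
      by (rule derivative_eq_intros refl dx dy dz r | simp)+
    moreover have "- (2 * x r * x' r * ((t - C) * (t - D))) - 2 * y r * y' r * ((t - B) * (t - D))
        - 2 * z r * z' r * ((t - B) * (t - C))
      = - 2 * ?h r / (t - m r $ i) * chi (x r) (y r) (z r) t"
    proof -
      \<comment> \<open>Since the matrix is a rank-one perturbation of a constant one, the
        derivative of \<open>chi\<close> at \<open>t\<close> along an eigenvector with eigenvalue
        \<mu> is exactly \<open>- 2 * h / (t - \<mu>)\<close> times \<open>chi\<close>.\<close>
      have "(t - m r $ i) * (- (2 * x r * x' r * ((t - C) * (t - D))) - 2 * y r * y' r * ((t - B) * (t - D))
        - 2 * z r * z' r * ((t - B) * (t - C))) = - 2 * ?h r * chi (x r) (y r) (z r) t"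
        using v[OF r] unfolding is_eigvec_def Let_def chi_def by algebra
      then show ?thesis using t[OF r] by (simp add: field_simps)
    qed
    ultimately show "((\<lambda>s. chi (x s) (y s) (z s) t) has_real_derivative
      - 2 * ?h r / (t - m r $ i) * chi (x r) (y r) (z r) t) (at r)" by simp
  qed
  \<comment> \<open>The ranges of different roots meet only at B and C. Any other value of root
    \<open>j\<close> is avoided by root \<open>i\<close> along all of \<open>I\<close>, so it was
    already a root at \<open>s0\<close>.\<close>
  have "m s $ j \<in> {B, C, m s0 $ 1, m s0 $ 2, m s0 $ 3}" if s: "s \<in> I" for s
  proof (cases "m s $ j \<in> {B, C}")
    case False
    have "m s' $ i \<noteq> m s $ j" if "s' \<in> I" for s'
      using ell_ranges[OF e[OF that]] ell_ranges[OF e[OF s]] False j exhaust_3[of i] exhaust_3[of j] pos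
      by auto
    moreover have "chi (x s) (y s) (z s) (m s $ j) = 0"
      using ell_chi[OF e[OF s]] exhaust_3[of j] by auto
    ultimately have "chi (x s0) (y s0) (z s0) (m s $ j) = 0" using root s I by blast
    then show ?thesis using ell_chi[OF e[OF I(2)]] by auto
  qed auto
  then have "(\<lambda>s. m s $ j) ` I \<subseteq> {B, C, m s0 $ 1, m s0 $ 2, m s0 $ 3}" by blast
  then have "finite ((\<lambda>s. m s $ j) ` I)" by (rule finite_subset) simp
  then have "(\<lambda>s. m s $ j) constant_on I"
    using continuous_finite_range_constant[OF _ cm] I(1) is_interval_connected by blast
  then show ?thesis using I unfolding constant_on_def by auto
qed

text \<open>Differentiating the relation determines \<open>w'\<close> only after division by
  \<open>w s\<close>. At a zero of \<open>w\<close> either \<open>mu s = \<beta>\<close>, or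
  \<open>K = 0\<close> and \<open>w\<close> vanishes identically.\<close>

lemma coordinate_eigvec:
  assumes I: "open I" "s \<in> I"
    and w: "\<And>t. t \<in> I \<Longrightarrow> (w t)^2 * e = K * (mu t - \<beta>)" "e \<noteq> 0"
    and d: "(w has_real_derivative w') (at s)" "(mu has_real_derivative 2 * h) (at s)"
  shows "(mu s - \<beta>) * w' = h * w s"
proof (cases "w s = 0")
  case True
  then have "K = 0 \<or> mu s = \<beta>" using w(1)[OF I(2)] by auto
  moreover have "w' = 0" if "K = 0"
  proof -
    have "w t = 0" if "t \<in> I" for t using w(1)[OF that] \<open>K = 0\<close> w(2) by simp
    then have "((\<lambda>_. 0) has_real_derivative w') (at s)"
      using has_field_derivative_transform_within_open[OF d(1) I] by auto
    then show ?thesis using DERIV_unique DERIV_const by blast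
  qed
  ultimately show ?thesis using True by auto
next
  case False
  have "((\<lambda>t. (w t)^2 * e) has_real_derivative 2 * w s * w' * e) (at s)"
    by (rule derivative_eq_intros refl d(1) | simp)+
  then have "((\<lambda>t. K * (mu t - \<beta>)) has_real_derivative 2 * w s * w' * e) (at s)"
    by (rule has_field_derivative_transform_within_open[OF _ I]) (rule w(1))
  moreover have "((\<lambda>t. K * (mu t - \<beta>)) has_real_derivative K * (2 * h)) (at s)"
    by (rule derivative_eq_intros refl d(2) | simp)+
  ultimately have "w s * w' * e = K * h" using DERIV_unique by fastforce
  then have "(w s * e) * ((mu s - \<beta>) * w') = (w s * e) * (h * w s)"
    using w(1)[OF I(2)] by algebra
  then show ?thesis using False w(2) by simp
qed

text \<open>The converse of \<open>eigenvalues_constant\<close>: a curve that moves only one root is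
  tangent to its eigenvector. The trace gives the derivative of that root, and each squared
  coordinate is linear in it.\<close>

lemma coordinate_line_eigvec:
  assumes I: "open I" "s \<in> I"
    and e: "\<And>t. t \<in> I \<Longrightarrow> ell (x t) (y t) (z t) (m t)"
    and c: "\<And>t j. t \<in> I \<Longrightarrow> j \<noteq> i \<Longrightarrow> m t $ j = m s $ j"
    and d: "(x has_real_derivative x') (at s)" "(y has_real_derivative y') (at s)"
      "(z has_real_derivative z') (at s)"
  shows "is_eigvec (x s) (y s) (z s) (m s $ i) x' y' z'"
    and "((\<lambda>t. m t $ i) has_real_derivative 2 * (x s * x' + y s * y' + z s * z')) (at s)"
proof -
  let ?h = "x s * x' + y s * y' + z s * z'"
  have tr: "(x t)^2 + (y t)^2 + (z t)^2 - ((x s)^2 + (y s)^2 + (z s)^2) + m s $ i = m t $ i" if "t \<in> I" for t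
    using ell_trace[OF e[OF that]] ell_trace[OF e[OF I(2)]] c[OF that] exhaust_3[of i] by auto
  have "((\<lambda>t. (x t)^2 + (y t)^2 + (z t)^2 - ((x s)^2 + (y s)^2 + (z s)^2) + m s $ i) has_real_derivative 2 * ?h) (at s)"
    by (rule derivative_eq_intros refl d | simp)+
  then show dm: "((\<lambda>t. m t $ i) has_real_derivative 2 * ?h) (at s)"
    by (rule has_field_derivative_transform_within_open[OF _ I]) (rule tr)
  have cc: "(m t $ 1 - \<beta>) * (m t $ 2 - \<beta>) * (m t $ 3 - \<beta>) = (\<Prod>j\<in>UNIV-{i}. m s $ j - \<beta>) * (m t $ i - \<beta>)"
    if "t \<in> I" for t \<beta>
  proof -
    have p3: "(\<Prod>j\<in>UNIV. m t $ j - \<beta>) = (m t $ 1 - \<beta>) * (m t $ 2 - \<beta>) * (m t $ 3 - \<beta>)"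
      unfolding UNIV_3 by simp
    have "(\<Prod>j\<in>UNIV. m t $ j - \<beta>) = (m t $ i - \<beta>) * (\<Prod>j\<in>UNIV-{i}. m t $ j - \<beta>)"
      using prod.remove[of UNIV i "\<lambda>j. m t $ j - \<beta>"] by (simp only: finite UNIV_I)
    also have "(\<Prod>j\<in>UNIV-{i}. m t $ j - \<beta>) = (\<Prod>j\<in>UNIV-{i}. m s $ j - \<beta>)"
    proof (rule prod.cong[OF refl])
      fix j assume "j \<in> UNIV - {i}"
      then have "j \<noteq> i" by simp
      then show "m t $ j - \<beta> = m s $ j - \<beta>" using c[OF that] by simp
    qed
    finally show ?thesis
      by (metis p3 mult.commute)
  qed
  \<comment> \<open>The minus sign in the row of \<open>y\<close> compensates for the single
    reversed factor in \<open>ell\<close>; in the row of \<open>x\<close> two reversed factors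
    cancel.\<close>
  have eqs: "(x t)^2 * ((B - C) * (B - D)) = (\<Prod>j\<in>UNIV-{i}. m s $ j - B) * (m t $ i - B)"
    "(y t)^2 * (- (B - C) * (C - D)) = (\<Prod>j\<in>UNIV-{i}. m s $ j - C) * (m t $ i - C)"
    "(z t)^2 * ((B - D) * (C - D)) = (\<Prod>j\<in>UNIV-{i}. m s $ j - D) * (m t $ i - D)"
    if "t \<in> I" for t
  proof -
    have eq: "(x t)^2 * ((B - C) * (B - D)) = (m t $ 1 - B) * (B - m t $ 2) * (B - m t $ 3)"
      "(y t)^2 * ((B - C) * (C - D)) = (m t $ 1 - C) * (m t $ 2 - C) * (C - m t $ 3)"
      "(z t)^2 * ((B - D) * (C - D)) = (m t $ 1 - D) * (m t $ 2 - D) * (m t $ 3 - D)"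
      using e[OF that] unfolding ell_def by auto
    show "(x t)^2 * ((B - C) * (B - D)) = (\<Prod>j\<in>UNIV-{i}. m s $ j - B) * (m t $ i - B)"
      unfolding eq cc[OF that, symmetric] by algebra
    have "(y t)^2 * (- (B - C) * (C - D)) = - ((y t)^2 * ((B - C) * (C - D)))" by algebra
    then show "(y t)^2 * (- (B - C) * (C - D)) = (\<Prod>j\<in>UNIV-{i}. m s $ j - C) * (m t $ i - C)"
      unfolding eq cc[OF that, symmetric] by algebra
    show "(z t)^2 * ((B - D) * (C - D)) = (\<Prod>j\<in>UNIV-{i}. m s $ j - D) * (m t $ i - D)"
      unfolding eq cc[OF that, symmetric] ..
  qed
  have "(m s $ i - B) * x' = ?h * x s" by (rule coordinate_eigvec[OF I eqs(1) _ d(1) dm]) (use pos in auto)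
  moreover have "(m s $ i - C) * y' = ?h * y s" by (rule coordinate_eigvec[OF I eqs(2) _ d(2) dm]) (use pos in auto)
  moreover have "(m s $ i - D) * z' = ?h * z s" by (rule coordinate_eigvec[OF I eqs(3) _ d(3) dm]) (use pos in auto)
  ultimately show "is_eigvec (x s) (y s) (z s) (m s $ i) x' y' z'"
    unfolding is_eigvec_def Let_def by blast
qed

end

subsection \<open>The shape operator of a sheet\<close>

locale quadric =
  fixes a b c d \<sigma> :: real
  assumes a0: "0 < a" and bc: "c < b" and cd: "d < c" and d0: "0 < d" and s1: "\<sigma> = 1 \<or> \<sigma> = -1"
begin

section \<open>Linear coordinates and parametrization of a sheet\<close>

lemma pos0: "b > 0" "c > 0" using bc cd d0 by auto

sublocale confocal "b^2" "c^2" "d^2"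
  by unfold_locales (use bc cd d0 in \<open>auto simp: power_strict_mono\<close>)

abbreviation "M \<equiv> Q3_sheet a b c d \<sigma>"
abbreviation "N \<equiv> Q3_normal a b c d"
abbreviation "G \<equiv> Q3_gradient a b c d"

text \<open>The factors are chosen so that
  \<open>p \<bullet> v = X p * X v + Y p * Y v + Z p * Z v\<close> for tangent \<open>v\<close>
  (\<open>h_eq\<close>), which eliminates the first ambient coordinate. Being linear on the whole
  space, the three functions also provide ambient smooth extensions of inverse
  parametrizations.\<close>

definition X :: "real^4 \<Rightarrow> real" where "X p = sqrt (a^2 + b^2) / b * p$2"
definition Y :: "real^4 \<Rightarrow> real" where "Y p = sqrt (a^2 + c^2) / c * p$3"
definition Z :: "real^4 \<Rightarrow> real" where "Z p = sqrt (a^2 + d^2) / d * p$4"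

text \<open>The inverse of (X, Y, Z) on the sheet; curves and surfaces on the sheet are described
  through it.\<close>

definition Phi :: "real \<Rightarrow> real \<Rightarrow> real \<Rightarrow> real^4" where
  "Phi x y z = Q3_chart a b c d \<sigma> (x / sqrt (a^2 + b^2)) (y / sqrt (a^2 + c^2)) (z / sqrt (a^2 + d^2))"

lemma roots_pos: "sqrt (a^2 + b^2) > 0" "sqrt (a^2 + c^2) > 0" "sqrt (a^2 + d^2) > 0"
  using a0 by (simp_all add: add_pos_nonneg)

lemma s_sq: "\<sigma> * \<sigma> = 1" using s1 by auto

lemma XYZ_Phi [simp]: "X (Phi x y z) = x" "Y (Phi x y z) = y" "Z (Phi x y z) = z"
  using roots_pos pos0 d0 by (simp_all add: X_def Y_def Z_def Phi_def Q3_chart_def)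

lemma Phi_in_M [simp]: "Phi x y z \<in> M"
  unfolding Phi_def Q3_sheet_def by blast

lemma Phi_XYZ: "p \<in> M \<Longrightarrow> Phi (X p) (Y p) (Z p) = p"
  using roots_pos pos0 d0
  by (auto simp: Q3_sheet_def X_def Y_def Z_def Phi_def Q3_chart_def)

lemma M_eqI: "p \<in> M \<Longrightarrow> q \<in> M \<Longrightarrow> X p = X q \<Longrightarrow> Y p = Y q \<Longrightarrow> Z p = Z q \<Longrightarrow> p = q"
  by (metis Phi_XYZ)

lemma smooth_on_Phi [smooth_intros]:
  assumes "smooth_on U x" "smooth_on U y" "smooth_on U z" "open U"
  shows "smooth_on U (\<lambda>s. Phi (x s) (y s) (z s))"
proof -
  have "1 + (x s / sqrt (a^2 + b^2))^2 + (y s / sqrt (a^2 + c^2))^2 + (z s / sqrt (a^2 + d^2))^2 > 0" for s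
    by (intro add_pos_nonneg) auto
  then show ?thesis
    unfolding Phi_def Q3_chart_def using roots_pos
    by (intro smooth_intros assms) auto
qed

lemma bounded_linear_XYZ: "bounded_linear X" "bounded_linear Y" "bounded_linear Z"
  unfolding X_def Y_def Z_def
  by (intro bounded_linear_const_mult bounded_linear_vec_nth)+

lemma smooth_on_XYZ [smooth_intros]:
  "smooth_on U f \<Longrightarrow> open U \<Longrightarrow> smooth_on U (\<lambda>s. X (f s))"
  "smooth_on U f \<Longrightarrow> open U \<Longrightarrow> smooth_on U (\<lambda>s. Y (f s))"
  "smooth_on U f \<Longrightarrow> open U \<Longrightarrow> smooth_on U (\<lambda>s. Z (f s))"
  by (rule smooth_on_bounded_linear[OF bounded_linear_XYZ(1)] smooth_on_bounded_linear[OF bounded_linear_XYZ(2)]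
      smooth_on_bounded_linear[OF bounded_linear_XYZ(3)]; assumption)+

lemma linear_XYZ: "linear X" "linear Y" "linear Z"
  using bounded_linear_XYZ by (auto intro: bounded_linear.linear)

lemma continuous_on_XYZ [continuous_intros]:
  "continuous_on U f \<Longrightarrow> continuous_on U (\<lambda>s. X (f s))"
  "continuous_on U f \<Longrightarrow> continuous_on U (\<lambda>s. Y (f s))"
  "continuous_on U f \<Longrightarrow> continuous_on U (\<lambda>s. Z (f s))"
  by (rule bounded_linear.continuous_on[OF bounded_linear_XYZ(1)] bounded_linear.continuous_on[OF bounded_linear_XYZ(2)]
      bounded_linear.continuous_on[OF bounded_linear_XYZ(3)]; assumption)+

lemma continuous_on_Phi [continuous_intros]:
  assumes "continuous_on U x" "continuous_on U y" "continuous_on U z"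
  shows "continuous_on U (\<lambda>s. Phi (x s) (y s) (z s))"
proof -
  have "smooth_on UNIV (\<lambda>t::real \<times> real \<times> real. Phi (fst t) (fst (snd t)) (snd (snd t)))"
    by (intro smooth_intros open_UNIV)
  then have "continuous_on UNIV (\<lambda>t::real \<times> real \<times> real. Phi (fst t) (fst (snd t)) (snd (snd t)))"
    by (rule smooth_on_continuous)
  moreover have "continuous_on U (\<lambda>s. (x s, y s, z s))" by (intro continuous_intros assms)
  ultimately show ?thesis by (auto dest: continuous_on_compose2)
qed

section \<open>Gradient, unit normal and tangent spaces\<close>

lemma Q3_eq: "p \<in> Q3 a b c d \<longleftrightarrow> (p$1)^2 = a^2 * (1 + (p$2/b)^2 + (p$3/c)^2 + (p$4/d)^2)"
  using a0 by (simp add: Q3_def Q3_form_def power_divide field_simps)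

lemma M_iff: "p \<in> M \<longleftrightarrow> p \<in> Q3 a b c d \<and> 0 < \<sigma> * p$1"
proof
  assume "p \<in> M"
  then obtain u v w where p: "p = Q3_chart a b c d \<sigma> u v w" unfolding Q3_sheet_def by blast
  have "1 + u^2 + v^2 + w^2 > 0" by (intro add_pos_nonneg) auto
  then show "p \<in> Q3 a b c d \<and> 0 < \<sigma> * p$1"
    using s1 a0 pos0 d0 unfolding Q3_eq p Q3_chart_def by (auto simp: power_mult_distrib)
next
  assume p: "p \<in> Q3 a b c d \<and> 0 < \<sigma> * p$1"
  let ?r = "1 + (p$2/b)^2 + (p$3/c)^2 + (p$4/d)^2"
  have "\<sigma> * p$1 = sqrt ((\<sigma> * p$1)^2)" using p by simp
  also have "(\<sigma> * p$1)^2 = a^2 * ?r" using p s1 by (auto simp: Q3_eq)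
  also have "sqrt (a^2 * ?r) = a * sqrt ?r" using a0 by (simp add: real_sqrt_mult)
  finally have "\<sigma> * (\<sigma> * p$1) = \<sigma> * (a * sqrt ?r)" by simp
  then have "p$1 = \<sigma> * a * sqrt ?r" using s_sq by (simp flip: mult.assoc)
  then have "p = Q3_chart a b c d \<sigma> (p$2/b) (p$3/c) (p$4/d)"
    using pos0 d0 by (simp add: vec_eq_iff forall_4 Q3_chart_def)
  then show "p \<in> M" unfolding Q3_sheet_def by blast
qed

lemma G_nth [simp]: "G p $ 1 = 2 * p$1 / a^2" "G p $ 2 = - 2 * p$2 / b^2"
  "G p $ 3 = - 2 * p$3 / c^2" "G p $ 4 = - 2 * p$4 / d^2"
  by (simp_all add: Q3_gradient_def)

text \<open>The gradient of a quadratic form is linear, hence its own derivative; together with its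
  symmetry this makes the shape operator explicit.\<close>

lemma linear_G: "linear G"
  by (rule linearI) (simp_all add: vec_eq_iff forall_4 algebra_simps add_divide_distrib diff_divide_distrib)

lemma inner4: "u \<bullet> v = u$1 * v$1 + u$2 * v$2 + u$3 * v$3 + u$4 * v$4" for u v :: "real^4"
  by (simp add: inner_vec_def sum_4)

lemma inner_G: "v \<bullet> G p = 2 * (p$1 * v$1 / a^2 - p$2 * v$2 / b^2 - p$3 * v$3 / c^2 - p$4 * v$4 / d^2)"
  unfolding inner4 G_nth by (simp add: diff_divide_distrib mult_ac)

lemma G_sym: "G u \<bullet> v = u \<bullet> G v"
  using inner_G[of v u] inner_G[of u v] by (simp add: inner_commute mult.commute)

lemma G_self: "p \<in> Q3 a b c d \<Longrightarrow> p \<bullet> G p = 2"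
  by (simp add: inner_G Q3_def Q3_form_def flip: power2_eq_square)

lemma G_nonzero: "p \<in> M \<Longrightarrow> G p \<noteq> 0"
  using G_self[of p] M_iff by fastforce

lemma p1_nonzero: "p \<in> M \<Longrightarrow> p$1 \<noteq> 0"
  using M_iff by auto

lemma N_eq: "N p = G p /\<^sub>R norm (G p)"
  by (simp add: Q3_normal_def sgn_div_norm)

lemma N_unit: "p \<in> M \<Longrightarrow> norm (N p) = 1"
  using G_nonzero by (simp add: Q3_normal_def norm_sgn)

text \<open>One inclusion differentiates the constant \<open>Q3_form\<close> along a curve. For the
  other, the last three coordinates follow a straight line and the first is recovered from the
  equation of the sheet.\<close>

lemma tangent_space_M:
  assumes p: "p \<in> M"
  shows "tangent_space M p = {v. v \<bullet> G p = 0}"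
proof (intro equalityI subsetI)
  fix v assume "v \<in> tangent_space M p"
  then obtain g where g: "g 0 = p" "\<forall>\<^sub>F s in nhds (0::real). g s \<in> M" "(g has_vector_derivative v) (at 0)"
    unfolding tangent_space_def by blast
  have "(Q3_form a b c d has_derivative (\<lambda>h. h \<bullet> G p)) (at (g 0))"
    using GDERIV_Q3_form[of a b c d p] g(1) by (simp add: gderiv_def)
  then have "((\<lambda>s. Q3_form a b c d (g s)) has_derivative (\<lambda>h. (h *\<^sub>R v) \<bullet> G p)) (at 0)"
    by (rule has_derivative_compose[OF g(3)[unfolded has_vector_derivative_def]])
  moreover have "((\<lambda>s. Q3_form a b c d (g s)) has_derivative (\<lambda>h. 0)) (at 0)"
  proof -
    obtain S where S: "open S" "0 \<in> S" "\<And>s. s \<in> S \<Longrightarrow> g s \<in> M"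
      using g(2) unfolding eventually_nhds by blast
    have "Q3_form a b c d (g s) = 1" if "s \<in> S" for s
      using S(3)[OF that] by (simp add: M_iff Q3_def)
    then show ?thesis
      by (intro has_derivative_transform_within_open[OF has_derivative_const[of 1] S(1,2)]) simp
  qed
  ultimately have "(\<lambda>h. (h *\<^sub>R v) \<bullet> G p) = (\<lambda>h. 0)" by (rule has_derivative_unique)
  then have "(1 *\<^sub>R v) \<bullet> G p = 0" by metis
  then show "v \<in> {v. v \<bullet> G p = 0}" by simp
next
  fix v assume "v \<in> {v. v \<bullet> G p = 0}"
  then have v: "p$1 * v$1 / a^2 = p$2 * v$2 / b^2 + p$3 * v$3 / c^2 + p$4 * v$4 / d^2"
    by (simp add: inner_G)
  define f where "f s = sqrt (1 + ((p$2 + s * v$2)/b)^2 + ((p$3 + s * v$3)/c)^2 + ((p$4 + s * v$4)/d)^2)" for s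
  define g where "g s = (vector [\<sigma> * a * f s, p$2 + s * v$2, p$3 + s * v$3, p$4 + s * v$4] :: real^4)" for s
  have f0: "f 0 > 0" unfolding f_def by (simp add: add_pos_nonneg)
  have p1: "p$1 = \<sigma> * a * f 0"
    using Phi_XYZ[OF p] p unfolding Q3_sheet_def f_def Q3_chart_def using pos0 d0 by auto
  have "g s \<in> M" for s
  proof -
    have "g s = Q3_chart a b c d \<sigma> ((p$2 + s * v$2)/b) ((p$3 + s * v$3)/c) ((p$4 + s * v$4)/d)"
      unfolding g_def f_def Q3_chart_def using pos0 d0 by simp
    then show ?thesis unfolding Q3_sheet_def by blast
  qed
  moreover have "g 0 = p" using p1 by (simp add: g_def vec_eq_iff forall_4)
  moreover have "(g has_vector_derivative v) (at 0)"
  proof -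
    have "(f has_real_derivative (p$2 * v$2 / b^2 + p$3 * v$3 / c^2 + p$4 * v$4 / d^2) / f 0) (at 0)"
    proof -
      let ?r = "\<lambda>s. 1 + ((p$2 + s * v$2)/b)^2 + ((p$3 + s * v$3)/c)^2 + ((p$4 + s * v$4)/d)^2"
      have "(?r has_real_derivative 2 * (p$2 / b) * (v$2 / b) + 2 * (p$3 / c) * (v$3 / c)
          + 2 * (p$4 / d) * (v$4 / d)) (at 0)"
        using pos0 d0 by (auto intro!: derivative_eq_intros simp: mult_ac)
      moreover have "?r 0 > 0" using f0 unfolding f_def by simp
      ultimately have "((\<lambda>s. sqrt (?r s)) has_real_derivative inverse (sqrt (?r 0)) / 2 *
          (2 * (p$2 / b) * (v$2 / b) + 2 * (p$3 / c) * (v$3 / c) + 2 * (p$4 / d) * (v$4 / d))) (at 0)"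
        by (intro DERIV_chain2[OF DERIV_real_sqrt])
      moreover have "inverse (sqrt (?r 0)) / 2 *
          (2 * (p$2 / b) * (v$2 / b) + 2 * (p$3 / c) * (v$3 / c) + 2 * (p$4 / d) * (v$4 / d))
        = (p$2 * v$2 / b^2 + p$3 * v$3 / c^2 + p$4 * v$4 / d^2) / f 0"
      proof -
        have "sqrt (?r 0) = f 0" by (simp add: f_def)
        moreover have "inverse F / 2 * (2 * (p$2 / b) * (v$2 / b) + 2 * (p$3 / c) * (v$3 / c) + 2 * (p$4 / d) * (v$4 / d))
          = (p$2 * v$2 / b^2 + p$3 * v$3 / c^2 + p$4 * v$4 / d^2) / F" for F
        proof -
          have "2 * (x / r) * (y / r) = 2 * (x * y / r^2)" for x y r :: real
            by (simp add: power2_eq_square)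
          moreover have "inverse F / 2 * (2 * x + 2 * y + 2 * z) = (x + y + z) / F" for x y z
            by (cases "F = 0") (simp_all add: field_simps)
          ultimately show ?thesis by (simp only:)
        qed
        ultimately show ?thesis by (simp only:)
      qed
      moreover have "(\<lambda>s. sqrt (?r s)) = f" by (simp add: f_def fun_eq_iff)
      ultimately show ?thesis by (simp only:)
    qed
    \<comment> \<open>Tangency of \<open>v\<close> identifies the derivative of the recovered
      coordinate with \<open>v$1\<close>.\<close>
    moreover have "\<sigma> * a * ((p$2 * v$2 / b^2 + p$3 * v$3 / c^2 + p$4 * v$4 / d^2) / f 0) = v$1"
      unfolding v[symmetric] p1 using f0 a0 s_sq by (simp add: field_simps power2_eq_square)
    ultimately have "((\<lambda>s. \<sigma> * a * f s) has_real_derivative v$1) (at 0)"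
      by (metis DERIV_cmult)
    then have 1: "((\<lambda>s. \<sigma> * a * f s) has_vector_derivative v$1) (at 0)"
      by (simp add: has_real_derivative_iff_has_vector_derivative)
    have 2: "((\<lambda>s. p$i + s * v$i) has_vector_derivative v$i) (at 0)" for i
      by (auto intro!: derivative_eq_intros simp: has_vector_derivative_def)
    have "((\<lambda>s. g s $ i) has_vector_derivative v$i) (at 0)" for i
      using exhaust_4[of i] 1 2 by (auto simp: g_def)
    then show ?thesis
      unfolding has_vector_derivative_def has_derivative_componentwise_within[of g]
      by (auto simp: Basis_vec_def inner_axis)
  qed
  ultimately show "v \<in> tangent_space M p" unfolding tangent_space_def by auto
qed

lemma dim_tangent: "p \<in> M \<Longrightarrow> dim {v. v \<bullet> G p = 0} = 3"
  using dim_hyperplane[OF G_nonzero] by (simp add: inner_commute)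

text \<open>The derivative of the negated unit normal is minus the tangential part of
  \<open>G v\<close> over \<open>norm (G p)\<close>. As the derivative within \<open>M\<close> is
  determined on tangent vectors only, both are compared along a curve in \<open>M\<close> with
  velocity \<open>v\<close>.\<close>

lemma shape_operator_M:
  assumes p: "p \<in> M" and v: "v \<bullet> G p = 0"
  shows "shape_operator M N p v = - (1 / norm (G p)) *\<^sub>R (G v - (N p \<bullet> G v) *\<^sub>R N p)"
proof -
  let ?n = "norm (G p)"
  let ?D = "\<lambda>v. - (1 / ?n) *\<^sub>R (G v - (N p \<bullet> G v) *\<^sub>R N p)"
  have n: "?n \<noteq> 0" using G_nonzero[OF p] by simp
  have dG: "(G has_derivative G) (at p)"
    by (simp add: linear_G linear_conv_bounded_linear[symmetric] bounded_linear_imp_has_derivative)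
  have "((\<lambda>q. - (inverse (norm (G q)) *\<^sub>R G q)) has_derivative ?D) (at p)"
  proof (rule has_derivative_eq_rhs)
    show "((\<lambda>q. - (inverse (norm (G q)) *\<^sub>R G q)) has_derivative
        (\<lambda>v. - (inverse ?n *\<^sub>R G v + (- (inverse ?n * (G v \<bullet> sgn (G p)) * inverse ?n)) *\<^sub>R G p))) (at p)"
      using has_derivative_minus[OF has_derivative_scaleR[OF Deriv.has_derivative_inverse[OF n
          has_derivative_compose[OF dG has_derivative_norm[OF G_nonzero[OF p]]]] dG]] .
    show "(\<lambda>v. - (inverse ?n *\<^sub>R G v + (- (inverse ?n * (G v \<bullet> sgn (G p)) * inverse ?n)) *\<^sub>R G p)) = ?D"
      by (simp add: fun_eq_iff sgn_div_norm N_eq divide_inverse scaleR_diff_right inner_commute mult_ac)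
  qed
  then have D: "((\<lambda>q. - N q) has_derivative ?D) (at p)" by (simp add: N_eq)
  have D': "((\<lambda>q. - N q) has_derivative shape_operator M N p) (at p within M)"
    unfolding shape_operator_def
    by (rule frechet_derivative_works[THEN iffD1, OF differentiableI[OF has_derivative_at_withinI[OF D]]])
  have "v \<in> tangent_space M p" using v tangent_space_M[OF p] by simp
  then obtain g where g: "g 0 = p" "\<forall>\<^sub>F s in nhds (0::real). g s \<in> M" "(g has_vector_derivative v) (at 0)"
    unfolding tangent_space_def by blast
  obtain S where S: "open S" "0 \<in> S" "\<And>s. s \<in> S \<Longrightarrow> g s \<in> M"
    using g(2) unfolding eventually_nhds by blast
  have "g ` S \<subseteq> M" using S by auto
  then have "(((\<lambda>q. - N q) \<circ> g) has_vector_derivative shape_operator M N p v) (at 0 within S)"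
    using vector_derivative_diff_chain_within[of g v 0 S "\<lambda>q. - N q" "shape_operator M N p"]
      has_vector_derivative_at_within[OF g(3)] has_derivative_subset[OF D'] g(1) by blast
  moreover have "(((\<lambda>q. - N q) \<circ> g) has_vector_derivative ?D v) (at 0 within S)"
    using vector_derivative_diff_chain_within[of g v 0 S "\<lambda>q. - N q" ?D]
      has_vector_derivative_at_within[OF g(3)] has_derivative_at_withinI[OF D] g(1) by blast
  ultimately show ?thesis
    using at_within_open[OF S(2,1)] vector_derivative_unique_at by metis
qed

text \<open>The eigenvalue equation concerns tangential parts only, hence is an equation for
  \<open>G v\<close> modulo multiples of the normal direction \<open>G p\<close>.\<close>

lemma shape_eigen_aux:
  assumes p: "p \<in> M" and v: "v \<bullet> G p = 0"
  shows "shape_operator M N p v = k *\<^sub>R v \<longleftrightarrow> (\<exists>\<mu>. G v + (norm (G p) * k) *\<^sub>R v = \<mu> *\<^sub>R G p)"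
proof -
  let ?n = "norm (G p)"
  have n: "?n \<noteq> 0" using G_nonzero[OF p] by simp
  have nN: "G p = ?n *\<^sub>R N p" using n by (simp add: N_eq)
  have vN: "v \<bullet> N p = 0" using v by (simp add: N_eq)
  have NN: "N p \<bullet> N p = 1" using N_unit[OF p] by (simp add: dot_square_norm)
  have "shape_operator M N p v = k *\<^sub>R v \<longleftrightarrow> (- ?n) *\<^sub>R shape_operator M N p v = (- ?n) *\<^sub>R (k *\<^sub>R v)"
    by (simp only: scaleR_cancel_left neg_equal_0_iff_equal n simp_thms)
  also have "\<dots> \<longleftrightarrow> G v + (?n * k) *\<^sub>R v = (N p \<bullet> G v) *\<^sub>R N p"
    using n by (simp add: shape_operator_M[OF p v] algebra_simps eq_neg_iff_add_eq_0)
  also have "\<dots> \<longleftrightarrow> (\<exists>\<mu>. G v + (?n * k) *\<^sub>R v = \<mu> *\<^sub>R G p)"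
  proof
    assume "G v + (?n * k) *\<^sub>R v = (N p \<bullet> G v) *\<^sub>R N p"
    then have "G v + (?n * k) *\<^sub>R v = ((N p \<bullet> G v) / ?n) *\<^sub>R G p"
      using n by (simp add: N_eq divide_inverse)
    then show "\<exists>\<mu>. G v + (?n * k) *\<^sub>R v = \<mu> *\<^sub>R G p" ..
  next
    assume "\<exists>\<mu>. G v + (?n * k) *\<^sub>R v = \<mu> *\<^sub>R G p"
    then obtain \<mu> where \<mu>: "G v + (?n * k) *\<^sub>R v = \<mu> *\<^sub>R G p" ..
    then have "N p \<bullet> (G v + (?n * k) *\<^sub>R v) = N p \<bullet> (\<mu> *\<^sub>R G p)" by simp
    moreover have "N p \<bullet> G p = ?n" using n by (simp add: N_eq dot_square_norm power2_eq_square)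
    ultimately have "N p \<bullet> G v = \<mu> * ?n"
      using vN by (simp add: inner_add_right inner_commute[of "N p" v])
    then show "G v + (?n * k) *\<^sub>R v = (N p \<bullet> G v) *\<^sub>R N p"
      using \<mu> n by (simp add: N_eq)
  qed
  finally show ?thesis .
qed

text \<open>Tangency expresses \<open>p$1 * v$1\<close> by the other three products, and the squared
  scaling factor \<open>(a^2 + r^2) / r^2\<close> collects both contributions of a coordinate with
  semi-axis \<open>r\<close>.\<close>

lemma h_eq:
  assumes "v \<bullet> G p = 0"
  shows "X p * X v + Y p * Y v + Z p * Z v = p \<bullet> v"
proof -
  have t: "p$1 * v$1 / a^2 = p$2 * v$2 / b^2 + p$3 * v$3 / c^2 + p$4 * v$4 / d^2"
    using assms by (simp add: inner_G)
  have "X p * X v = a^2 * (p$2 * v$2 / b^2) + p$2 * v$2"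
    "Y p * Y v = a^2 * (p$3 * v$3 / c^2) + p$3 * v$3"
    "Z p * Z v = a^2 * (p$4 * v$4 / d^2) + p$4 * v$4"
  proof -
    have "(sqrt (a^2 + r^2) / r * x) * (sqrt (a^2 + r^2) / r * y) = a^2 * (x * y / r^2) + x * y"
      if "r > 0" for r x y :: real
    proof -
      have "(sqrt (a^2 + r^2) / r * x) * (sqrt (a^2 + r^2) / r * y)
          = (sqrt (a^2 + r^2) * sqrt (a^2 + r^2)) * (x * y) / r^2"
        by (simp add: power2_eq_square)
      also have "\<dots> = (a^2 + r^2) * (x * y) / r^2" by simp
      finally show ?thesis using that by (simp add: field_simps)
    qed
    then show "X p * X v = a^2 * (p$2 * v$2 / b^2) + p$2 * v$2"
      "Y p * Y v = a^2 * (p$3 * v$3 / c^2) + p$3 * v$3"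
      "Z p * Z v = a^2 * (p$4 * v$4 / d^2) + p$4 * v$4"
      unfolding X_def Y_def Z_def using pos0 d0 by blast+
  qed
  moreover have "a^2 * (p$1 * v$1 / a^2) = p$1 * v$1" using a0 by simp
  ultimately show ?thesis using t by (simp add: inner4 algebra_simps)
qed

text \<open>Contracting the last three coordinate equations with \<open>p\<close>, weighted by the
  inverse squared semi-axes, ties \<mu> to the first equation and yields
  \<open>\<mu> = K * (p \<bullet> v)\<close>. Conversely the first equation follows because
  \<open>p$1\<close> is non-zero.\<close>

lemma eigen_iff:
  assumes p: "p \<in> M" and v: "v \<bullet> G p = 0"
  shows "(\<exists>\<mu>. G v + (2 * K) *\<^sub>R v = \<mu> *\<^sub>R G p) \<longleftrightarrow>
    (1 - K * b^2) * X v = K * (p \<bullet> v) * X p \<and> (1 - K * c^2) * Y v = K * (p \<bullet> v) * Y p \<and>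
    (1 - K * d^2) * Z v = K * (p \<bullet> v) * Z p" (is "?l \<longleftrightarrow> ?r")
proof -
  have t: "p$1 * v$1 / a^2 = p$2 * v$2 / b^2 + p$3 * v$3 / c^2 + p$4 * v$4 / d^2"
    using v by (simp add: inner_G)
  have q: "p$1 * p$1 / a^2 - 1 = p$2 * p$2 / b^2 + p$3 * p$3 / c^2 + p$4 * p$4 / d^2"
    using p M_iff[of p] by (simp add: Q3_def Q3_form_def power2_eq_square algebra_simps)
  have comp: "G v + (2 * K) *\<^sub>R v = \<mu> *\<^sub>R G p \<longleftrightarrow> (1 + K * a^2) * v$1 = \<mu> * p$1 \<and>
      (1 - K * b^2) * v$2 = \<mu> * p$2 \<and> (1 - K * c^2) * v$3 = \<mu> * p$3 \<and> (1 - K * d^2) * v$4 = \<mu> * p$4" for \<mu>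
  proof -
    have "2 * v$1 / a^2 + 2 * K * v$1 = \<mu> * (2 * p$1 / a^2) \<longleftrightarrow> (1 + K * a^2) * v$1 = \<mu> * p$1"
    proof -
      have "2 * v$1 / a^2 + 2 * K * v$1 - \<mu> * (2 * p$1 / a^2) = 2 / a^2 * ((1 + K * a^2) * v$1 - \<mu> * p$1)"
        using a0 by (simp add: algebra_simps)
      then show ?thesis using a0 by (metis divide_eq_0_iff eq_iff_diff_eq_0 less_irrefl
          mult_eq_0_iff power_not_zero zero_neq_numeral)
    qed
    moreover have "- 2 * v$i / \<beta>^2 + 2 * K * v$i = \<mu> * (- 2 * p$i / \<beta>^2) \<longleftrightarrow> (1 - K * \<beta>^2) * v$i = \<mu> * p$i"
      if "\<beta> > 0" for i \<beta>
    proof -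
      have "- 2 * v$i / \<beta>^2 + 2 * K * v$i - \<mu> * (- 2 * p$i / \<beta>^2) = - 2 / \<beta>^2 * ((1 - K * \<beta>^2) * v$i - \<mu> * p$i)"
        using that by (simp add: algebra_simps)
      then show ?thesis using that by (metis diff_eq_eq add_0 divide_eq_0_iff eq_iff_diff_eq_0 less_irrefl
          mult_eq_0_iff neg_equal_0_iff_equal power_not_zero zero_neq_numeral)
    qed
    ultimately show ?thesis using pos0 d0 by (simp add: vec_eq_iff forall_4)
  qed
  have rX: "(1 - K * b^2) * X v = \<mu> * X p \<longleftrightarrow> (1 - K * b^2) * v$2 = \<mu> * p$2"
    "(1 - K * c^2) * Y v = \<mu> * Y p \<longleftrightarrow> (1 - K * c^2) * v$3 = \<mu> * p$3"
    "(1 - K * d^2) * Z v = \<mu> * Z p \<longleftrightarrow> (1 - K * d^2) * v$4 = \<mu> * p$4" for \<mu>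
  proof -
    have r: "A * (r * x) = \<mu> * (r * y) \<longleftrightarrow> A * x = \<mu> * y" if "r > 0" for A r x y :: real
      using that by (simp only: mult.left_commute[of _ r] mult_cancel_left) simp
    show "(1 - K * b^2) * X v = \<mu> * X p \<longleftrightarrow> (1 - K * b^2) * v$2 = \<mu> * p$2"
      "(1 - K * c^2) * Y v = \<mu> * Y p \<longleftrightarrow> (1 - K * c^2) * v$3 = \<mu> * p$3"
      "(1 - K * d^2) * Z v = \<mu> * Z p \<longleftrightarrow> (1 - K * d^2) * v$4 = \<mu> * p$4"
      unfolding X_def Y_def Z_def
      using r[OF divide_pos_pos[OF roots_pos(1) pos0(1)]] r[OF divide_pos_pos[OF roots_pos(2) pos0(2)]]
        r[OF divide_pos_pos[OF roots_pos(3) d0]] by blast+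
  qed
  have sum: "p$1 * v$1 / a^2 - K * (p$2 * v$2 + p$3 * v$3 + p$4 * v$4) = \<mu> * (p$1 * p$1 / a^2 - 1)"
    if "(1 - K * b^2) * v$2 = \<mu> * p$2" "(1 - K * c^2) * v$3 = \<mu> * p$3" "(1 - K * d^2) * v$4 = \<mu> * p$4" for \<mu>
  proof -
    have "p$2 * v$2 / b^2 - K * (p$2 * v$2) = \<mu> * (p$2 * p$2 / b^2)"
      "p$3 * v$3 / c^2 - K * (p$3 * v$3) = \<mu> * (p$3 * p$3 / c^2)"
      "p$4 * v$4 / d^2 - K * (p$4 * v$4) = \<mu> * (p$4 * p$4 / d^2)"
      using that pos0 d0 by (simp_all add: divide_simps) algebra+
    then show ?thesis unfolding t q by (simp add: algebra_simps)
  qed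
  have a2: "a^2 * (p$1 * v$1 / a^2) = p$1 * v$1" "a^2 * (p$1 * p$1 / a^2) = p$1 * p$1" using a0 by auto
  have pv: "p \<bullet> v = p$1 * v$1 + (p$2 * v$2 + p$3 * v$3 + p$4 * v$4)" by (simp add: inner4)
  show ?thesis
  proof
    assume ?l
    then obtain \<mu> where \<mu>: "(1 + K * a^2) * v$1 = \<mu> * p$1"
      "(1 - K * b^2) * v$2 = \<mu> * p$2" "(1 - K * c^2) * v$3 = \<mu> * p$3" "(1 - K * d^2) * v$4 = \<mu> * p$4"
      unfolding comp by blast
    have "a^2 * \<mu> = a^2 * (K * (p \<bullet> v))"
      using sum[OF \<mu>(2-4)] \<mu>(1) a2 unfolding pv by algebra
    then have "\<mu> = K * (p \<bullet> v)" using a0 by simp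
    then show ?r using \<mu> rX by auto
  next
    assume ?r
    define \<mu> where "\<mu> = K * (p \<bullet> v)"
    have \<mu>: "(1 - K * b^2) * v$2 = \<mu> * p$2" "(1 - K * c^2) * v$3 = \<mu> * p$3" "(1 - K * d^2) * v$4 = \<mu> * p$4"
      using \<open>?r\<close> rX unfolding \<mu>_def by auto
    have "p$1 * ((1 + K * a^2) * v$1) = p$1 * (\<mu> * p$1)"
      using sum[OF \<mu>] a2 \<mu>_def unfolding pv by algebra
    then have "(1 + K * a^2) * v$1 = \<mu> * p$1" using p1_nonzero[OF p] by simp
    then show ?l using \<mu> comp by blast
  qed
qed

text \<open>For this curvature the constant of \<open>eigen_iff\<close> is \<open>K = 1 / m\<close>,
  and multiplying the rows by \<open>m\<close> gives the eigenvector equation. The 2 stems from the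
  gradient.\<close>

lemma shape_eigen:
  assumes p: "p \<in> M" and v: "v \<bullet> G p = 0" and m: "m \<noteq> 0"
  shows "shape_operator M N p v = (2 / (norm (G p) * m)) *\<^sub>R v \<longleftrightarrow>
    is_eigvec (X p) (Y p) (Z p) m (X v) (Y v) (Z v)"
proof -
  have n: "norm (G p) \<noteq> 0" using G_nonzero[OF p] by simp
  have "shape_operator M N p v = (2 / (norm (G p) * m)) *\<^sub>R v \<longleftrightarrow>
      (\<exists>\<mu>. G v + (2 * (1 / m)) *\<^sub>R v = \<mu> *\<^sub>R G p)"
    unfolding shape_eigen_aux[OF p v] using n by simp
  also have "\<dots> \<longleftrightarrow> is_eigvec (X p) (Y p) (Z p) m (X v) (Y v) (Z v)"
    unfolding eigen_iff[OF p v] is_eigvec_def Let_def h_eq[OF v]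
    using m by (simp add: field_simps)
  finally show ?thesis .
qed

text \<open>The normal has a non-zero first component, so a tangent vector is determined by its
  linear coordinates.\<close>

lemma tangent_zero:
  assumes p: "p \<in> M" and v: "v \<bullet> G p = 0" and z: "X v = 0" "Y v = 0" "Z v = 0"
  shows "v = 0"
proof -
  have 0: "v$2 = 0" "v$3 = 0" "v$4 = 0" using z roots_pos pos0 d0 by (auto simp: X_def Y_def Z_def)
  then have "v$1 = 0" using v p1_nonzero[OF p] a0 by (auto simp: inner4)
  then show ?thesis using 0 by (simp add: vec_eq_iff forall_4)
qed

text \<open>Contracting the rows with the linear coordinates of \<open>v\<close> writes a positive
  sum of squares as \<open>K\<close> times a non-negative one. Positivity permits the passage to the
  reciprocal \<open>m\<close> and makes it reverse the order.\<close>

lemma shape_eigen_pos: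
  assumes p: "p \<in> M" and v: "v \<bullet> G p = 0" "v \<noteq> 0" and k: "shape_operator M N p v = k *\<^sub>R v"
  shows "k > 0"
proof -
  define K where "K = norm (G p) * k / 2"
  have n: "norm (G p) > 0" using G_nonzero[OF p] by simp
  have "\<exists>\<mu>. G v + (2 * K) *\<^sub>R v = \<mu> *\<^sub>R G p"
    using k unfolding shape_eigen_aux[OF p v(1)] K_def by simp
  then have eq: "(1 - K * b^2) * X v = K * (p \<bullet> v) * X p" "(1 - K * c^2) * Y v = K * (p \<bullet> v) * Y p"
    "(1 - K * d^2) * Z v = K * (p \<bullet> v) * Z p" unfolding eigen_iff[OF p v(1)] by auto
  have "X v * X v + Y v * Y v + Z v * Z v
      = K * (b^2 * (X v * X v) + c^2 * (Y v * Y v) + d^2 * (Z v * Z v) + (p \<bullet> v) * (p \<bullet> v))"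
    using eq h_eq[OF v(1)] by algebra
  moreover have "X v * X v + Y v * Y v + Z v * Z v > 0"
    using tangent_zero[OF p v(1)] v(2)
    by (smt (verit) mult_eq_0_iff not_real_square_gt_zero zero_le_square)
  ultimately have "0 < K * (b^2 * (X v * X v) + c^2 * (Y v * Y v) + d^2 * (Z v * Z v) + (p \<bullet> v) * (p \<bullet> v))"
    by simp
  moreover have "0 \<le> b^2 * (X v * X v) + c^2 * (Y v * Y v) + d^2 * (Z v * Z v) + (p \<bullet> v) * (p \<bullet> v)"
    by simp
  ultimately have "K > 0" by (simp add: zero_less_mult_iff)
  then show ?thesis using n by (simp add: K_def zero_less_mult_iff)
qed

text \<open>The condition under the description operator of \<open>principal_curvatures\<close>,
  with the frame as an argument, so that existence and uniqueness can be treated separately.\<close>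

definition principal_frame :: "real^4 \<Rightarrow> real^3 \<Rightarrow> (3 \<Rightarrow> real^4) \<Rightarrow> bool" where
  "principal_frame p k e \<longleftrightarrow> k$1 \<le> k$2 \<and> k$2 \<le> k$3 \<and>
     (\<forall>i j. e i \<bullet> e j = (if i = j then 1 else 0)) \<and> span (range e) = tangent_space M p \<and>
     (\<forall>i. shape_operator M N p (e i) = k$i *\<^sub>R e i)"

text \<open>Tangent vectors are determined by their linear coordinates, so the frame stays
  independent in three-space and \<open>chi_eigenbasis\<close> identifies all roots of
  \<open>chi\<close>.\<close>

lemma principal_frame_ell:
  assumes p: "p \<in> M" and f: "principal_frame p k e"
  shows "ell (X p) (Y p) (Z p) (\<chi> i. 2 / (norm (G p) * k$i))" "\<And>i. k$i > 0"
proof -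
  have ort: "e i \<bullet> e j = (if i = j then 1 else 0)" for i j using f by (simp add: principal_frame_def)
  have T: "e i \<bullet> G p = 0" for i
    using f tangent_space_M[OF p] unfolding principal_frame_def by (auto simp: span_base)
  have nz: "e i \<noteq> 0" for i using ort[of i i] by auto
  have sh: "shape_operator M N p (e i) = k$i *\<^sub>R e i" for i using f by (simp add: principal_frame_def)
  show kp: "k$i > 0" for i by (rule shape_eigen_pos[OF p T nz sh])
  have n: "norm (G p) > 0" using G_nonzero[OF p] by simp
  define m :: "real^3" where "m = (\<chi> i. 2 / (norm (G p) * k$i))"
  have m: "m$i \<noteq> 0" "2 / (norm (G p) * m$i) = k$i" for i
    using kp[of i] n by (auto simp: m_def)
  have ev: "is_eigvec (X p) (Y p) (Z p) (m$i) (X (e i)) (Y (e i)) (Z (e i))" for i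
    using shape_eigen[OF p T m(1), of i i] sh m(2) by simp
  define W :: "3 \<Rightarrow> real^3" where "W j = vector [X (e j), Y (e j), Z (e j)]" for j
  have "chi (X p) (Y p) (Z p) t = (t - m$1) * (t - m$2) * (t - m$3)" for t
  proof (rule chi_eigenbasis[of m W])
    fix r :: "real^3" assume 0: "(\<Sum>j\<in>UNIV. r$j *\<^sub>R W j) = 0"
    let ?v = "\<Sum>j\<in>UNIV. r$j *\<^sub>R e j"
    have "X ?v = 0" "Y ?v = 0" "Z ?v = 0"
      using arg_cong[OF 0, of "\<lambda>w. w$1"] arg_cong[OF 0, of "\<lambda>w. w$2"] arg_cong[OF 0, of "\<lambda>w. w$3"]
      by (simp_all add: W_def linear_sum[OF linear_XYZ(1)] linear_sum[OF linear_XYZ(2)] linear_sum[OF linear_XYZ(3)]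
          linear_cmul[OF linear_XYZ(1)] linear_cmul[OF linear_XYZ(2)] linear_cmul[OF linear_XYZ(3)])
    moreover have "?v \<bullet> G p = 0" using T by (simp add: inner_sum_left)
    ultimately have "?v = 0" by (intro tangent_zero[OF p])
    then have "?v \<bullet> e i = 0" for i by simp
    then have "r$i = 0" for i
      using ort by (simp add: inner_sum_left if_distrib cong: if_cong)
    then show "r = 0" by (simp add: vec_eq_iff)
  qed (use ev in \<open>auto simp: is_eigvec_def Let_def W_def\<close>)
  moreover have "m$3 \<le> m$2" "m$2 \<le> m$1"
    using f kp n unfolding principal_frame_def m_def
    by (auto intro!: divide_left_mono mult_left_mono)
  ultimately have "ell (X p) (Y p) (Z p) m" by (rule ell_if_chi)
  then show "ell (X p) (Y p) (Z p) (\<chi> i. 2 / (norm (G p) * k$i))" by (simp add: m_def)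
qed

text \<open>The eigenbasis lemma needs a map that is linear on the whole space. It is applied to the
  explicit formula \<open>?f\<close>, which agrees with the shape operator on tangent
  vectors.\<close>

lemma principal_frame_exists:
  assumes p: "p \<in> M"
  obtains k e where "principal_frame p k e"
proof -
  let ?T = "{v. v \<bullet> G p = 0}"
  let ?f = "\<lambda>v. - (1 / norm (G p)) *\<^sub>R (G v - (N p \<bullet> G v) *\<^sub>R N p)"
  have n: "norm (G p) \<noteq> 0" using G_nonzero[OF p] by simp
  have "linear ?f"
    by (rule linearI) (simp_all add: linear_add[OF linear_G] linear_cmul[OF linear_G] inner_add_right algebra_simps)
  moreover have "subspace ?T" by (auto simp: subspace_def inner_add_left)
  moreover have NN: "N p \<bullet> G p = norm (G p)"
    using n by (simp add: N_eq dot_square_norm power2_eq_square)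
  have "G v \<bullet> G p - (N p \<bullet> G v) * norm (G p) = 0" for v
    using n by (simp add: N_eq inner_commute)
  then have "?f ` ?T \<subseteq> ?T" by (auto simp: inner_diff_left NN)
  moreover have "?f u \<bullet> v = u \<bullet> ?f v" if "u \<in> ?T" "v \<in> ?T" for u v
  proof -
    have "N p \<bullet> v = 0" "u \<bullet> N p = 0" using that by (auto simp: N_eq inner_commute)
    then show ?thesis by (simp add: inner_diff_left inner_diff_right G_sym)
  qed
  ultimately obtain e :: "3 \<Rightarrow> real^4" and k :: "real^3" where e:
    "\<And>i j. e i \<bullet> e j = (if i = j then 1 else 0)" "span (range e) = ?T"
    "\<And>i. ?f (e i) = k$i *\<^sub>R e i" "k$1 \<le> k$2" "k$2 \<le> k$3"
    using orthonormal_eigenbasis3[of ?f ?T] dim_tangent[OF p] by blast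
  have "e i \<in> span (range e)" for i by (simp add: span_base)
  then have "e i \<bullet> G p = 0" for i unfolding e(2) by simp
  then have "shape_operator M N p (e i) = k$i *\<^sub>R e i" for i
    using e(3) shape_operator_M[OF p] by simp
  then have "principal_frame p k e"
    unfolding principal_frame_def using e tangent_space_M[OF p] by simp
  then show ?thesis using that by blast
qed

definition mu :: "real^4 \<Rightarrow> real^3" where
  "mu p = (THE m. ell (X p) (Y p) (Z p) m)"

lemma mu_eqI: "ell (X p) (Y p) (Z p) m \<Longrightarrow> mu p = m"
  unfolding mu_def using ell_unique by blast

text \<open>Existence of the ellipsoidal coordinates is read off from a principal frame rather than
  by locating the roots of \<open>chi\<close>.\<close>

lemma ell_mu: "p \<in> M \<Longrightarrow> ell (X p) (Y p) (Z p) (mu p)"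
  by (metis principal_frame_exists principal_frame_ell(1) mu_eqI)

lemma mu_pos:
  assumes "p \<in> M"
  shows "mu p $ i > 0"
proof -
  have "mu p $ 1 > 0" "mu p $ 2 > 0" "mu p $ 3 > 0"
    using ell_ranges[OF ell_mu[OF assms]] D0 CD BC by linarith+
  then show ?thesis using exhaust_3[of i] by auto
qed

lemma principal_frame_curvatures:
  assumes p: "p \<in> M" and f: "principal_frame p k e"
  shows "k$i = 2 / (norm (G p) * mu p $ i)"
  using mu_eqI[OF principal_frame_ell(1)[OF p f]] principal_frame_ell(2)[OF p f, of i] G_nonzero[OF p]
  by simp

text \<open>Every admissible frame yields the curvatures computed from \<open>mu p\<close>, so the
  description in the definition has a unique value.\<close>

lemma principal_curvatures_frame:
  assumes p: "p \<in> M" and f: "principal_frame p k e"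
  shows "principal_curvatures M N p = k"
  unfolding principal_curvatures_def
proof (rule the_equality)
  show "k$1 \<le> k$2 \<and> k$2 \<le> k$3 \<and> (\<exists>e :: 3 \<Rightarrow> real^4. (\<forall>i j. e i \<bullet> e j = (if i = j then 1 else 0)) \<and>
     span (range e) = tangent_space M p \<and> (\<forall>i. shape_operator M N p (e i) = k$i *\<^sub>R e i))"
    using f unfolding principal_frame_def by blast
  fix l assume "l$1 \<le> l$2 \<and> l$2 \<le> l$3 \<and> (\<exists>e :: 3 \<Rightarrow> real^4. (\<forall>i j. e i \<bullet> e j = (if i = j then 1 else 0)) \<and>
     span (range e) = tangent_space M p \<and> (\<forall>i. shape_operator M N p (e i) = l$i *\<^sub>R e i))"
  then obtain e' where "principal_frame p l e'" unfolding principal_frame_def by blast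
  then show "l = k"
    using principal_frame_curvatures[OF p] f by (metis vec_eq_iff)
qed

lemma principal_curvatures_M: "p \<in> M \<Longrightarrow> principal_curvatures M N p $ i = 2 / (norm (G p) * mu p $ i)"
  using principal_frame_exists principal_curvatures_frame principal_frame_curvatures by metis

lemma curvature_eq_iff: "p \<in> M \<Longrightarrow>
    principal_curvatures M N p $ i = principal_curvatures M N p $ j \<longleftrightarrow> mu p $ i = mu p $ j"
  and curvature_less_iff: "p \<in> M \<Longrightarrow>
    principal_curvatures M N p $ i < principal_curvatures M N p $ j \<longleftrightarrow> mu p $ j < mu p $ i"
  using G_nonzero[of p] mu_pos[of p i] mu_pos[of p j]
  by (auto simp: principal_curvatures_M divide_simps)

lemma eigenspace_M:
  assumes p: "p \<in> M"
  shows "eigenspace M N p (principal_curvatures M N p $ i) =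
    {v. v \<bullet> G p = 0 \<and> is_eigvec (X p) (Y p) (Z p) (mu p $ i) (X v) (Y v) (Z v)}"
  using shape_eigen[OF p _ mu_pos[OF p, THEN less_imp_neq, symmetric]]
  by (auto simp: eigenspace_def tangent_space_M[OF p] principal_curvatures_M[OF p])

text \<open>The ranges of the extreme roots are disjoint, since the third is at most c^2 and the
  first at least b^2.\<close>

lemma umbilic_empty: "umbilic_set M N = {}"
  using ell_ranges[OF ell_mu] by (fastforce simp: umbilic_set_def Let_def curvature_eq_iff)

lemma P12_mu: "partially_umbilic_set12 M N = {p \<in> M. mu p $ 1 = mu p $ 2}"
  using ell_ranges[OF ell_mu]
  by (fastforce simp: partially_umbilic_set12_def Let_def curvature_eq_iff curvature_less_iff)

lemma P23_mu: "partially_umbilic_set23 M N = {p \<in> M. mu p $ 2 = mu p $ 3}"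
  using ell_ranges[OF ell_mu]
  by (fastforce simp: partially_umbilic_set23_def Let_def curvature_eq_iff curvature_less_iff)

lemma foliation_domain_M:
  "foliation_domain M N i = {p \<in> M. \<forall>j. j \<noteq> i \<longrightarrow> mu p $ j \<noteq> mu p $ i}"
proof -
  have "mu p $ 1 \<noteq> mu p $ 3" "mu p $ 3 \<noteq> mu p $ 1" if "p \<in> M" for p
    using ell_ranges[OF ell_mu[OF that]] by simp_all
  then show ?thesis
    using exhaust_3[of i]
    by (auto simp: foliation_domain_def singular_set_def umbilic_empty P12_mu P23_mu forall_3)
qed

end

subsection \<open>Principal lines and leaves\<close>

lemma smooth_on_continuous_vector_derivative:
  fixes f :: "real \<Rightarrow> 'a::euclidean_space"
  assumes "smooth_on I f"
  shows "continuous_on I (\<lambda>s. vector_derivative f (at s))"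
proof -
  have "Ck_on (Suc 0) I f" using assms unfolding smooth_on_def by blast
  then have d: "\<forall>x\<in>I. f differentiable (at x)" and c: "continuous_on I (dir_deriv 1 f)" by auto
  show ?thesis
    by (rule continuous_on_cong[THEN iffD1, OF refl _ c])
      (use d in \<open>simp add: dir_deriv_def frechet_derivative_eq_vector_derivative\<close>)
qed

lemma sgn_constant:
  fixes w :: "real \<Rightarrow> real"
  assumes "is_interval I" "continuous_on I w" "s0 \<in> I" "s1 \<in> I" "\<And>s. s \<in> I \<Longrightarrow> w s \<noteq> 0"
  shows "sgn (w s0) = sgn (w s1)"
proof -
  have "is_interval (w ` I)"
    using assms(1,2) connected_continuous_image is_interval_connected_1 by blast
  moreover have "w s0 \<in> w ` I" "w s1 \<in> w ` I" "0 \<notin> w ` I" using assms by auto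
  ultimately have "\<not> (w s0 \<le> 0 \<and> 0 \<le> w s1)" "\<not> (w s1 \<le> 0 \<and> 0 \<le> w s0)"
    unfolding is_interval_1 by blast+
  then show ?thesis by (auto simp: sgn_if)
qed

lemma eq_if_square_sgn_eq:
  fixes x y :: real
  assumes "x^2 = y^2" "sgn x = sgn y"
  shows "x = y"
proof -
  have "\<bar>x\<bar> = \<bar>y\<bar>" using assms(1) by (simp add: power2_eq_iff abs_eq_iff)
  then show ?thesis using assms(2) by (metis abs_sgn mult_sgn_abs)
qed

context quadric
begin

abbreviation "B \<equiv> b^2"
abbreviation "C \<equiv> c^2"
abbreviation "D \<equiv> d^2"

lemma continuous_on_mu: "continuous_on M (\<lambda>p. mu p $ i)"
  by (rule ell_continuous[of _ X Y Z]) (auto intro: continuous_intros ell_mu)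

lemma mu_Phi: "ell x y z m \<Longrightarrow> mu (Phi x y z) = m"
  by (rule mu_eqI) simp

lemma tangent_curve:
  assumes "open I" "s \<in> I" "\<And>t. t \<in> I \<Longrightarrow> g t \<in> S" "(g has_vector_derivative v) (at s)"
  shows "v \<in> tangent_space S (g s)"
proof -
  have "((\<lambda>t. g (t + s)) has_vector_derivative v) (at 0)"
  proof -
    have "((\<lambda>t. t + s) has_vector_derivative 1) (at 0)"
      by (auto intro!: derivative_eq_intros simp flip: has_real_derivative_iff_has_vector_derivative)
    from vector_diff_chain_at[OF this, of g v] assms(4) show ?thesis by (simp add: o_def)
  qed
  moreover have "\<forall>\<^sub>F t in nhds 0. g (t + s) \<in> S"
  proof -
    have "open ((\<lambda>t. t + s) -` I)" using assms(1) by (intro open_vimage) (auto intro: continuous_intros)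
    then show ?thesis using assms(2,3) unfolding eventually_nhds by force
  qed
  ultimately show ?thesis unfolding tangent_space_def by (intro CollectI exI[of _ "\<lambda>t. g (t + s)"]) auto
qed

lemma has_real_derivative_XYZ:
  assumes "(g has_vector_derivative v) (at s)"
  shows "((\<lambda>t. X (g t)) has_real_derivative X v) (at s)"
    "((\<lambda>t. Y (g t)) has_real_derivative Y v) (at s)"
    "((\<lambda>t. Z (g t)) has_real_derivative Z v) (at s)"
  unfolding has_real_derivative_iff_has_vector_derivative
  using bounded_linear_XYZ bounded_linear.has_vector_derivative assms by blast+

text \<open>Regularity may be witnessed by a coordinate or by the moving root, whose derivative is
  twice the inner product of position and velocity and would vanish with the velocity.\<close>

lemma principal_lineI:
  fixes x y z :: "real \<Rightarrow> real" and m :: "real \<Rightarrow> real^3"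
  assumes I: "open I" "is_interval I"
    and sm: "smooth_on I x" "smooth_on I y" "smooth_on I z"
    and e: "\<And>s. s \<in> I \<Longrightarrow> ell (x s) (y s) (z s) (m s)"
    and c: "\<And>s t j. s \<in> I \<Longrightarrow> t \<in> I \<Longrightarrow> j \<noteq> i \<Longrightarrow> m s $ j = m t $ j"
    and n: "\<And>s j. s \<in> I \<Longrightarrow> j \<noteq> i \<Longrightarrow> m s $ j \<noteq> m s $ i"
    and d: "\<And>s. s \<in> I \<Longrightarrow> \<exists>w\<in>{x, y, z, \<lambda>s. m s $ i}. \<exists>D. D \<noteq> 0 \<and> (w has_real_derivative D) (at s)"
  shows "principal_line M N i I (\<lambda>s. Phi (x s) (y s) (z s))"
proof -
  let ?g = "\<lambda>s. Phi (x s) (y s) (z s)"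
  have g: "smooth_on I ?g" by (intro smooth_intros sm I)
  have "?g s \<in> foliation_domain M N i \<and> vector_derivative ?g (at s) \<noteq> 0 \<and>
      vector_derivative ?g (at s) \<in> eigenline M N i (?g s)" if s: "s \<in> I" for s
  proof -
    define v where "v = vector_derivative ?g (at s)"
    have dv: "(?g has_vector_derivative v) (at s)"
      unfolding v_def by (rule smooth_on_has_vector_derivative[OF g s])
    have dx: "(x has_real_derivative X v) (at s)" "(y has_real_derivative Y v) (at s)"
      "(z has_real_derivative Z v) (at s)"
      using has_real_derivative_XYZ[OF dv] by simp_all
    have "v \<in> tangent_space M (?g s)" by (rule tangent_curve[OF I(1) s _ dv]) simp
    then have T: "v \<bullet> G (?g s) = 0" by (simp add: tangent_space_M)
    note ev = coordinate_line_eigvec[where i = i, OF I(1) s e c[OF _ s] dx]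
    have mu: "mu (?g s) = m s" by (rule mu_Phi[OF e[OF s]])
    have "v \<noteq> 0"
    proof
      assume "v = 0"
      then have "X v = 0" "Y v = 0" "Z v = 0" using linear_0[OF linear_XYZ(1)] linear_0[OF linear_XYZ(2)] linear_0[OF linear_XYZ(3)] by auto
      then show False using d[OF s] dx ev(2) by (auto dest: DERIV_unique)
    qed
    moreover have "v \<in> eigenline M N i (?g s)"
      unfolding eigenline_def eigenspace_M[OF Phi_in_M] using T ev(1) mu by simp
    moreover have "?g s \<in> foliation_domain M N i"
      unfolding foliation_domain_M using n[OF s] mu by simp
    ultimately show ?thesis by (simp add: v_def)
  qed
  then show ?thesis unfolding principal_line_def using I g by blast
qed

section \<open>Invariants of principal lines\<close>

lemma principal_line_constant:
  assumes l: "principal_line M N i I g" and s: "s0 \<in> I" "s1 \<in> I" and j: "j \<noteq> i"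
  shows "mu (g s0) $ j = mu (g s1) $ j"
proof -
  let ?v = "\<lambda>s. vector_derivative g (at s)"
  have I: "open I" "is_interval I" and g: "smooth_on I g"
    and gs: "\<And>s. s \<in> I \<Longrightarrow> g s \<in> foliation_domain M N i \<and> ?v s \<in> eigenline M N i (g s)"
    using l unfolding principal_line_def by auto
  have gM: "g s \<in> M" if "s \<in> I" for s using gs[OF that] foliation_domain_M by auto
  have cv: "continuous_on I ?v" by (rule smooth_on_continuous_vector_derivative[OF g])
  note dv = smooth_on_has_vector_derivative[OF g]
  show ?thesis
  proof (rule eigenvalues_constant[OF I(2) s])
    show "continuous_on I (\<lambda>s. X (?v s))" "continuous_on I (\<lambda>s. Y (?v s))" "continuous_on I (\<lambda>s. Z (?v s))"
      by (intro continuous_intros cv)+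
    show "is_eigvec (X (g s)) (Y (g s)) (Z (g s)) (mu (g s) $ i) (X (?v s)) (Y (?v s)) (Z (?v s))"
      if "s \<in> I" for s
      using gs[OF that] unfolding eigenline_def eigenspace_M[OF gM[OF that]] by simp
  qed (use has_real_derivative_XYZ[OF dv] ell_mu gM j in auto)
qed

text \<open>These are the linear coordinates whose zeros depend on the two constant roots only: X
  vanishes when root 1 or 2 is B, Y when root 2 or 3 is C, Z when root 3 is D.\<close>

definition same_sign :: "3 \<Rightarrow> real^4 \<Rightarrow> real^4 \<Rightarrow> bool" where
  "same_sign i p q \<longleftrightarrow> (i = 1 \<longrightarrow> sgn (Y p) = sgn (Y q) \<and> sgn (Z p) = sgn (Z q)) \<and>
     (i = 2 \<longrightarrow> sgn (Z p) = sgn (Z q)) \<and> (i = 3 \<longrightarrow> sgn (X p) = sgn (X q))"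

text \<open>The common level set of the invariants, an upper bound for the leaf through
  \<open>p\<close>.\<close>

definition leafset :: "3 \<Rightarrow> real^4 \<Rightarrow> (real^4) set" where
  "leafset i p = {q \<in> foliation_domain M N i. (\<forall>j. j \<noteq> i \<longrightarrow> mu q $ j = mu p $ j) \<and> same_sign i p q}"

lemma squares:
  assumes "p \<in> M"
  shows "(X p)^2 * ((B - C) * (B - D)) = (mu p $ 1 - B) * (B - mu p $ 2) * (B - mu p $ 3)"
    "(Y p)^2 * ((B - C) * (C - D)) = (mu p $ 1 - C) * (mu p $ 2 - C) * (C - mu p $ 3)"
    "(Z p)^2 * ((B - D) * (C - D)) = (mu p $ 1 - D) * (mu p $ 2 - D) * (mu p $ 3 - D)"
  using ell_mu[OF assms] unfolding ell_def by auto

lemma mu_ranges: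
  assumes "p \<in> M"
  shows "D \<le> mu p $ 3" "mu p $ 3 \<le> C" "C \<le> mu p $ 2" "mu p $ 2 \<le> B" "B \<le> mu p $ 1"
  using ell_ranges[OF ell_mu[OF assms]] by auto

lemma XYZ_zero_iff:
  assumes "p \<in> M"
  shows "X p = 0 \<longleftrightarrow> mu p $ 1 = B \<or> mu p $ 2 = B"
    "Y p = 0 \<longleftrightarrow> mu p $ 2 = C \<or> mu p $ 3 = C"
    "Z p = 0 \<longleftrightarrow> mu p $ 3 = D"
proof -
  have "X p = 0 \<longleftrightarrow> (X p)^2 * ((B - C) * (B - D)) = 0" "Y p = 0 \<longleftrightarrow> (Y p)^2 * ((B - C) * (C - D)) = 0"
    "Z p = 0 \<longleftrightarrow> (Z p)^2 * ((B - D) * (C - D)) = 0"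
    using pos by simp_all
  moreover have "B - mu p $ 3 \<noteq> 0" "mu p $ 1 - C \<noteq> 0" "mu p $ 1 - D \<noteq> 0" "mu p $ 2 - D \<noteq> 0"
    using mu_ranges[OF assms] pos by linarith+
  ultimately show "X p = 0 \<longleftrightarrow> mu p $ 1 = B \<or> mu p $ 2 = B" "Y p = 0 \<longleftrightarrow> mu p $ 2 = C \<or> mu p $ 3 = C"
    "Z p = 0 \<longleftrightarrow> mu p $ 3 = D"
    unfolding squares[OF assms] mult_eq_0_iff by argo+
qed

text \<open>The constant roots decide whether such a coordinate is zero, so along a line it vanishes
  identically or nowhere, and in the latter case keeps its sign.\<close>

lemma principal_line_subset_leafset:
  assumes l: "principal_line M N i I g" and s: "s0 \<in> I"
  shows "g ` I \<subseteq> leafset i (g s0)"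
proof
  fix q assume "q \<in> g ` I"
  then obtain s1 where s1: "s1 \<in> I" "q = g s1" by blast
  have I: "is_interval I" and g: "continuous_on I g"
    using l unfolding principal_line_def by (auto intro: smooth_on_continuous)
  have dom: "g s \<in> foliation_domain M N i" and gM: "g s \<in> M" if "s \<in> I" for s
    using l that unfolding principal_line_def by (auto simp: foliation_domain_M)
  define r where "r = mu (g s0)"
  have c: "mu (g t) $ j = r $ j" if "t \<in> I" "j \<noteq> i" for t j
    using principal_line_constant[OF l that(1) s that(2)] by (simp add: r_def)
  have sgnc: "sgn (w (g s0)) = sgn (w (g s1))"
    if w: "continuous_on I (\<lambda>s. w (g s))" "\<And>s. s \<in> I \<Longrightarrow> w (g s) = 0 \<longleftrightarrow> w (g s0) = 0" for w :: "real^4 \<Rightarrow> real"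
  proof (cases "w (g s0) = 0")
    case True
    then show ?thesis using w(2)[OF s1(1)] by simp
  next
    case False
    then show ?thesis using sgn_constant[OF I w(1) s s1(1)] w(2) by blast
  qed
  have sgnq: "same_sign i (g s0) q"
    unfolding same_sign_def s1(2)
  proof (intro conjI impI)
    assume i: "i = 1"
    show "sgn (Y (g s0)) = sgn (Y (g s1))"
      by (rule sgnc) (use c i XYZ_zero_iff gM s in \<open>auto intro: continuous_intros g\<close>)
    show "sgn (Z (g s0)) = sgn (Z (g s1))"
      by (rule sgnc) (use c i XYZ_zero_iff gM s in \<open>auto intro: continuous_intros g\<close>)
  next
    assume i: "i = 2"
    show "sgn (Z (g s0)) = sgn (Z (g s1))"
      by (rule sgnc) (use c i XYZ_zero_iff gM s in \<open>auto intro: continuous_intros g\<close>)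
  next
    assume i: "i = 3"
    show "sgn (X (g s0)) = sgn (X (g s1))"
      by (rule sgnc) (use c i XYZ_zero_iff gM s in \<open>auto intro: continuous_intros g\<close>)
  qed
  show "q \<in> leafset i (g s0)"
    unfolding leafset_def using dom[OF s1(1)] c[OF s1(1)] s1(2) sgnq by (simp add: r_def)
qed

lemma leaf_subset_leafset: "leaf M N i p \<subseteq> leafset i p"
  unfolding leaf_def using principal_line_subset_leafset by blast

text \<open>This takes the place of uniqueness of integral curves, by a circle of inclusions: the
  leaf lies in \<open>leafset\<close>, that set in the line, and the line in the leaf.\<close>

lemma leaf_eqI:
  assumes l: "principal_line M N i I g" and p: "p \<in> foliation_domain M N i"
    and sub: "leafset i p \<subseteq> g ` I"
  shows "leaf M N i p = g ` I"
proof -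
  have "p \<in> leafset i p" using p by (simp add: leafset_def same_sign_def)
  then have "p \<in> g ` I" using sub by blast
  then have "g ` I \<subseteq> leaf M N i p" unfolding leaf_def using l by (intro Union_upper) auto
  then show ?thesis using sub leaf_subset_leafset by blast
qed

section \<open>Explicit parametrizations of leaves\<close>

lemma domM: "p \<in> foliation_domain M N i \<Longrightarrow> p \<in> M"
  by (simp add: foliation_domain_M)

lemma leafsetD:
  assumes "q \<in> leafset i p"
  shows "q \<in> M" "\<And>j. j \<noteq> i \<Longrightarrow> mu q $ j = mu p $ j" "\<And>j. j \<noteq> i \<Longrightarrow> mu q $ j \<noteq> mu q $ i" "same_sign i p q"
  using assms unfolding leafset_def foliation_domain_M by auto

lemma mult_sqrt_sq: "0 < x \<Longrightarrow> (k * sqrt x)^2 = k^2 * x"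
  by (simp add: power_mult_distrib)

text \<open>The parameter is a signed square root of \<open>m$1 - B\<close>. Both signs occur
  because the leaf crosses the plane X = 0 where \<open>m$1 = B\<close>, and X becomes linear in
  it.\<close>

lemma leaf1_generic:
  assumes p: "p \<in> foliation_domain M N 1" and r: "mu p $ 2 < B"
  shows "diffeomorphic (leaf M N 1 p) (UNIV :: real set)"
proof -
  note pM = domM[OF p]
  note R = mu_ranges[OF pM] pos
  \<comment> \<open>\<open>Xc\<close>, \<open>ey\<close> and \<open>ez\<close> are X, Y and Z with
    the dependence on the moving root divided out, hence constant along the leaf; \<open>ey\<close>
    and \<open>ez\<close> carry the signs of Y and Z.\<close>
  define Xc where "Xc = sqrt ((B - mu p $ 2) * (B - mu p $ 3) / ((B - C) * (B - D)))"
  define ey where "ey = Y p / sqrt (mu p $ 1 - C)"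
  define ez where "ez = Z p / sqrt (mu p $ 1 - D)"
  have Xc: "Xc > 0" using r R by (simp add: Xc_def)
  have Xc2: "Xc^2 * ((B - C) * (B - D)) = (B - mu p $ 2) * (B - mu p $ 3)"
    using r R by (simp add: Xc_def)
  have ey2: "ey^2 * ((B - C) * (C - D)) = (mu p $ 2 - C) * (C - mu p $ 3)"
    using squares(2)[OF pM] R by (simp add: ey_def power_divide field_simps)
  have ez2: "ez^2 * ((B - D) * (C - D)) = (mu p $ 2 - D) * (mu p $ 3 - D)"
    using squares(3)[OF pM] R by (simp add: ez_def power_divide field_simps)
  have sg: "sgn ey = sgn (Y p)" "sgn ez = sgn (Z p)" using R by (auto simp: ey_def ez_def sgn_divide)
  define m where "m t = (vector [B + t^2, mu p $ 2, mu p $ 3] :: real^3)" for t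
  define g where "g t = Phi (Xc * t) (ey * sqrt (t^2 + (B - C))) (ez * sqrt (t^2 + (B - D)))" for t
  have rt: "t^2 + (B - C) > 0" "t^2 + (B - D) > 0" for t using pos by (simp_all add: add_nonneg_pos)
  have l: "principal_line M N 1 UNIV g"
    unfolding g_def
  proof (rule principal_lineI[where m = m])
    fix s :: real
    show "ell (Xc * s) (ey * sqrt (s^2 + (B - C))) (ez * sqrt (s^2 + (B - D))) (m s)"
      using R Xc2 ey2 ez2 rt[of s, THEN less_imp_le] unfolding ell_def m_def
      by (simp add: power_mult_distrib) algebra
    show "\<exists>w\<in>{\<lambda>t. Xc * t, \<lambda>t. ey * sqrt (t^2 + (B - C)), \<lambda>t. ez * sqrt (t^2 + (B - D)), \<lambda>s. m s $ 1}.
        \<exists>D. D \<noteq> 0 \<and> (w has_real_derivative D) (at s)"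
      using Xc by (intro bexI[of _ "\<lambda>t. Xc * t"] exI[of _ Xc]) (auto intro!: derivative_eq_intros)
    have "mu p $ 2 < B + s^2" "mu p $ 3 < B + s^2" using R r zero_le_power2[of s] by linarith+
    then show "j \<noteq> 1 \<Longrightarrow> m s $ j \<noteq> m s $ 1" for j
      using exhaust_3[of j] by (auto simp: m_def)
    show "j \<noteq> 1 \<Longrightarrow> m s $ j = m t $ j" for t j using exhaust_3[of j] by (auto simp: m_def)
  qed (auto intro!: smooth_intros simp: rt)
  have "leafset 1 p \<subseteq> range g"
  proof
    fix q assume q: "q \<in> leafset 1 p"
    note qM = leafsetD(1)[OF q]
    have mu: "mu q $ 2 = mu p $ 2" "mu q $ 3 = mu p $ 3" using leafsetD(2)[OF q] by auto
    define t where "t = X q / Xc"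
    have "t^2 * ((B - mu p $ 2) * (B - mu p $ 3)) = (mu q $ 1 - B) * ((B - mu p $ 2) * (B - mu p $ 3))"
    proof -
      have "X q = Xc * t" using Xc by (simp add: t_def)
      then show ?thesis using squares(1)[OF qM, unfolded mu] Xc2 by algebra
    qed
    then have t2: "t^2 = mu q $ 1 - B" using r R by auto
    have "(Y q)^2 * ((B - C) * (C - D)) = (ey * sqrt (t^2 + (B - C)))^2 * ((B - C) * (C - D))"
      unfolding mult_sqrt_sq[OF rt(1)] using squares(2)[OF qM, unfolded mu] ey2 t2 by algebra
    then have "(Y q)^2 = (ey * sqrt (t^2 + (B - C)))^2" using pos by simp
    then have "Y q = ey * sqrt (t^2 + (B - C))"
      by (rule eq_if_square_sgn_eq) (use leafsetD(4)[OF q] sg rt[of t] in \<open>simp add: same_sign_def sgn_mult\<close>)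
    moreover have "(Z q)^2 * ((B - D) * (C - D)) = (ez * sqrt (t^2 + (B - D)))^2 * ((B - D) * (C - D))"
      unfolding mult_sqrt_sq[OF rt(2)] using squares(3)[OF qM, unfolded mu] ez2 t2 by algebra
    then have "(Z q)^2 = (ez * sqrt (t^2 + (B - D)))^2" using pos by simp
    then have "Z q = ez * sqrt (t^2 + (B - D))"
      by (rule eq_if_square_sgn_eq) (use leafsetD(4)[OF q] sg rt[of t] in \<open>simp add: same_sign_def sgn_mult\<close>)
    ultimately have "q = g t" using Xc by (intro M_eqI qM) (auto simp: g_def t_def)
    then show "q \<in> range g" by blast
  qed
  then have lf: "leaf M N 1 p = range g" by (rule leaf_eqI[OF l p])
  show ?thesis
    unfolding lf
  proof (rule diffeomorphicI)
    show "smooth_map_on (range g) (\<lambda>q. X q / Xc)"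
      by (rule smooth_map_onI[of UNIV]) (use Xc in \<open>auto intro!: smooth_intros\<close>)
    show "smooth_map_on UNIV g"
      by (rule smooth_map_onI[of UNIV]) (use l in \<open>auto simp: principal_line_def\<close>)
  qed (use Xc in \<open>auto simp: g_def\<close>)
qed

text \<open>Here the leaf stays in the plane X = 0 and \<open>m$1\<close> runs over the open
  half-line above B, whose end is the excluded curve \<open>m$1 = m$2\<close>.\<close>

lemma leaf1_singular:
  assumes p: "p \<in> foliation_domain M N 1" and r: "mu p $ 2 = B"
  shows "diffeomorphic (leaf M N 1 p) (UNIV :: real set)"
proof -
  note pM = domM[OF p]
  note R = mu_ranges[OF pM] pos
  define ey where "ey = Y p / sqrt (mu p $ 1 - C)"
  define ez where "ez = Z p / sqrt (mu p $ 1 - D)"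
  have ey2: "ey^2 * (C - D) = C - mu p $ 3"
  proof -
    have "ey^2 * (mu p $ 1 - C) = (Y p)^2" using R by (simp add: ey_def power_divide)
    then have "(ey^2 * (C - D)) * ((mu p $ 1 - C) * (B - C)) = (C - mu p $ 3) * ((mu p $ 1 - C) * (B - C))"
      using squares(2)[OF pM, unfolded r] by algebra
    then show ?thesis using R by simp
  qed
  have ez2: "ez^2 * (C - D) = mu p $ 3 - D"
  proof -
    have "ez^2 * (mu p $ 1 - D) = (Z p)^2" using R by (simp add: ez_def power_divide)
    then have "(ez^2 * (C - D)) * ((mu p $ 1 - D) * (B - D)) = (mu p $ 3 - D) * ((mu p $ 1 - D) * (B - D))"
      using squares(3)[OF pM, unfolded r] by algebra
    then show ?thesis using R by simp
  qed
  have sg: "sgn ey = sgn (Y p)" "sgn ez = sgn (Z p)" using R by (auto simp: ey_def ez_def sgn_divide)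
  define m where "m t = (vector [B + t, B, mu p $ 3] :: real^3)" for t
  define g where "g t = Phi 0 (ey * sqrt (t + (B - C))) (ez * sqrt (t + (B - D)))" for t
  have rt: "t + (B - C) > 0" "t + (B - D) > 0" if "t > 0" for t using pos that by simp_all
  have l: "principal_line M N 1 {0<..} g"
    unfolding g_def
  proof (rule principal_lineI[where m = m])
    fix s :: real assume s: "s \<in> {0<..}"
    then have s0: "s > 0" by simp
    show "ell 0 (ey * sqrt (s + (B - C))) (ez * sqrt (s + (B - D))) (m s)"
      unfolding ell_def m_def mult_sqrt_sq[OF rt(1)[OF s0]] mult_sqrt_sq[OF rt(2)[OF s0]]
      using R ey2 ez2 s0 by simp algebra
    \<comment> \<open>Y or Z may vanish identically, so the root itself detects the
      velocity.\<close>
    show "\<exists>w\<in>{\<lambda>t. 0, \<lambda>t. ey * sqrt (t + (B - C)), \<lambda>t. ez * sqrt (t + (B - D)), \<lambda>s. m s $ 1}.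
        \<exists>D. D \<noteq> 0 \<and> (w has_real_derivative D) (at s)"
      by (intro bexI[of _ "\<lambda>s. m s $ 1"] exI[of _ 1]) (auto intro!: derivative_eq_intros simp: m_def)
    have "B < B + s" "mu p $ 3 < B + s" using R s0 by linarith+
    then show "j \<noteq> 1 \<Longrightarrow> m s $ j \<noteq> m s $ 1" for j
      using exhaust_3[of j] by (auto simp: m_def)
    show "j \<noteq> 1 \<Longrightarrow> m s $ j = m t $ j" for t j using exhaust_3[of j] by (auto simp: m_def)
  qed (auto intro!: smooth_intros simp: rt)
  have tp: "mu q $ 1 - B > 0" if "q \<in> leafset 1 p" for q
    using leafsetD[OF that] mu_ranges(5)[of q] r by force
  have eq: "q = g (mu q $ 1 - B)" if q: "q \<in> leafset 1 p" for q
  proof -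
    note qM = leafsetD(1)[OF q]
    have mu: "mu q $ 2 = B" "mu q $ 3 = mu p $ 3" using leafsetD(2)[OF q] r by auto
    define t where "t = mu q $ 1 - B"
    have t: "t > 0" using tp[OF q] by (simp add: t_def)
    have "X q = 0" using XYZ_zero_iff(1)[OF qM] mu by simp
    moreover have "(Y q)^2 * ((B - C) * (C - D)) = (ey * sqrt (t + (B - C)))^2 * ((B - C) * (C - D))"
      unfolding mult_sqrt_sq[OF rt(1)[OF t]] using squares(2)[OF qM, unfolded mu] ey2 t_def by algebra
    then have "(Y q)^2 = (ey * sqrt (t + (B - C)))^2" using pos by simp
    then have "Y q = ey * sqrt (t + (B - C))"
      by (rule eq_if_square_sgn_eq) (use leafsetD(4)[OF q] sg rt[OF t] in \<open>simp add: same_sign_def sgn_mult\<close>)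
    moreover have "(Z q)^2 * ((B - D) * (C - D)) = (ez * sqrt (t + (B - D)))^2 * ((B - D) * (C - D))"
      unfolding mult_sqrt_sq[OF rt(2)[OF t]] using squares(3)[OF qM, unfolded mu] ez2 t_def by algebra
    then have "(Z q)^2 = (ez * sqrt (t + (B - D)))^2" using pos by simp
    then have "Z q = ez * sqrt (t + (B - D))"
      by (rule eq_if_square_sgn_eq) (use leafsetD(4)[OF q] sg rt[OF t] in \<open>simp add: same_sign_def sgn_mult\<close>)
    ultimately have "q = g t" by (intro M_eqI qM) (auto simp: g_def)
    then show ?thesis by (simp add: t_def)
  qed
  have sub: "leafset 1 p \<subseteq> g ` {0<..}"
    using eq tp by (metis greaterThan_iff image_eqI subsetI)
  have lf: "leaf M N 1 p = g ` {0<..}" by (rule leaf_eqI[OF l p sub])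
  \<comment> \<open>Since \<open>ey^2 + ez^2 = 1\<close>, the sum of the squares of Y and Z equals
    the parameter up to a constant. This inverse is smooth also when \<open>ey\<close> or
    \<open>ez\<close> is zero.\<close>
  have inv: "(Y q)^2 + (Z q)^2 - (ey^2 * (B - C) + ez^2 * (B - D)) = t"
    if q: "q = g t" and t: "t > 0" for q t
  proof -
    have "ey^2 + ez^2 = 1"
    proof -
      have "(ey^2 + ez^2) * (C - D) = 1 * (C - D)" using ey2 ez2 by algebra
      then show ?thesis using pos by simp
    qed
    moreover have "(Y q)^2 = ey^2 * (t + (B - C))" "(Z q)^2 = ez^2 * (t + (B - D))"
      using q rt[OF t] by (simp_all add: g_def power_mult_distrib)
    ultimately show ?thesis by algebra
  qed
  define f where "f q = (Y q)^2 + (Z q)^2 - (ey^2 * (B - C) + ez^2 * (B - D))" for q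
  have fg: "f (g t) = t" if "t > 0" for t using inv[OF refl that] by (simp add: f_def)
  have "diffeomorphic (g ` {0<..}) {0::real<..}"
  proof (rule diffeomorphicI)
    show "smooth_map_on (g ` {0<..}) f"
      unfolding f_def by (rule smooth_map_onI[of UNIV]) (auto intro!: smooth_intros)
    show "smooth_map_on {0<..} g"
      by (rule smooth_map_onI[of "{0<..}"]) (use l in \<open>auto simp: principal_line_def\<close>)
  qed (auto simp: fg)
  then show ?thesis unfolding lf using diffeomorphic_greaterThan_UNIV diffeomorphic_trans by blast
qed

lemma leaf1: "p \<in> foliation_domain M N 1 \<Longrightarrow> diffeomorphic (leaf M N 1 p) (UNIV :: real set)"
  using leaf1_generic leaf1_singular mu_ranges(4)[OF domM] by (meson order_le_less)

lemma square_cancel: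
  fixes x y k :: real
  assumes "x^2 * k = y^2 * k" "k > 0" "sgn x = sgn y"
  shows "x = y"
proof (rule eq_if_square_sgn_eq)
  show "x^2 = y^2" using assms(1,2) mult_right_cancel[of k "x^2" "y^2"] less_imp_neq[OF assms(2)] by metis
qed fact

text \<open>While \<open>m$2\<close> oscillates between C and B, the pair (X / Xc, Y / Yc) runs
  around the unit circle and Z is a smooth function of it. The hypotheses on roots 1 and 3 make both
  scales positive.\<close>

lemma leaf2_generic:
  assumes p: "p \<in> foliation_domain M N 2" and r: "B < mu p $ 1" "mu p $ 3 < C"
  shows "closed_leaf (leaf M N 2 p)"
proof -
  note pM = domM[OF p]
  note R = mu_ranges[OF pM] pos
  define Xc where "Xc = sqrt ((mu p $ 1 - B) * (B - mu p $ 3) / (B - D))"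
  define Yc where "Yc = sqrt ((mu p $ 1 - C) * (C - mu p $ 3) / (C - D))"
  define ez where "ez = Z p / sqrt (mu p $ 2 - D)"
  have Xc: "Xc > 0" and Yc: "Yc > 0" using r R by (simp_all add: Xc_def Yc_def)
  have Xc2: "Xc^2 * (B - D) = (mu p $ 1 - B) * (B - mu p $ 3)"
    and Yc2: "Yc^2 * (C - D) = (mu p $ 1 - C) * (C - mu p $ 3)"
    using r R by (simp_all add: Xc_def Yc_def)
  have ez2: "ez^2 * ((B - D) * (C - D)) = (mu p $ 1 - D) * (mu p $ 3 - D)"
    using squares(3)[OF pM] R by (simp add: ez_def power_divide field_simps)
  have sg: "sgn ez = sgn (Z p)" using R by (auto simp: ez_def sgn_divide)
  define m where "m t = (vector [mu p $ 1, C + (B - C) * (cos t)^2, mu p $ 3] :: real^3)" for t :: real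
  \<comment> \<open>Defined on the whole plane, so that it is an ambient smooth extension of the map
    on the circle.\<close>
  define g where "g u = Phi (Xc * u$1) (Yc * u$2) (ez * sqrt ((C - D) + (B - C) * (u$2)^2))" for u :: "real^2"
  have rt: "(C - D) + (B - C) * t^2 > 0" for t using pos by (simp add: add_pos_nonneg)
  define k where "k t = (vector [sin t, cos t] :: real^2)" for t :: real
  have l: "principal_line M N 2 UNIV (\<lambda>t. g (k t))"
    unfolding g_def k_def vector_2
  proof (rule principal_lineI[where m = m])
    fix s :: real
    have c2: "0 \<le> (B - C) * (cos s)^2" "(B - C) * (cos s)^2 \<le> B - C"
      using pos mult_left_mono[of "(cos s)^2" 1 "B - C"] by (auto simp: abs_square_le_1)
    show "ell (Xc * sin s) (Yc * cos s) (ez * sqrt ((C - D) + (B - C) * (cos s)^2)) (m s)"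
      unfolding ell_def m_def mult_sqrt_sq[OF rt] vector_3
    proof (intro conjI)
      show "(Xc * sin s)\<^sup>2 * ((B - C) * (B - D)) =
        (mu p $ 1 - B) * (B - (C + (B - C) * (cos s)\<^sup>2)) * (B - mu p $ 3)"
        using Xc2 sin_cos_squared_add[of s] by algebra
      show "(Yc * cos s)\<^sup>2 * ((B - C) * (C - D)) =
        (mu p $ 1 - C) * (C + (B - C) * (cos s)\<^sup>2 - C) * (C - mu p $ 3)"
        using Yc2 by algebra
      show "ez\<^sup>2 * (C - D + (B - C) * (cos s)\<^sup>2) * ((B - D) * (C - D)) =
        (mu p $ 1 - D) * (C + (B - C) * (cos s)\<^sup>2 - D) * (mu p $ 3 - D)"
        using ez2 by algebra
    qed (use R c2 in linarith)+
    have "cos s \<noteq> 0 \<or> sin s \<noteq> 0"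
      using sin_cos_squared_add[of s] by (metis add_0 power_zero_numeral zero_neq_one)
    then show "\<exists>w\<in>{\<lambda>t. Xc * sin t, \<lambda>t. Yc * cos t, \<lambda>t. ez * sqrt ((C - D) + (B - C) * (cos t)^2), \<lambda>s. m s $ 2}.
        \<exists>D. D \<noteq> 0 \<and> (w has_real_derivative D) (at s)"
    proof
      assume "cos s \<noteq> 0"
      then show ?thesis using Xc
        by (intro bexI[of _ "\<lambda>t. Xc * sin t"] exI[of _ "Xc * cos s"]) (auto intro!: derivative_eq_intros)
    next
      assume "sin s \<noteq> 0"
      then show ?thesis using Yc
        by (intro bexI[of _ "\<lambda>t. Yc * cos t"] exI[of _ "- Yc * sin s"]) (auto intro!: derivative_eq_intros)
    qed
    have "C + (B - C) * (cos s)^2 < mu p $ 1" "mu p $ 3 < C + (B - C) * (cos s)^2" using R r c2 by linarith+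
    then show "j \<noteq> 2 \<Longrightarrow> m s $ j \<noteq> m s $ 2" for j
      using exhaust_3[of j] by (auto simp: m_def)
    show "j \<noteq> 2 \<Longrightarrow> m s $ j = m t $ j" for t j using exhaust_3[of j] by (auto simp: m_def)
  qed (auto intro!: smooth_intros simp: rt)
  have circ: "u \<in> range k" if "(u$1)^2 + (u$2)^2 = 1" for u :: "real^2"
  proof -
    have "(u$2)^2 + (u$1)^2 = 1" using that by simp
    then obtain t where "u$1 = sin t" "u$2 = cos t" using sincos_total_2pi by blast
    then have "u = k t" by (simp add: k_def vec_eq_iff forall_2)
    then show ?thesis by blast
  qed
  have ksph: "k t \<in> sphere 0 1" for t
    by (simp add: k_def norm_vec_def L2_set_def sum_2)
  have sph: "(u$1)^2 + (u$2)^2 = 1" if "u \<in> sphere 0 1" for u :: "real^2"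
    using that by (simp add: norm_vec_def L2_set_def sum_2)
  have "leafset 2 p \<subseteq> range (\<lambda>t. g (k t))"
  proof
    fix q assume q: "q \<in> leafset 2 p"
    note qM = leafsetD(1)[OF q]
    have mu: "mu q $ 1 = mu p $ 1" "mu q $ 3 = mu p $ 3" using leafsetD(2)[OF q] by auto
    define u where "u = (vector [X q / Xc, Y q / Yc] :: real^2)"
    have u: "X q = Xc * u$1" "Y q = Yc * u$2" using Xc Yc by (auto simp: u_def)
    have "(u$1)^2 * (B - C) * ((mu p $ 1 - B) * (B - mu p $ 3)) = (B - mu q $ 2) * ((mu p $ 1 - B) * (B - mu p $ 3))"
      using squares(1)[OF qM, unfolded mu] Xc2 u(1) by algebra
    then have u1: "(u$1)^2 * (B - C) = B - mu q $ 2" using r R by simp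
    have "(u$2)^2 * (B - C) * ((mu p $ 1 - C) * (C - mu p $ 3)) = (mu q $ 2 - C) * ((mu p $ 1 - C) * (C - mu p $ 3))"
      using squares(2)[OF qM, unfolded mu] Yc2 u(2) by algebra
    then have u2: "(u$2)^2 * (B - C) = mu q $ 2 - C" using r R by simp
    have "((u$1)^2 + (u$2)^2) * (B - C) = 1 * (B - C)" using u1 u2 by algebra
    then have "(u$1)^2 + (u$2)^2 = 1" using pos by simp
    then obtain t where t: "u = k t" using circ by blast
    have "(Z q)^2 * ((B - D) * (C - D)) = (ez * sqrt ((C - D) + (B - C) * (u$2)^2))^2 * ((B - D) * (C - D))"
      unfolding mult_sqrt_sq[OF rt] using squares(3)[OF qM, unfolded mu] ez2 u2 by algebra
    then have "Z q = ez * sqrt ((C - D) + (B - C) * (u$2)^2)"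
      by (rule square_cancel) (use leafsetD(4)[OF q] sg rt pos in \<open>simp_all add: same_sign_def sgn_mult\<close>)
    then have "q = g u" using u by (intro M_eqI qM) (auto simp: g_def)
    then show "q \<in> range (\<lambda>t. g (k t))" using t by blast
  qed
  then have lf: "leaf M N 2 p = range (\<lambda>t. g (k t))" by (rule leaf_eqI[OF l p])
  show ?thesis
    unfolding closed_leaf_def lf
  proof (rule diffeomorphicI)
    show "smooth_map_on (range (\<lambda>t. g (k t))) (\<lambda>q. vector [X q / Xc, Y q / Yc] :: real^2)"
      by (rule smooth_map_onI[of UNIV]) (use Xc Yc in \<open>auto intro!: smooth_intros\<close>)
    show "smooth_map_on (sphere 0 1) g"
      unfolding g_def by (rule smooth_map_onI[of UNIV]) (auto intro!: smooth_intros simp: rt)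
    have inv: "vector [X (g u) / Xc, Y (g u) / Yc] = u" for u :: "real^2"
      using Xc Yc by (simp add: g_def vec_eq_iff forall_2)
    then show "y \<in> sphere 0 1 \<Longrightarrow> vector [X (g y) / Xc, Y (g y) / Yc] = y" for y :: "real^2" by blast
    show "q \<in> range (\<lambda>t. g (k t)) \<Longrightarrow> (vector [X q / Xc, Y q / Yc] :: real^2) \<in> sphere 0 1" for q
      using inv ksph by auto
    show "q \<in> range (\<lambda>t. g (k t)) \<Longrightarrow> g (vector [X q / Xc, Y q / Yc]) = q" for q
      using inv by auto
    show "u \<in> sphere 0 1 \<Longrightarrow> g u \<in> range (\<lambda>t. g (k t))" for u
      using circ[OF sph] by blast
  qed
qed

text \<open>Now Y and Z run around an ellipse while \<open>m$3\<close> oscillates between D and C.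
  Compactness follows since one period already covers \<open>leafset\<close>.\<close>

lemma leaf3_generic:
  assumes p: "p \<in> foliation_domain M N 3" and r: "C < mu p $ 2"
  shows "compact (leaf M N 3 p)"
proof -
  note pM = domM[OF p]
  note R = mu_ranges[OF pM] pos
  define Yc where "Yc = sqrt ((mu p $ 1 - C) * (mu p $ 2 - C) / (B - C))"
  define Zc where "Zc = sqrt ((mu p $ 1 - D) * (mu p $ 2 - D) / (B - D))"
  define ex where "ex = X p / sqrt (B - mu p $ 3)"
  have Yc: "Yc > 0" and Zc: "Zc > 0" using r R by (simp_all add: Yc_def Zc_def)
  have Yc2: "Yc^2 * (B - C) = (mu p $ 1 - C) * (mu p $ 2 - C)"
    and Zc2: "Zc^2 * (B - D) = (mu p $ 1 - D) * (mu p $ 2 - D)"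
    using r R by (simp_all add: Yc_def Zc_def)
  have ex2: "ex^2 * ((B - C) * (B - D)) = (mu p $ 1 - B) * (B - mu p $ 2)"
    using squares(1)[OF pM] R by (simp add: ex_def power_divide field_simps)
  have sg: "sgn ex = sgn (X p)" using R by (auto simp: ex_def sgn_divide)
  define m where "m t = (vector [mu p $ 1, mu p $ 2, D + (C - D) * (cos t)^2] :: real^3)" for t :: real
  define g where "g t = Phi (ex * sqrt ((B - C) + (C - D) * (sin t)^2)) (Yc * sin t) (Zc * cos t)" for t
  have rt: "(B - C) + (C - D) * t^2 > 0" for t using pos by (simp add: add_pos_nonneg)
  have sm: "smooth_on UNIV (\<lambda>t. ex * sqrt ((B - C) + (C - D) * (sin t)^2))"
    by (auto intro!: smooth_intros simp: rt)
  have l: "principal_line M N 3 UNIV g"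
    unfolding g_def
  proof (rule principal_lineI[where m = m])
    fix s :: real
    have c2: "0 \<le> (C - D) * (cos s)^2" "(C - D) * (cos s)^2 \<le> C - D"
      using pos mult_left_mono[of "(cos s)^2" 1 "C - D"] by (auto simp: abs_square_le_1)
    show "ell (ex * sqrt ((B - C) + (C - D) * (sin s)^2)) (Yc * sin s) (Zc * cos s) (m s)"
      unfolding ell_def m_def mult_sqrt_sq[OF rt] vector_3
    proof (intro conjI)
      show "ex\<^sup>2 * (B - C + (C - D) * (sin s)\<^sup>2) * ((B - C) * (B - D)) =
        (mu p $ 1 - B) * (B - mu p $ 2) * (B - (D + (C - D) * (cos s)\<^sup>2))"
        using ex2 sin_cos_squared_add[of s] by algebra
      show "(Yc * sin s)\<^sup>2 * ((B - C) * (C - D)) =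
        (mu p $ 1 - C) * (mu p $ 2 - C) * (C - (D + (C - D) * (cos s)\<^sup>2))"
        using Yc2 sin_cos_squared_add[of s] by algebra
      show "(Zc * cos s)\<^sup>2 * ((B - D) * (C - D)) =
        (mu p $ 1 - D) * (mu p $ 2 - D) * (D + (C - D) * (cos s)\<^sup>2 - D)"
        using Zc2 by algebra
    qed (use R c2 in linarith)+
    have "cos s \<noteq> 0 \<or> sin s \<noteq> 0"
      using sin_cos_squared_add[of s] by (metis add_0 power_zero_numeral zero_neq_one)
    then show "\<exists>w\<in>{\<lambda>t. ex * sqrt ((B - C) + (C - D) * (sin t)^2), \<lambda>t. Yc * sin t, \<lambda>t. Zc * cos t, \<lambda>s. m s $ 3}.
        \<exists>D. D \<noteq> 0 \<and> (w has_real_derivative D) (at s)"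
    proof
      assume "cos s \<noteq> 0"
      then show ?thesis using Yc
        by (intro bexI[of _ "\<lambda>t. Yc * sin t"] exI[of _ "Yc * cos s"]) (auto intro!: derivative_eq_intros)
    next
      assume "sin s \<noteq> 0"
      then show ?thesis using Zc
        by (intro bexI[of _ "\<lambda>t. Zc * cos t"] exI[of _ "- Zc * sin s"]) (auto intro!: derivative_eq_intros)
    qed
    have "D + (C - D) * (cos s)^2 < mu p $ 1" "D + (C - D) * (cos s)^2 < mu p $ 2" using R r c2 by linarith+
    then show "j \<noteq> 3 \<Longrightarrow> m s $ j \<noteq> m s $ 3" for j
      using exhaust_3[of j] by (auto simp: m_def)
    show "j \<noteq> 3 \<Longrightarrow> m s $ j = m t $ j" for t j using exhaust_3[of j] by (auto simp: m_def)
  qed (auto intro!: smooth_intros sm)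
  have sub: "leafset 3 p \<subseteq> g ` {0..2*pi}"
  proof
    fix q assume q: "q \<in> leafset 3 p"
    note qM = leafsetD(1)[OF q]
    have mu: "mu q $ 1 = mu p $ 1" "mu q $ 2 = mu p $ 2" using leafsetD(2)[OF q] by auto
    define v w where "v = Y q / Yc" and "w = Z q / Zc"
    have u: "Y q = Yc * v" "Z q = Zc * w" using Yc Zc by (auto simp: v_def w_def)
    have "v^2 * (C - D) * ((mu p $ 1 - C) * (mu p $ 2 - C)) = (C - mu q $ 3) * ((mu p $ 1 - C) * (mu p $ 2 - C))"
      using squares(2)[OF qM, unfolded mu] Yc2 u(1) by algebra
    then have u1: "v^2 * (C - D) = C - mu q $ 3" using r R by simp
    have "w^2 * (C - D) * ((mu p $ 1 - D) * (mu p $ 2 - D)) = (mu q $ 3 - D) * ((mu p $ 1 - D) * (mu p $ 2 - D))"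
      using squares(3)[OF qM, unfolded mu] Zc2 u(2) by algebra
    then have u2: "w^2 * (C - D) = mu q $ 3 - D" using r R by simp
    have "(w^2 + v^2) * (C - D) = 1 * (C - D)" using u1 u2 by algebra
    then have "w^2 + v^2 = 1" using pos by simp
    then obtain t where t: "0 \<le> t" "t < 2 * pi" "w = cos t" "v = sin t" using sincos_total_2pi by blast
    have "(X q)^2 * ((B - C) * (B - D)) = (ex * sqrt ((B - C) + (C - D) * (sin t)^2))^2 * ((B - C) * (B - D))"
      unfolding mult_sqrt_sq[OF rt] using squares(1)[OF qM, unfolded mu] ex2 u1 t(4) by algebra
    then have "X q = ex * sqrt ((B - C) + (C - D) * (sin t)^2)"
      by (rule square_cancel) (use leafsetD(4)[OF q] sg rt pos in \<open>simp_all add: same_sign_def sgn_mult\<close>)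
    then have "q = g t" using u t by (intro M_eqI qM) (auto simp: g_def)
    then show "q \<in> g ` {0..2*pi}" using t by auto
  qed
  then have "leaf M N 3 p = range g" by (intro leaf_eqI[OF l p]) blast
  moreover have "range g \<subseteq> g ` {0..2*pi}"
    using leaf_subset_leafset sub calculation by blast
  ultimately have "leaf M N 3 p = g ` {0..2*pi}" by blast
  moreover have "continuous_on {0..2*pi} g"
    using l unfolding principal_line_def by (meson continuous_on_subset smooth_on_continuous subset_UNIV)
  ultimately show ?thesis by (simp add: compact_continuous_image)
qed

end

subsection \<open>Separatrix surfaces\<close>

context quadric
begin

text \<open>Common frame for leaves that end on partially umbilic curves: continuity on the closed
  interval supplies the limits, whereas smoothness and distinct roots are required only
  inside.\<close>

lemma arc_leaf:
  fixes x y z :: "real \<Rightarrow> real" and m :: "real \<Rightarrow> real^3"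
  assumes cont: "continuous_on {0..1} x" "continuous_on {0..1} y" "continuous_on {0..1} z"
    and sm: "smooth_on {0<..<1} x" "smooth_on {0<..<1} y" "smooth_on {0<..<1} z"
    and e: "\<And>s. s \<in> {0<..<1} \<Longrightarrow> ell (x s) (y s) (z s) (m s)"
    and c: "\<And>s t j. j \<noteq> i \<Longrightarrow> m s $ j = m t $ j"
    and n: "\<And>s j. s \<in> {0<..<1} \<Longrightarrow> j \<noteq> i \<Longrightarrow> m s $ j \<noteq> m s $ i"
    and d: "\<And>s. s \<in> {0<..<1} \<Longrightarrow> \<exists>w\<in>{x, y, z, \<lambda>s. m s $ i}. \<exists>D. D \<noteq> 0 \<and> (w has_real_derivative D) (at s)"
    and p: "p \<in> foliation_domain M N i"
    and surj: "\<And>q. q \<in> leafset i p \<Longrightarrow> \<exists>t\<in>{0<..<1}. X q = x t \<and> Y q = y t \<and> Z q = z t"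
  shows "p \<in> leaf M N i p"
    "limiting_endpoint M N i (leaf M N i p) (Phi (x 0) (y 0) (z 0))"
    "limiting_endpoint M N i (leaf M N i p) (Phi (x 1) (y 1) (z 1))"
proof -
  define g where "g s = Phi (x s) (y s) (z s)" for s
  have l: "principal_line M N i {0<..<1} g"
    unfolding g_def by (rule principal_lineI[OF _ _ sm e c n d]) auto
  have sub: "leafset i p \<subseteq> g ` {0<..<1}"
  proof
    fix q assume q: "q \<in> leafset i p"
    obtain t where t: "t \<in> {0<..<1}" "X q = x t" "Y q = y t" "Z q = z t" using surj[OF q] by blast
    then have "q = g t" by (intro M_eqI leafsetD(1)[OF q]) (auto simp: g_def)
    then show "q \<in> g ` {0<..<1}" using t by blast
  qed
  have lf: "leaf M N i p = g ` {0<..<1}" by (rule leaf_eqI[OF l p sub])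
  show "p \<in> leaf M N i p"
    unfolding lf using sub p by (auto simp: leafset_def same_sign_def)
  have "continuous_on {0..1} g" unfolding g_def by (intro continuous_intros cont)
  then have "(g \<longlongrightarrow> g 0) (at 0 within {0..1})" "(g \<longlongrightarrow> g 1) (at 1 within {0..1})"
    by (simp_all add: continuous_on_def)
  then have "(g \<longlongrightarrow> g 0) (at_right 0)" "(g \<longlongrightarrow> g 1) (at_left 1)"
    by (simp_all add: at_within_Icc_at_right at_within_Icc_at_left)
  then show "limiting_endpoint M N i (leaf M N i p) (Phi (x 0) (y 0) (z 0))"
    "limiting_endpoint M N i (leaf M N i p) (Phi (x 1) (y 1) (z 1))"
    unfolding limiting_endpoint_def lf using l by (auto simp: g_def)
qed

lemma linear_param:
  fixes u :: real
  assumes "u^2 < 1"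
  shows "(u + 1) / 2 \<in> {0<..<1}" "2 * ((u + 1) / 2) - 1 = u"
  using assms by (auto simp: abs_square_less_1 field_simps)

lemma square_param:
  assumes "s \<in> {0<..<1::real}"
  shows "(2 * s - 1)^2 < 1"
  using assms by (simp add: abs_square_less_1 abs_less_iff)

text \<open>In the plane Y = 0 with \<open>m$2 = C\<close>, Z moves linearly from one branch of the
  focal hyperbola to the other. Every such leaf joins the two branches, which is why they share one
  separatrix surface.\<close>

lemma leaf3_separatrix:
  assumes p: "p \<in> foliation_domain M N 3" and r: "mu p $ 2 = C"
  shows "p \<in> leaf M N 3 p"
    "\<exists>e\<in>M. mu e $ 2 = mu e $ 3 \<and> 0 < Z e \<and> limiting_endpoint M N 3 (leaf M N 3 p) e"
    "\<exists>e\<in>M. mu e $ 2 = mu e $ 3 \<and> Z e < 0 \<and> limiting_endpoint M N 3 (leaf M N 3 p) e"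
proof -
  note pM = domM[OF p]
  note R = mu_ranges[OF pM] pos
  define Zc where "Zc = sqrt ((mu p $ 1 - D) * (C - D) / (B - D))"
  define ex where "ex = X p / sqrt (B - mu p $ 3)"
  have Zc: "Zc > 0" using r R by (simp add: Zc_def)
  have Zc2: "Zc^2 * (B - D) = (mu p $ 1 - D) * (C - D)" using r R by (simp add: Zc_def)
  have ex2: "ex^2 * (B - D) = mu p $ 1 - B"
  proof -
    have "ex^2 * (B - mu p $ 3) = (X p)^2" using R by (simp add: ex_def power_divide)
    then have "(ex^2 * (B - D)) * ((B - mu p $ 3) * (B - C)) = (mu p $ 1 - B) * ((B - mu p $ 3) * (B - C))"
      using squares(1)[OF pM, unfolded r] by algebra
    then show ?thesis using R by simp
  qed
  have sg: "sgn ex = sgn (X p)" using R by (auto simp: ex_def sgn_divide)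
  \<comment> \<open>The root is even in the centered parameter \<open>2 * t - 1\<close>: it is D in
    the middle, where Z changes sign, and C at both ends.\<close>
  define m where "m t = (vector [mu p $ 1, C, D + (C - D) * (2 * t - 1)^2] :: real^3)" for t :: real
  let ?x = "\<lambda>t. ex * sqrt ((B - D) - (C - D) * (2 * t - 1)^2)"
  let ?z = "\<lambda>t. Zc * (2 * t - 1)"
  have c2: "0 \<le> (C - D) * (2 * t - 1)^2 \<and> (C - D) * (2 * t - 1)^2 < C - D" if "t \<in> {0<..<1}" for t
    using pos mult_strict_left_mono[OF square_param[OF that] pos(2)] by simp
  have rt: "(B - D) - (C - D) * (2 * t - 1)^2 > 0" if "t \<in> {0<..<1}" for t
    using c2[OF that] pos by linarith
  have e: "ell (?x s) 0 (?z s) (m s)" if s: "s \<in> {0<..<1}" for s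
    unfolding ell_def m_def mult_sqrt_sq[OF rt[OF s]] vector_3
  proof (intro conjI)
    show "ex\<^sup>2 * (B - D - (C - D) * (2 * s - 1)\<^sup>2) * ((B - C) * (B - D)) =
      (mu p $ 1 - B) * (B - C) * (B - (D + (C - D) * (2 * s - 1)\<^sup>2))"
      using ex2 by algebra
    show "(Zc * (2 * s - 1))\<^sup>2 * ((B - D) * (C - D)) =
      (mu p $ 1 - D) * (C - D) * (D + (C - D) * (2 * s - 1)\<^sup>2 - D)"
      using Zc2 by algebra
  qed (use R c2[OF s] in \<open>linarith | simp\<close>)+
  have A': "p \<in> leaf M N 3 p" "limiting_endpoint M N 3 (leaf M N 3 p) (Phi (?x 0) 0 (?z 0))"
    "limiting_endpoint M N 3 (leaf M N 3 p) (Phi (?x 1) 0 (?z 1))"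
  proof -
    have 1: "\<exists>w\<in>{?x, \<lambda>_. 0, ?z, \<lambda>s. m s $ 3}. \<exists>D. D \<noteq> 0 \<and> (w has_real_derivative D) (at s)" for s
      using Zc by (intro bexI[of _ ?z] exI[of _ "Zc * 2"]) (auto intro!: derivative_eq_intros)
    have 2: "m s $ j \<noteq> m s $ 3" if "s \<in> {0<..<1}" "j \<noteq> 3" for s j
    proof -
      have "D + (C - D) * (2 * s - 1)^2 < mu p $ 1" "D + (C - D) * (2 * s - 1)^2 < C"
        using R c2[OF that(1)] by linarith+
      then show ?thesis using exhaust_3[of j] that(2) by (auto simp: m_def)
    qed
    have 3: "m s $ j = m t $ j" if "j \<noteq> 3" for s t j
      using exhaust_3[of j] that by (auto simp: m_def)
    have 4: "\<exists>t\<in>{0<..<1}. X q = ?x t \<and> Y q = 0 \<and> Z q = ?z t" if q: "q \<in> leafset 3 p" for q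
    proof -
      note qM = leafsetD(1)[OF q]
      have mu: "mu q $ 1 = mu p $ 1" "mu q $ 2 = C" using leafsetD(2)[OF q] r by auto
      have "mu q $ 3 < C" using leafsetD(3)[OF q, of 2] mu mu_ranges[OF qM] by auto
      define u where "u = Z q / Zc"
      have u: "Z q = Zc * u" using Zc by (simp add: u_def)
      have "u^2 * (C - D) * (mu p $ 1 - D) = (mu q $ 3 - D) * (mu p $ 1 - D)"
      proof -
        have "(u^2 * (C - D) * (mu p $ 1 - D)) * (C - D) = (mu q $ 3 - D) * (mu p $ 1 - D) * (C - D)"
          using squares(3)[OF qM, unfolded mu] Zc2 u by algebra
        then show ?thesis using pos by simp
      qed
      then have u2: "u^2 * (C - D) = mu q $ 3 - D" using R by simp
      then have "u^2 * (C - D) < 1 * (C - D)" using \<open>mu q $ 3 < C\<close> by simp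
      then have u1: "u^2 < 1" using pos by simp
      define t where "t = (u + 1) / 2"
      have t: "t \<in> {0<..<1}" "2 * t - 1 = u" using linear_param[OF u1] by (auto simp: t_def)
      have "(X q)^2 * ((B - C) * (B - D)) = (?x t)^2 * ((B - C) * (B - D))"
        unfolding mult_sqrt_sq[OF rt[OF t(1)]] unfolding t(2) using squares(1)[OF qM, unfolded mu] ex2 u2 by algebra
      then have "X q = ?x t"
        by (rule square_cancel) (use leafsetD(4)[OF q] sg rt[OF t(1)] pos in \<open>simp_all add: same_sign_def sgn_mult\<close>)
      moreover have "Y q = 0" using XYZ_zero_iff(2)[OF qM] mu by simp
      ultimately show ?thesis using t u by auto
    qed
    have 5: "continuous_on {0..1} ?x" "continuous_on {0..1} ?z" "continuous_on {0..1} (\<lambda>_. 0::real)" "smooth_on {0<..<1} (\<lambda>_. 0::real)"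
      by (intro continuous_intros smooth_intros)+
    have 6: "smooth_on {0<..<1} ?x" "smooth_on {0<..<1} ?z" by (intro smooth_intros rt; auto)+
    note A = arc_leaf[where m = m and i = 3, OF 5(1,3,2) 6(1) 5(4) 6(2) e 3 2 1 p 4]
    show "p \<in> leaf M N 3 p" "limiting_endpoint M N 3 (leaf M N 3 p) (Phi (?x 0) 0 (?z 0))"
      "limiting_endpoint M N 3 (leaf M N 3 p) (Phi (?x 1) 0 (?z 1))"
      using A by simp_all
  qed
  show "p \<in> leaf M N 3 p" by (rule A')
  have ep: "ell (ex * sqrt (B - C)) 0 (k * Zc) (vector [mu p $ 1, C, C])" if "k^2 = 1" for k
    unfolding ell_def mult_sqrt_sq[OF pos(1)] power_mult_distrib[of k] that vector_3
    using R ex2 Zc2 by simp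
  have "?x 0 = ex * sqrt (B - C)" "?x 1 = ex * sqrt (B - C)" "?z 0 = (-1) * Zc" "?z 1 = 1 * Zc" by simp_all
  then have E: "mu (Phi (?x 0) 0 (?z 0)) = vector [mu p $ 1, C, C]" "mu (Phi (?x 1) 0 (?z 1)) = vector [mu p $ 1, C, C]"
    using mu_Phi[OF ep[of "-1"]] mu_Phi[OF ep[of 1]] by simp_all
  show "\<exists>e\<in>M. mu e $ 2 = mu e $ 3 \<and> 0 < Z e \<and> limiting_endpoint M N 3 (leaf M N 3 p) e"
    using A'(3) E(2) Zc by (intro bexI[of _ "Phi (?x 1) 0 (?z 1)"]) auto
  show "\<exists>e\<in>M. mu e $ 2 = mu e $ 3 \<and> Z e < 0 \<and> limiting_endpoint M N 3 (leaf M N 3 p) e"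
    using A'(2) E(1) Zc by (intro bexI[of _ "Phi (?x 0) 0 (?z 0)"]) auto
qed

text \<open>With \<open>m$3 = C\<close> and \<open>m$1 > B\<close> the leaf lies in the plane Y = 0,
  crosses X = 0 at \<open>m$2 = B\<close> and ends where \<open>m$2\<close> has come down to C. As Z
  keeps its sign, the branch is that of \<open>p\<close>.\<close>

lemma leaf2_separatrix23:
  assumes p: "p \<in> foliation_domain M N 2" and r: "mu p $ 3 = C" "B < mu p $ 1"
  shows "p \<in> leaf M N 2 p"
    "\<exists>e\<in>M. mu e $ 2 = mu e $ 3 \<and> sgn (Z e) = sgn (Z p) \<and> limiting_endpoint M N 2 (leaf M N 2 p) e"
proof -
  note pM = domM[OF p]
  note R = mu_ranges[OF pM] pos
  define Xc where "Xc = sqrt ((mu p $ 1 - B) * (B - C) / (B - D))"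
  define ez where "ez = Z p / sqrt (mu p $ 2 - D)"
  have Xc: "Xc > 0" using r R by (simp add: Xc_def)
  have Xc2: "Xc^2 * (B - D) = (mu p $ 1 - B) * (B - C)" using r R by (simp add: Xc_def)
  have ez2: "ez^2 * (B - D) = mu p $ 1 - D"
  proof -
    have "ez^2 * (mu p $ 2 - D) = (Z p)^2" using R by (simp add: ez_def power_divide)
    then have "(ez^2 * (B - D)) * ((mu p $ 2 - D) * (C - D)) = (mu p $ 1 - D) * ((mu p $ 2 - D) * (C - D))"
      using squares(3)[OF pM, unfolded r(1)] by algebra
    then show ?thesis using R by simp
  qed
  have sg: "sgn ez = sgn (Z p)" using R by (auto simp: ez_def sgn_divide)
  define m where "m t = (vector [mu p $ 1, B - (B - C) * (2 * t - 1)^2, C] :: real^3)" for t :: real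
  let ?x = "\<lambda>t. Xc * (2 * t - 1)"
  let ?z = "\<lambda>t. ez * sqrt ((B - D) - (B - C) * (2 * t - 1)^2)"
  have c2: "0 \<le> (B - C) * (2 * t - 1)^2 \<and> (B - C) * (2 * t - 1)^2 < B - C" if "t \<in> {0<..<1}" for t
    using pos mult_strict_left_mono[OF square_param[OF that] pos(1)] by simp
  have rt: "(B - D) - (B - C) * (2 * t - 1)^2 > 0" if "t \<in> {0<..<1}" for t
    using c2[OF that] pos by linarith
  have e: "ell (?x s) 0 (?z s) (m s)" if s: "s \<in> {0<..<1}" for s
    unfolding ell_def m_def mult_sqrt_sq[OF rt[OF s]] vector_3
  proof (intro conjI)
    show "(Xc * (2 * s - 1))\<^sup>2 * ((B - C) * (B - D)) =
      (mu p $ 1 - B) * (B - (B - (B - C) * (2 * s - 1)\<^sup>2)) * (B - C)"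
      using Xc2 by algebra
    show "ez\<^sup>2 * (B - D - (B - C) * (2 * s - 1)\<^sup>2) * ((B - D) * (C - D)) =
      (mu p $ 1 - D) * (B - (B - C) * (2 * s - 1)\<^sup>2 - D) * (C - D)"
      using ez2 by algebra
  qed (use R c2[OF s] in \<open>linarith | simp\<close>)+
  have A': "p \<in> leaf M N 2 p" "limiting_endpoint M N 2 (leaf M N 2 p) (Phi (?x 1) 0 (?z 1))"
  proof -
    have 1: "\<exists>w\<in>{?x, \<lambda>_. 0, ?z, \<lambda>s. m s $ 2}. \<exists>D. D \<noteq> 0 \<and> (w has_real_derivative D) (at s)" for s
      using Xc by (intro bexI[of _ ?x] exI[of _ "Xc * 2"]) (auto intro!: derivative_eq_intros)
    have 2: "m s $ j \<noteq> m s $ 2" if "s \<in> {0<..<1}" "j \<noteq> 2" for s j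
    proof -
      have "B - (B - C) * (2 * s - 1)^2 < mu p $ 1" "C < B - (B - C) * (2 * s - 1)^2"
        using R r c2[OF that(1)] by linarith+
      then show ?thesis using exhaust_3[of j] that(2) by (auto simp: m_def)
    qed
    have 3: "m s $ j = m t $ j" if "j \<noteq> 2" for s t j
      using exhaust_3[of j] that by (auto simp: m_def)
    have 4: "\<exists>t\<in>{0<..<1}. X q = ?x t \<and> Y q = 0 \<and> Z q = ?z t" if q: "q \<in> leafset 2 p" for q
    proof -
      note qM = leafsetD(1)[OF q]
      have mu: "mu q $ 1 = mu p $ 1" "mu q $ 3 = C" using leafsetD(2)[OF q] r by auto
      have "C < mu q $ 2" using leafsetD(3)[OF q, of 3] mu mu_ranges[OF qM] by auto
      define u where "u = X q / Xc"
      have u: "X q = Xc * u" using Xc by (simp add: u_def)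
      have "(u^2 * (B - C)) * ((mu p $ 1 - B) * (B - C)) = (B - mu q $ 2) * ((mu p $ 1 - B) * (B - C))"
        using squares(1)[OF qM, unfolded mu] Xc2 u by algebra
      then have u2: "u^2 * (B - C) = B - mu q $ 2" using R r by simp
      then have "u^2 * (B - C) < 1 * (B - C)" using \<open>C < mu q $ 2\<close> by simp
      then have u1: "u^2 < 1" using pos by simp
      define t where "t = (u + 1) / 2"
      have t: "t \<in> {0<..<1}" "2 * t - 1 = u" using linear_param[OF u1] by (auto simp: t_def)
      have "(Z q)^2 * ((B - D) * (C - D)) = (?z t)^2 * ((B - D) * (C - D))"
        unfolding mult_sqrt_sq[OF rt[OF t(1)]] unfolding t(2) using squares(3)[OF qM, unfolded mu] ez2 u2 by algebra
      then have "Z q = ?z t"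
        by (rule square_cancel) (use leafsetD(4)[OF q] sg rt[OF t(1)] pos in \<open>simp_all add: same_sign_def sgn_mult\<close>)
      moreover have "Y q = 0" using XYZ_zero_iff(2)[OF qM] mu by simp
      ultimately show ?thesis using t u by auto
    qed
    have 5: "continuous_on {0..1} ?x" "continuous_on {0..1} ?z" "continuous_on {0..1} (\<lambda>_. 0::real)" "smooth_on {0<..<1} (\<lambda>_. 0::real)"
      by (intro continuous_intros smooth_intros)+
    have 6: "smooth_on {0<..<1} ?x" "smooth_on {0<..<1} ?z" by (intro smooth_intros rt; auto)+
    note A = arc_leaf[where m = m and i = 2, OF 5(1,3,2) 6(1) 5(4) 6(2) e 3 2 1 p 4]
    show "p \<in> leaf M N 2 p" "limiting_endpoint M N 2 (leaf M N 2 p) (Phi (?x 1) 0 (?z 1))"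
      using A by simp_all
  qed
  show "p \<in> leaf M N 2 p" by (rule A')
  have "ell Xc 0 (ez * sqrt (C - D)) (vector [mu p $ 1, C, C])"
    unfolding ell_def mult_sqrt_sq[OF pos(2)] vector_3
    using R ez2 Xc2 by simp
  then have "mu (Phi (?x 1) 0 (?z 1)) = vector [mu p $ 1, C, C]" by (intro mu_Phi) simp
  then show "\<exists>e\<in>M. mu e $ 2 = mu e $ 3 \<and> sgn (Z e) = sgn (Z p) \<and> limiting_endpoint M N 2 (leaf M N 2 p) e"
    using A'(2) sg pos by (intro bexI[of _ "Phi (?x 1) 0 (?z 1)"]) (auto simp: sgn_mult)
qed

text \<open>The counterpart in the plane X = 0: Y moves linearly, \<open>m$2\<close> falls from B to
  C and returns, and the leaf ends on the focal ellipse.\<close>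

lemma leaf2_separatrix12:
  assumes p: "p \<in> foliation_domain M N 2" and r: "mu p $ 1 = B" "mu p $ 3 < C"
  shows "p \<in> leaf M N 2 p"
    "\<exists>e\<in>M. mu e $ 1 = mu e $ 2 \<and> limiting_endpoint M N 2 (leaf M N 2 p) e"
proof -
  note pM = domM[OF p]
  note R = mu_ranges[OF pM] pos
  define Yc where "Yc = sqrt ((B - C) * (C - mu p $ 3) / (C - D))"
  define ez where "ez = Z p / sqrt (mu p $ 2 - D)"
  have Yc: "Yc > 0" using r R by (simp add: Yc_def)
  have Yc2: "Yc^2 * (C - D) = (B - C) * (C - mu p $ 3)" using r R by (simp add: Yc_def)
  have ez2: "ez^2 * (C - D) = mu p $ 3 - D"
  proof -
    have "ez^2 * (mu p $ 2 - D) = (Z p)^2" using R by (simp add: ez_def power_divide)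
    then have "(ez^2 * (C - D)) * ((mu p $ 2 - D) * (B - D)) = (mu p $ 3 - D) * ((mu p $ 2 - D) * (B - D))"
      using squares(3)[OF pM, unfolded r(1)] by algebra
    then show ?thesis using R by simp
  qed
  have sg: "sgn ez = sgn (Z p)" using R by (auto simp: ez_def sgn_divide)
  define m where "m t = (vector [B, C + (B - C) * (2 * t - 1)^2, mu p $ 3] :: real^3)" for t :: real
  let ?y = "\<lambda>t. Yc * (2 * t - 1)"
  let ?z = "\<lambda>t. ez * sqrt ((C - D) + (B - C) * (2 * t - 1)^2)"
  have c2: "0 \<le> (B - C) * (2 * t - 1)^2 \<and> (B - C) * (2 * t - 1)^2 < B - C" if "t \<in> {0<..<1}" for t
    using pos mult_strict_left_mono[OF square_param[OF that] pos(1)] by simp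
  have rt: "(C - D) + (B - C) * (2 * t - 1)^2 > 0" for t
    using pos by (simp add: add_pos_nonneg)
  have e: "ell 0 (?y s) (?z s) (m s)" if s: "s \<in> {0<..<1}" for s
    unfolding ell_def m_def mult_sqrt_sq[OF rt] vector_3
  proof (intro conjI)
    show "(Yc * (2 * s - 1))\<^sup>2 * ((B - C) * (C - D)) =
      (B - C) * (C + (B - C) * (2 * s - 1)\<^sup>2 - C) * (C - mu p $ 3)"
      using Yc2 by algebra
    show "ez\<^sup>2 * (C - D + (B - C) * (2 * s - 1)\<^sup>2) * ((B - D) * (C - D)) =
      (B - D) * (C + (B - C) * (2 * s - 1)\<^sup>2 - D) * (mu p $ 3 - D)"
      using ez2 by algebra
  qed (use R c2[OF s] in \<open>linarith | simp\<close>)+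
  have A': "p \<in> leaf M N 2 p" "limiting_endpoint M N 2 (leaf M N 2 p) (Phi 0 (?y 1) (?z 1))"
  proof -
    have 1: "\<exists>w\<in>{\<lambda>_. 0, ?y, ?z, \<lambda>s. m s $ 2}. \<exists>D. D \<noteq> 0 \<and> (w has_real_derivative D) (at s)" for s
      using Yc by (intro bexI[of _ ?y] exI[of _ "Yc * 2"]) (auto intro!: derivative_eq_intros)
    have 2: "m s $ j \<noteq> m s $ 2" if "s \<in> {0<..<1}" "j \<noteq> 2" for s j
    proof -
      have "C + (B - C) * (2 * s - 1)^2 < B" "mu p $ 3 < C + (B - C) * (2 * s - 1)^2"
        using R r c2[OF that(1)] by linarith+
      then show ?thesis using exhaust_3[of j] that(2) by (auto simp: m_def)
    qed
    have 3: "m s $ j = m t $ j" if "j \<noteq> 2" for s t j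
      using exhaust_3[of j] that by (auto simp: m_def)
    have 4: "\<exists>t\<in>{0<..<1}. X q = 0 \<and> Y q = ?y t \<and> Z q = ?z t" if q: "q \<in> leafset 2 p" for q
    proof -
      note qM = leafsetD(1)[OF q]
      have mu: "mu q $ 1 = B" "mu q $ 3 = mu p $ 3" using leafsetD(2)[OF q] r by auto
      have "mu q $ 2 < B" using leafsetD(3)[OF q, of 1] mu mu_ranges[OF qM] by auto
      define u where "u = Y q / Yc"
      have u: "Y q = Yc * u" using Yc by (simp add: u_def)
      have "(u^2 * (B - C)) * ((C - mu p $ 3) * (B - C)) = (mu q $ 2 - C) * ((C - mu p $ 3) * (B - C))"
        using squares(2)[OF qM, unfolded mu] Yc2 u by algebra
      then have u2: "u^2 * (B - C) = mu q $ 2 - C" using R r by simp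
      then have "u^2 * (B - C) < 1 * (B - C)" using \<open>mu q $ 2 < B\<close> by simp
      then have u1: "u^2 < 1" using pos by simp
      define t where "t = (u + 1) / 2"
      have t: "t \<in> {0<..<1}" "2 * t - 1 = u" using linear_param[OF u1] by (auto simp: t_def)
      have "(Z q)^2 * ((B - D) * (C - D)) = (?z t)^2 * ((B - D) * (C - D))"
        unfolding mult_sqrt_sq[OF rt] unfolding t(2) using squares(3)[OF qM, unfolded mu] ez2 u2 by algebra
      then have "Z q = ?z t"
        by (rule square_cancel) (use leafsetD(4)[OF q] sg rt[of t] pos in \<open>simp_all add: same_sign_def sgn_mult\<close>)
      moreover have "X q = 0" using XYZ_zero_iff(1)[OF qM] mu by simp
      ultimately show ?thesis using t u by auto
    qed
    have 5: "continuous_on {0..1} ?y" "continuous_on {0..1} ?z" "continuous_on {0..1} (\<lambda>_. 0::real)" "smooth_on {0<..<1} (\<lambda>_. 0::real)"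
      by (intro continuous_intros smooth_intros)+
    have 6: "smooth_on {0<..<1} ?y" "smooth_on {0<..<1} ?z" by (intro smooth_intros rt; auto)+
    note A = arc_leaf[where m = m and i = 2, OF 5(3,1,2) 5(4) 6 e 3 2 1 p 4]
    show "p \<in> leaf M N 2 p" "limiting_endpoint M N 2 (leaf M N 2 p) (Phi 0 (?y 1) (?z 1))"
      using A by simp_all
  qed
  show "p \<in> leaf M N 2 p" by (rule A')
  have "ell 0 Yc (ez * sqrt (B - D)) (vector [B, B, mu p $ 3])"
    unfolding ell_def mult_sqrt_sq[OF pos(3)] vector_3
    using R ez2 Yc2 by simp
  then have "mu (Phi 0 (?y 1) (?z 1)) = vector [B, B, mu p $ 3]" by (intro mu_Phi) simp
  then show "\<exists>e\<in>M. mu e $ 1 = mu e $ 2 \<and> limiting_endpoint M N 2 (leaf M N 2 p) e"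
    using A'(2) by (intro bexI[of _ "Phi 0 (?y 1) (?z 1)"]) auto
qed

text \<open>The exceptional leaves on the Z-axis, where X and Y give no parameter. They run from the
  hyperbola at \<open>m$2 = C\<close> to the ellipse at \<open>m$2 = B\<close>, hence belong to
  separatrix surfaces of both kinds.\<close>

lemma leaf2_separatrix_both:
  assumes p: "p \<in> foliation_domain M N 2" and r: "mu p $ 1 = B" "mu p $ 3 = C"
  shows "p \<in> leaf M N 2 p"
    "\<exists>e\<in>M. mu e $ 1 = mu e $ 2 \<and> limiting_endpoint M N 2 (leaf M N 2 p) e"
    "\<exists>e\<in>M. mu e $ 2 = mu e $ 3 \<and> sgn (Z e) = sgn (Z p) \<and> limiting_endpoint M N 2 (leaf M N 2 p) e"
proof -
  note pM = domM[OF p]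
  note R = mu_ranges[OF pM] pos
  have k2: "(sgn (Z p))^2 = 1" using XYZ_zero_iff(3)[OF pM] r pos by (auto simp: sgn_if)
  \<comment> \<open>On the axis \<open>(Z q)^2 = m$2 - D\<close>, so \<open>f\<close> interpolates
    linearly between the absolute values of Z at the two ends.\<close>
  define f where "f t = (1 - t) * sqrt (C - D) + t * sqrt (B - D)" for t
  let ?z = "\<lambda>t. sgn (Z p) * f t"
  define m where "m t = (vector [B, D + (f t)^2, C] :: real^3)" for t
  have f': "f t = sqrt (C - D) + t * (sqrt (B - D) - sqrt (C - D))" for t by (simp add: f_def algebra_simps)
  have lt: "sqrt (C - D) < sqrt (B - D)" using pos by simp
  have fr: "sqrt (C - D) < f t \<and> f t < sqrt (B - D)" if "t \<in> {0<..<1}" for t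
  proof -
    have "0 < t * (sqrt (B - D) - sqrt (C - D))" "t * (sqrt (B - D) - sqrt (C - D)) < 1 * (sqrt (B - D) - sqrt (C - D))"
      using that lt by (intro mult_pos_pos mult_strict_right_mono; simp)+
    then show ?thesis unfolding f' by simp
  qed
  have f2: "C - D < (f t)^2 \<and> (f t)^2 < B - D" if "t \<in> {0<..<1}" for t
  proof -
    have "0 < sqrt (C - D)" using pos by simp
    then have "(sqrt (C - D))^2 < (f t)^2" "(f t)^2 < (sqrt (B - D))^2"
      using fr[OF that] by (intro power_strict_mono; linarith)+
    then show ?thesis using pos by simp
  qed
  have e: "ell 0 0 (?z s) (m s)" if s: "s \<in> {0<..<1}" for s
    unfolding ell_def m_def power_mult_distrib k2 vector_3 using R f2[OF s] by simp
  have A': "p \<in> leaf M N 2 p" "limiting_endpoint M N 2 (leaf M N 2 p) (Phi 0 0 (?z 0))"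
     "limiting_endpoint M N 2 (leaf M N 2 p) (Phi 0 0 (?z 1))"
  proof -
    have 1: "\<exists>w\<in>{\<lambda>_. 0, \<lambda>_. 0, ?z, \<lambda>s. m s $ 2}. \<exists>D. D \<noteq> 0 \<and> (w has_real_derivative D) (at s)" for s
      using lt k2 unfolding f'
      by (intro bexI[of _ ?z] exI[of _ "sgn (Z p) * (sqrt (B - D) - sqrt (C - D))"])
        (auto intro!: derivative_eq_intros simp: f')
    have 2: "m s $ j \<noteq> m s $ 2" if "s \<in> {0<..<1}" "j \<noteq> 2" for s j
    proof -
      have "D + (f s)^2 < B" "C < D + (f s)^2" using R f2[OF that(1)] by linarith+
      then show ?thesis using exhaust_3[of j] that(2) by (auto simp: m_def)
    qed
    have 3: "m s $ j = m t $ j" if "j \<noteq> 2" for s t j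
      using exhaust_3[of j] that by (auto simp: m_def)
    have 4: "\<exists>t\<in>{0<..<1}. X q = 0 \<and> Y q = 0 \<and> Z q = ?z t" if q: "q \<in> leafset 2 p" for q
    proof -
      note qM = leafsetD(1)[OF q]
      have mu: "mu q $ 1 = B" "mu q $ 3 = C" using leafsetD(2)[OF q] r by auto
      have m2: "mu q $ 2 < B" "C < mu q $ 2"
        using leafsetD(3)[OF q, of 1] leafsetD(3)[OF q, of 3] mu mu_ranges[OF qM] by auto
      have "(Z q)^2 * ((B - D) * (C - D)) = (mu q $ 2 - D) * ((B - D) * (C - D))"
        using squares(3)[OF qM, unfolded mu] by algebra
      then have z2: "(Z q)^2 = mu q $ 2 - D" using pos by simp
      then have "sqrt (mu q $ 2 - D) = \<bar>Z q\<bar>" by (metis real_sqrt_abs)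
      then have za: "sqrt (C - D) < \<bar>Z q\<bar>" "\<bar>Z q\<bar> < sqrt (B - D)"
        using m2 by (metis diff_strict_right_mono real_sqrt_less_iff)+
      define t where "t = (\<bar>Z q\<bar> - sqrt (C - D)) / (sqrt (B - D) - sqrt (C - D))"
      have "t \<in> {0<..<1}" using za lt by (simp add: t_def)
      moreover have "f t = \<bar>Z q\<bar>" using lt unfolding f' by (simp add: t_def)
      then have "Z q = ?z t" using leafsetD(4)[OF q] by (simp add: same_sign_def sgn_mult_abs)
      moreover have "X q = 0" "Y q = 0" using XYZ_zero_iff[OF qM] mu by auto
      ultimately show ?thesis by auto
    qed
    have 5: "continuous_on {0..1} ?z" "continuous_on {0..1} (\<lambda>_. 0::real)" "smooth_on {0<..<1} (\<lambda>_. 0::real)" unfolding f_def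
      by (intro continuous_intros smooth_intros)+
    have 6: "smooth_on {0<..<1} ?z" unfolding f_def by (intro smooth_intros) auto
    note A = arc_leaf[where m = m and i = 2, OF 5(2,2,1) 5(3,3) 6 e 3 2 1 p 4]
    show "p \<in> leaf M N 2 p" "limiting_endpoint M N 2 (leaf M N 2 p) (Phi 0 0 (?z 0))"
     "limiting_endpoint M N 2 (leaf M N 2 p) (Phi 0 0 (?z 1))"
      using A by simp_all
  qed
  show "p \<in> leaf M N 2 p" by (rule A')
  have "ell 0 0 (?z 1) (vector [B, B, C])" "ell 0 0 (?z 0) (vector [B, C, C])"
    unfolding ell_def power_mult_distrib k2 vector_3 using R by (simp_all add: f_def)
  note E = this[THEN mu_Phi]
  show "\<exists>e\<in>M. mu e $ 1 = mu e $ 2 \<and> limiting_endpoint M N 2 (leaf M N 2 p) e"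
    using A'(3) E(1) by (intro bexI[of _ "Phi 0 0 (?z 1)"]) auto
  have "f 0 > 0" using pos by (simp add: f_def)
  then show "\<exists>e\<in>M. mu e $ 2 = mu e $ 3 \<and> sgn (Z e) = sgn (Z p) \<and> limiting_endpoint M N 2 (leaf M N 2 p) e"
    using A'(2) E(2) by (intro bexI[of _ "Phi 0 0 (?z 0)"]) (auto simp: sgn_mult)
qed

text \<open>The constant roots are continuous and pass to the limit. The sign of Z survives only as
  a weak inequality.\<close>

lemma limiting_endpoint_mu:
  assumes l: "limiting_endpoint M N i (leaf M N i p) q" and q: "q \<in> M"
  shows "j \<noteq> i \<Longrightarrow> mu q $ j = mu p $ j" "i = 2 \<Longrightarrow> Z p < 0 \<Longrightarrow> Z q \<le> 0" "i = 2 \<Longrightarrow> 0 < Z p \<Longrightarrow> 0 \<le> Z q"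
    "i = 2 \<Longrightarrow> Z p = 0 \<Longrightarrow> Z q = 0"
proof -
  obtain g where g: "g ` {0<..<1::real} = leaf M N i p" "(g \<longlongrightarrow> q) (at_right 0) \<or> (g \<longlongrightarrow> q) (at_left 1)"
    using l unfolding limiting_endpoint_def by blast
  obtain F where F: "(g \<longlongrightarrow> q) F" "\<forall>\<^sub>F s in F. s \<in> {0<..<1::real}" "F \<noteq> bot"
  proof -
    have "\<forall>\<^sub>F s in at_right 0. s \<in> {0<..<1::real}" "\<forall>\<^sub>F s in at_left 1. s \<in> {0<..<1::real}"
      using eventually_at_right_real[of 0 1] eventually_at_left_real[of 0 1] by simp_all
    then show ?thesis using g(2) that trivial_limit_at_right_real trivial_limit_at_left_real by metis
  qed
  have ls: "\<forall>\<^sub>F s in F. g s \<in> leafset i p"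
    using F(2) by eventually_elim (use g(1) leaf_subset_leafset in blast)
  then have gM: "\<forall>\<^sub>F s in F. g s \<in> M" by eventually_elim (rule leafsetD(1))
  show "mu q $ j = mu p $ j" if "j \<noteq> i"
  proof -
    have "((\<lambda>s. mu (g s) $ j) \<longlongrightarrow> mu q $ j) F"
      by (rule continuous_on_tendsto_compose[OF continuous_on_mu F(1) q gM])
    moreover have "((\<lambda>s. mu (g s) $ j) \<longlongrightarrow> mu p $ j) F"
      by (rule tendsto_eventually) (use ls in \<open>eventually_elim, use leafsetD(2) that in blast\<close>)
    ultimately show ?thesis using tendsto_unique[OF F(3)] by blast
  qed
  have Zl: "((\<lambda>s. Z (g s)) \<longlongrightarrow> Z q) F"
    by (rule bounded_linear.tendsto[OF bounded_linear_XYZ(3) F(1)])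
  have sg: "\<forall>\<^sub>F s in F. sgn (Z (g s)) = sgn (Z p)" if "i = 2"
    using ls by eventually_elim (use leafsetD(4) that in \<open>simp add: same_sign_def\<close>)
  show "Z q \<le> 0" if "i = 2" "Z p < 0"
    by (rule tendsto_upperbound[OF Zl _ F(3)])
      (use sg[OF that(1)] in \<open>eventually_elim, use that in \<open>simp add: sgn_if split: if_splits\<close>\<close>)
  show "0 \<le> Z q" if "i = 2" "0 < Z p"
    by (rule tendsto_lowerbound[OF Zl _ F(3)])
      (use sg[OF that(1)] in \<open>eventually_elim, use that in \<open>simp add: sgn_if split: if_splits\<close>\<close>)
  show "Z q = 0" if "i = 2" "Z p = 0"
  proof -
    have "((\<lambda>s. Z (g s)) \<longlongrightarrow> 0) F"
      by (rule tendsto_eventually)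
        (use sg[OF that(1)] in \<open>eventually_elim, use that in \<open>simp add: sgn_if split: if_splits\<close>\<close>)
    then show ?thesis using tendsto_unique[OF F(3) Zl] by blast
  qed
qed

section \<open>Separatrix surfaces as level sets of ellipsoidal coordinates\<close>

definition P23s :: "real \<Rightarrow> (real^4) set" where
  "P23s s = {p \<in> M. mu p $ 2 = mu p $ 3 \<and> 0 < s * Z p}"

lemma P23_mu_eq: "p \<in> M \<Longrightarrow> mu p $ 2 = mu p $ 3 \<longleftrightarrow> mu p $ 2 = C \<and> mu p $ 3 = C"
  and P12_mu_eq: "p \<in> M \<Longrightarrow> mu p $ 1 = mu p $ 2 \<longleftrightarrow> mu p $ 1 = B \<and> mu p $ 2 = B"
  using mu_ranges[of p] by auto

lemma separatrix_subset:
  assumes "x \<in> separatrix_surface M N i S" "S \<subseteq> M"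
  obtains q p where "q \<in> S" "p \<in> foliation_domain M N i" "x \<in> leafset i p"
    "limiting_endpoint M N i (leaf M N i p) q"
  using assms leaf_subset_leafset unfolding separatrix_surface_def leaves_def by blast

lemma separatrixI:
  "p \<in> foliation_domain M N i \<Longrightarrow> p \<in> leaf M N i p \<Longrightarrow> q \<in> S \<Longrightarrow>
    limiting_endpoint M N i (leaf M N i p) q \<Longrightarrow> p \<in> separatrix_surface M N i S"
  unfolding separatrix_surface_def leaves_def by blast

text \<open>Each leaf with \<open>m$2 = C\<close> has an end on either branch, so the surface does
  not depend on \<open>s\<close>.\<close>

lemma separatrix3:
  assumes "s = 1 \<or> s = -1"
  shows "separatrix_surface M N 3 (P23s s) = {p \<in> M. mu p $ 2 = C \<and> mu p $ 3 < C}"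
proof (intro equalityI subsetI)
  fix x assume x: "x \<in> separatrix_surface M N 3 (P23s s)"
  obtain q p where qp: "q \<in> P23s s" "p \<in> foliation_domain M N 3" "x \<in> leafset 3 p"
    "limiting_endpoint M N 3 (leaf M N 3 p) q"
    by (rule separatrix_subset[OF x]) (auto simp: P23s_def)
  have "q \<in> M" "mu q $ 2 = C" using qp(1) P23_mu_eq by (auto simp: P23s_def)
  then have "mu x $ 2 = C" using limiting_endpoint_mu(1)[OF qp(4), of 2] leafsetD(2)[OF qp(3), of 2] by simp
  moreover have "mu x $ 3 < C"
    using leafsetD(3)[OF qp(3), of 2] mu_ranges[OF leafsetD(1)[OF qp(3)]] calculation by auto
  ultimately show "x \<in> {p \<in> M. mu p $ 2 = C \<and> mu p $ 3 < C}" using leafsetD(1)[OF qp(3)] by simp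
next
  fix p assume p: "p \<in> {p \<in> M. mu p $ 2 = C \<and> mu p $ 3 < C}"
  have "mu p $ 3 < mu p $ 1" using p mu_ranges[of p] BC by auto
  then have dom: "p \<in> foliation_domain M N 3" using p by (auto simp: foliation_domain_M forall_3)
  obtain q where "q \<in> P23s s" "limiting_endpoint M N 3 (leaf M N 3 p) q"
    using leaf3_separatrix[OF dom] p assms unfolding P23s_def by fastforce
  then show "p \<in> separatrix_surface M N 3 (P23s s)"
    using separatrixI[OF dom] leaf3_separatrix(1)[OF dom] p by blast
qed

text \<open>The condition \<open>mu p $ 2 < mu p $ 1\<close> removes the point of the focal ellipse
  on the Z-axis, on the side selected by \<open>s\<close>; it becomes the puncture of the
  disk.\<close>

lemma separatrix2_P23s:
  assumes "s = 1 \<or> s = -1"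
  shows "separatrix_surface M N 2 (P23s s) = {p \<in> M. mu p $ 3 = C \<and> C < mu p $ 2 \<and> mu p $ 2 < mu p $ 1 \<and> 0 < s * Z p}"
    (is "_ = ?R")
proof (intro equalityI subsetI)
  fix x assume x: "x \<in> separatrix_surface M N 2 (P23s s)"
  obtain q p where qp: "q \<in> P23s s" "p \<in> foliation_domain M N 2" "x \<in> leafset 2 p"
    "limiting_endpoint M N 2 (leaf M N 2 p) q"
    by (rule separatrix_subset[OF x]) (auto simp: P23s_def)
  have q: "q \<in> M" "mu q $ 3 = C" "0 < s * Z q" using qp(1) P23_mu_eq by (auto simp: P23s_def)
  note xM = leafsetD(1)[OF qp(3)]
  have x3: "mu x $ 3 = C" using q limiting_endpoint_mu(1)[OF qp(4), of 3] leafsetD(2)[OF qp(3), of 3] by simp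
  have "mu x $ 2 \<noteq> mu x $ 1" "mu x $ 2 \<noteq> C" using leafsetD(3)[OF qp(3), of 1] leafsetD(3)[OF qp(3), of 3] x3 by auto
  then have x2: "C < mu x $ 2" "mu x $ 2 < mu x $ 1" using mu_ranges[OF xM] by auto
  \<comment> \<open>Z is non-zero at the end \<open>q\<close>, so the weak inequalities in the limit
    already determine the strict sign on the leaf.\<close>
  have "0 < s * Z p" using limiting_endpoint_mu(2-4)[OF qp(4) q(1) refl] q(3) assms by force
  moreover have "sgn (Z p) = sgn (Z x)" using leafsetD(4)[OF qp(3)] by (simp add: same_sign_def)
  ultimately have "0 < s * Z x" using assms by (auto simp: sgn_if split: if_splits)
  then show "x \<in> ?R" using xM x2 x3 by simp
next
  fix p assume p: "p \<in> ?R"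
  then have pM: "p \<in> M" and p3: "mu p $ 3 = C" by simp_all
  have dom: "p \<in> foliation_domain M N 2" using p by (auto simp: foliation_domain_M forall_3)
  have "p \<in> leaf M N 2 p \<and> (\<exists>e\<in>M. mu e $ 2 = mu e $ 3 \<and> sgn (Z e) = sgn (Z p) \<and> limiting_endpoint M N 2 (leaf M N 2 p) e)"
  proof (cases "mu p $ 1 = B")
    case True
    then show ?thesis using leaf2_separatrix_both[OF dom _ p3] by blast
  next
    case False
    then have "B < mu p $ 1" using mu_ranges(5)[OF pM] by simp
    then show ?thesis using leaf2_separatrix23[OF dom p3] by blast
  qed
  then obtain e where e: "p \<in> leaf M N 2 p" "e \<in> M" "mu e $ 2 = mu e $ 3" "sgn (Z e) = sgn (Z p)"
    "limiting_endpoint M N 2 (leaf M N 2 p) e" by blast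
  have "0 < s * Z e" using p e(4) assms by (auto simp: sgn_if split: if_splits)
  then show "p \<in> separatrix_surface M N 2 (P23s s)"
    using separatrixI[OF dom e(1) _ e(5)] e by (simp add: P23s_def)
qed

text \<open>The condition \<open>mu p $ 3 < mu p $ 2\<close> removes the two points where the focal
  hyperbola meets the plane X = 0. The leaves on the Z-axis have to be treated apart from the
  others.\<close>

lemma separatrix2_P12:
  "separatrix_surface M N 2 {p \<in> M. mu p $ 1 = mu p $ 2} = {p \<in> M. mu p $ 1 = B \<and> mu p $ 2 < B \<and> mu p $ 3 < mu p $ 2}"
    (is "separatrix_surface M N 2 ?S = ?R")
proof (intro equalityI subsetI)
  fix x assume x: "x \<in> separatrix_surface M N 2 ?S"
  obtain q p where qp: "q \<in> ?S" "p \<in> foliation_domain M N 2" "x \<in> leafset 2 p"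
    "limiting_endpoint M N 2 (leaf M N 2 p) q"
    by (rule separatrix_subset[OF x]) auto
  have q: "q \<in> M" "mu q $ 1 = B" using qp(1) P12_mu_eq by auto
  note xM = leafsetD(1)[OF qp(3)]
  have x3: "mu x $ 1 = B" using q limiting_endpoint_mu(1)[OF qp(4), of 1] leafsetD(2)[OF qp(3), of 1] by simp
  have "mu x $ 2 \<noteq> mu x $ 1" "mu x $ 2 \<noteq> mu x $ 3" using leafsetD(3)[OF qp(3), of 1] leafsetD(3)[OF qp(3), of 3] by auto
  then show "x \<in> ?R" using mu_ranges[OF xM] xM x3 by auto
next
  fix p assume p: "p \<in> ?R"
  then have pM: "p \<in> M" and p1: "mu p $ 1 = B" by simp_all
  have dom: "p \<in> foliation_domain M N 2" using p by (auto simp: foliation_domain_M forall_3)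
  have "p \<in> leaf M N 2 p \<and> (\<exists>e\<in>M. mu e $ 1 = mu e $ 2 \<and> limiting_endpoint M N 2 (leaf M N 2 p) e)"
  proof (cases "mu p $ 3 = C")
    case True
    then show ?thesis using leaf2_separatrix_both[OF dom p1] by blast
  next
    case False
    then have "mu p $ 3 < C" using mu_ranges(2)[OF pM] by simp
    then show ?thesis using leaf2_separatrix12[OF dom p1] by blast
  qed
  then obtain e where e: "p \<in> leaf M N 2 p" "e \<in> M" "mu e $ 1 = mu e $ 2"
    "limiting_endpoint M N 2 (leaf M N 2 p) e" by blast
  show "p \<in> separatrix_surface M N 2 ?S"
    using separatrixI[OF dom e(1) _ e(4)] e by simp
qed

end

subsection \<open>The separatrix surfaces in coordinates\<close>

text \<open>Radial rescaling that fixes the origin; it uses the squared norm \<open>r\<close>, a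
  polynomial, to stay smooth there.\<close>

lemma diffeomorphic_punctured_plane_disk:
  "diffeomorphic (UNIV - {0::real^2}) (ball (0::real^2) 1 - {0})"
proof -
  define r where "r v = (v$1)^2 + (v$2)^2" for v :: "real^2"
  have nr: "(norm v)^2 = r v" for v
    by (simp add: norm_vec_def L2_set_def sum_2 r_def)
  have r0: "r v \<ge> 0" for v by (simp add: r_def)
  have r1: "r v < 1" if "v \<in> ball 0 1" for v
    using that by (simp add: nr[symmetric] abs_square_less_1)
  have rs: "r (k *\<^sub>R v) = k^2 * r v" for k v by (simp add: r_def power_mult_distrib algebra_simps)
  show ?thesis
  proof (rule diffeomorphicI)
    show "smooth_map_on (UNIV - {0::real^2}) (\<lambda>v. (1 / sqrt (1 + r v)) *\<^sub>R v)"
    proof (rule smooth_map_onI[of UNIV])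
      have "1 + r v > 0" for v using r0[of v] by linarith
      moreover have "sqrt (1 + r v) \<noteq> 0" for v using calculation[of v] by simp
      ultimately show "smooth_on UNIV (\<lambda>v::real^2. (1 / sqrt (1 + r v)) *\<^sub>R v)"
        unfolding r_def by (intro smooth_intros open_UNIV)
    qed auto
    show "smooth_map_on (ball (0::real^2) 1 - {0}) (\<lambda>v. (1 / sqrt (1 - r v)) *\<^sub>R v)"
    proof (rule smooth_map_onI[of "ball 0 1"])
      show "smooth_on (ball 0 1) (\<lambda>v::real^2. (1 / sqrt (1 - r v)) *\<^sub>R v)"
      proof (intro smooth_intros open_ball)
        show "1 - r v > 0" "sqrt (1 - r v) \<noteq> 0" if "v \<in> ball 0 1" for v using r1[OF that] by simp_all
        show "smooth_on (ball 0 1) r" unfolding r_def by (intro smooth_intros open_ball)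
      qed
    qed auto
    fix v :: "real^2"
    have p: "1 + r v > 0" using r0[of v] by linarith
    have e: "r ((1 / sqrt (1 + r v)) *\<^sub>R v) = r v / (1 + r v)"
      using p by (simp add: rs power_divide)
    have "(norm ((1 / sqrt (1 + r v)) *\<^sub>R v))^2 < 1" unfolding nr e using p by simp
    then have "norm ((1 / sqrt (1 + r v)) *\<^sub>R v) < 1" by (simp add: abs_square_less_1)
    then show "v \<in> UNIV - {0} \<Longrightarrow> (1 / sqrt (1 + r v)) *\<^sub>R v \<in> ball 0 1 - {0}"
      using p by simp
    have "1 - r v / (1 + r v) = 1 / (1 + r v)" using p by (simp add: field_simps)
    then show "(1 / sqrt (1 - r ((1 / sqrt (1 + r v)) *\<^sub>R v))) *\<^sub>R (1 / sqrt (1 + r v)) *\<^sub>R v = v"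
      using p by (simp add: e real_sqrt_divide)
    assume v: "v \<in> ball 0 1 - {0}"
    then have p': "1 - r v > 0" using r1[of v] by simp
    then show "(1 / sqrt (1 - r v)) *\<^sub>R v \<in> UNIV - {0}" using v by simp
    have e': "r ((1 / sqrt (1 - r v)) *\<^sub>R v) = r v / (1 - r v)"
      using p' by (simp add: rs power_divide)
    have "1 + r v / (1 - r v) = 1 / (1 - r v)" using p' by (simp add: field_simps)
    then show "(1 / sqrt (1 + r ((1 / sqrt (1 - r v)) *\<^sub>R v))) *\<^sub>R (1 / sqrt (1 - r v)) *\<^sub>R v = v"
      using p' by (simp add: e' real_sqrt_divide)
  qed
qed

context quadric
begin

text \<open>A positive multiple of \<open>E_fun\<close> in linear coordinates: in the plane X = 0 it
  vanishes on the focal ellipse.\<close>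

definition FF :: "real^4 \<Rightarrow> real" where
  "FF p = (Y p)^2 * (B - D) + (Z p)^2 * (B - C) - (B - C) * (B - D)"

text \<open>A positive multiple of \<open>H_fun\<close> in linear coordinates: in the plane Y = 0 it
  vanishes on the focal hyperbola.\<close>

definition HH :: "real^4 \<Rightarrow> real" where
  "HH p = (Z p)^2 * (B - C) - (X p)^2 * (C - D) - (B - C) * (C - D)"

text \<open>On X = 0 one of the first two roots is B. Inserting the squared coordinates factors
  \<open>FF\<close>, and its sign separates \<open>m$1 = B\<close>, inside the ellipse, from
  \<open>m$2 = B\<close>, outside.\<close>

lemma FF_mu:
  assumes p: "p \<in> M"
  shows "mu p $ 1 = B \<Longrightarrow> FF p = - ((B - mu p $ 2) * (B - mu p $ 3))"
    "mu p $ 2 = B \<Longrightarrow> FF p = (mu p $ 1 - B) * (B - mu p $ 3)"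
proof -
  have k: "FF p * ((B - C) * (B - D) * (C - D)) = ((Y p)^2 * ((B - C) * (C - D))) * (B - D) * (B - D)
      + ((Z p)^2 * ((B - D) * (C - D))) * (B - C) * (B - C) - (B - C) * (B - D) * ((B - C) * (B - D) * (C - D))"
    unfolding FF_def by algebra
  have nz: "(B - C) * (B - D) * (C - D) \<noteq> 0" using pos by simp
  show "FF p = - ((B - mu p $ 2) * (B - mu p $ 3))" if "mu p $ 1 = B"
  proof -
    have "FF p * ((B - C) * (B - D) * (C - D)) = - ((B - mu p $ 2) * (B - mu p $ 3)) * ((B - C) * (B - D) * (C - D))"
      unfolding k squares[OF p] that by algebra
    then show ?thesis using nz mult_right_cancel by blast
  qed
  show "FF p = (mu p $ 1 - B) * (B - mu p $ 3)" if "mu p $ 2 = B"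
  proof -
    have "FF p * ((B - C) * (B - D) * (C - D)) = (mu p $ 1 - B) * (B - mu p $ 3) * ((B - C) * (B - D) * (C - D))"
      unfolding k squares[OF p] that by algebra
    then show ?thesis using nz mult_right_cancel by blast
  qed
qed

text \<open>The analogue on Y = 0: between the branches of the hyperbola \<open>m$2 = C\<close>,
  beyond them \<open>m$3 = C\<close>.\<close>

lemma HH_mu:
  assumes p: "p \<in> M"
  shows "mu p $ 3 = C \<Longrightarrow> HH p = (mu p $ 1 - C) * (mu p $ 2 - C)"
    "mu p $ 2 = C \<Longrightarrow> HH p = - ((mu p $ 1 - C) * (C - mu p $ 3))"
proof -
  have k: "HH p * ((B - C) * (B - D) * (C - D)) = ((Z p)^2 * ((B - D) * (C - D))) * (B - C) * (B - C)
      - ((X p)^2 * ((B - C) * (B - D))) * (C - D) * (C - D) - (B - C) * (C - D) * ((B - C) * (B - D) * (C - D))"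
    unfolding HH_def by algebra
  have nz: "(B - C) * (B - D) * (C - D) \<noteq> 0" using pos by simp
  show "HH p = (mu p $ 1 - C) * (mu p $ 2 - C)" if "mu p $ 3 = C"
  proof -
    have "HH p * ((B - C) * (B - D) * (C - D)) = (mu p $ 1 - C) * (mu p $ 2 - C) * ((B - C) * (B - D) * (C - D))"
      unfolding k squares[OF p] that by algebra
    then show ?thesis using nz mult_right_cancel by blast
  qed
  show "HH p = - ((mu p $ 1 - C) * (C - mu p $ 3))" if "mu p $ 2 = C"
  proof -
    have "HH p * ((B - C) * (B - D) * (C - D)) = - ((mu p $ 1 - C) * (C - mu p $ 3)) * ((B - C) * (B - D) * (C - D))"
      unfolding k squares[OF p] that by algebra
    then show ?thesis using nz mult_right_cancel by blast
  qed
qed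

lemma X0_cases:
  assumes p: "p \<in> M" "X p = 0"
  shows "FF p < 0 \<longleftrightarrow> mu p $ 1 = B \<and> mu p $ 2 < B" "FF p = 0 \<longleftrightarrow> mu p $ 1 = B \<and> mu p $ 2 = B"
proof -
  note R = mu_ranges[OF p(1)] pos
  have b3: "B - mu p $ 3 > 0" using R by linarith
  consider "mu p $ 1 = B" "mu p $ 2 = B" | "mu p $ 1 = B" "mu p $ 2 < B" | "B < mu p $ 1" "mu p $ 2 = B"
    using XYZ_zero_iff(1)[OF p(1)] p(2) R by force
  then have "(FF p < 0 \<longleftrightarrow> mu p $ 1 = B \<and> mu p $ 2 < B) \<and> (FF p = 0 \<longleftrightarrow> mu p $ 1 = B \<and> mu p $ 2 = B)"
  proof cases
    case 1
    then show ?thesis using FF_mu(1)[OF p(1)] by simp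
  next
    case 2
    then have "(B - mu p $ 2) * (B - mu p $ 3) > 0" using b3 by simp
    then show ?thesis using FF_mu(1)[OF p(1) 2(1)] 2 by auto
  next
    case 3
    then have "(mu p $ 1 - B) * (B - mu p $ 3) > 0" using b3 by simp
    then show ?thesis using FF_mu(2)[OF p(1) 3(2)] 3 by auto
  qed
  then show "FF p < 0 \<longleftrightarrow> mu p $ 1 = B \<and> mu p $ 2 < B" "FF p = 0 \<longleftrightarrow> mu p $ 1 = B \<and> mu p $ 2 = B" by auto
qed

lemma Y0_cases:
  assumes p: "p \<in> M" "Y p = 0"
  shows "HH p < 0 \<longleftrightarrow> mu p $ 2 = C \<and> mu p $ 3 < C" "HH p = 0 \<longleftrightarrow> mu p $ 2 = C \<and> mu p $ 3 = C"
    "0 < HH p \<longleftrightarrow> C < mu p $ 2 \<and> mu p $ 3 = C"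
proof -
  note R = mu_ranges[OF p(1)] pos
  have b1: "mu p $ 1 - C > 0" using R by linarith
  consider "mu p $ 2 = C" "mu p $ 3 = C" | "mu p $ 2 = C" "mu p $ 3 < C" | "C < mu p $ 2" "mu p $ 3 = C"
    using XYZ_zero_iff(2)[OF p(1)] p(2) R by force
  then have "(HH p < 0 \<longleftrightarrow> mu p $ 2 = C \<and> mu p $ 3 < C) \<and> (HH p = 0 \<longleftrightarrow> mu p $ 2 = C \<and> mu p $ 3 = C)
     \<and> (0 < HH p \<longleftrightarrow> C < mu p $ 2 \<and> mu p $ 3 = C)"
  proof cases
    case 1
    then show ?thesis using HH_mu(1)[OF p(1)] by simp
  next
    case 2
    then have "(mu p $ 1 - C) * (C - mu p $ 3) > 0" using b1 by simp
    then show ?thesis using HH_mu(2)[OF p(1) 2(1)] 2 by auto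
  next
    case 3
    then have "(mu p $ 1 - C) * (mu p $ 2 - C) > 0" using b1 by simp
    then show ?thesis using HH_mu(1)[OF p(1) 3(2)] 3 by auto
  qed
  then show "HH p < 0 \<longleftrightarrow> mu p $ 2 = C \<and> mu p $ 3 < C" "HH p = 0 \<longleftrightarrow> mu p $ 2 = C \<and> mu p $ 3 = C"
    "0 < HH p \<longleftrightarrow> C < mu p $ 2 \<and> mu p $ 3 = C" by auto
qed

lemma P12_coord: "{p \<in> M. mu p $ 1 = mu p $ 2} = {p \<in> M. X p = 0 \<and> FF p = 0}"
  using P12_mu_eq XYZ_zero_iff(1) X0_cases(2) by blast

lemma P23_coord: "{p \<in> M. mu p $ 2 = mu p $ 3} = {p \<in> M. Y p = 0 \<and> HH p = 0}"
  using P23_mu_eq XYZ_zero_iff(2) Y0_cases(2) by blast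

lemma P23s_coord: "P23s s = {p \<in> M. Y p = 0 \<and> HH p = 0 \<and> 0 < s * Z p}"
  unfolding P23s_def using P23_coord by blast

lemma W23_coord: "{p \<in> M. mu p $ 2 = C \<and> mu p $ 3 < C} = {p \<in> M. Y p = 0 \<and> HH p < 0}"
  using XYZ_zero_iff(2) Y0_cases(1) by blast

lemma W23s_coord: "{p \<in> M. mu p $ 3 = C \<and> C < mu p $ 2 \<and> mu p $ 2 < mu p $ 1 \<and> 0 < s * Z p}
    = {p \<in> M. Y p = 0 \<and> 0 < HH p \<and> 0 < s * Z p \<and> \<not> (X p = 0 \<and> FF p = 0)}"
proof -
  have "(mu p $ 3 = C \<and> C < mu p $ 2 \<and> mu p $ 2 < mu p $ 1) \<longleftrightarrow> (Y p = 0 \<and> 0 < HH p \<and> \<not> (X p = 0 \<and> FF p = 0))"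
    if "p \<in> M" for p
  proof -
    have "mu p $ 2 < mu p $ 1 \<longleftrightarrow> mu p $ 1 \<noteq> mu p $ 2" using mu_ranges[OF that] by auto
    then show ?thesis using P12_coord XYZ_zero_iff(2)[OF that] Y0_cases(3)[OF that] that by blast
  qed
  then show ?thesis by blast
qed

lemma W12_coord: "{p \<in> M. mu p $ 1 = B \<and> mu p $ 2 < B \<and> mu p $ 3 < mu p $ 2}
    = {p \<in> M. X p = 0 \<and> FF p < 0 \<and> \<not> (Y p = 0 \<and> HH p = 0)}"
proof -
  have "(mu p $ 1 = B \<and> mu p $ 2 < B \<and> mu p $ 3 < mu p $ 2) \<longleftrightarrow> (X p = 0 \<and> FF p < 0 \<and> \<not> (Y p = 0 \<and> HH p = 0))"
    if "p \<in> M" for p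
  proof -
    have "mu p $ 3 < mu p $ 2 \<longleftrightarrow> mu p $ 2 \<noteq> mu p $ 3" using mu_ranges[OF that] by auto
    then show ?thesis using P23_coord XYZ_zero_iff(1)[OF that] X0_cases(1)[OF that] that by blast
  qed
  then show ?thesis by blast
qed

text \<open>The height of the upper branch of the focal hyperbola over X. Its radicand is positive
  everywhere, so both branches are smooth graphs.\<close>

definition zh :: "real \<Rightarrow> real" where "zh x = sqrt ((C - D) * (1 + x^2 / (B - C)))"

lemma zh_arg: "(C - D) * (1 + x^2 / (B - C)) > 0"
  using pos by (intro mult_pos_pos add_pos_nonneg) auto

lemma zh_pos: "zh x > 0" unfolding zh_def using zh_arg by simp

lemma smooth_on_zh [smooth_intros]: "smooth_on U x \<Longrightarrow> open U \<Longrightarrow> smooth_on U (\<lambda>s. zh (x s))"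
  unfolding zh_def using pos by (intro smooth_intros zh_arg) auto

lemma HH_zh: "HH p = (B - C) * ((Z p)^2 - (zh (X p))^2)"
proof -
  have "(zh (X p))^2 = (C - D) * (1 + (X p)^2 / (B - C))" unfolding zh_def using zh_arg[of "X p"] by simp
  then show ?thesis using pos by (simp add: HH_def field_simps)
qed

lemma abs_sz: "s = 1 \<or> s = -1 \<Longrightarrow> 0 < s * z \<Longrightarrow> z = s * \<bar>z\<bar>" for s z :: real by auto

lemma HH_zero: "HH p = 0 \<longleftrightarrow> \<bar>Z p\<bar> = zh (X p)" and HH_neg: "HH p < 0 \<longleftrightarrow> \<bar>Z p\<bar> < zh (X p)"
  and HH_pos: "0 < HH p \<longleftrightarrow> zh (X p) < \<bar>Z p\<bar>"
proof -
  have 1: "(Z p)^2 < (zh (X p))^2 \<longleftrightarrow> \<bar>Z p\<bar> < zh (X p)" "(zh (X p))^2 < (Z p)^2 \<longleftrightarrow> zh (X p) < \<bar>Z p\<bar>"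
    using zh_pos[of "X p"] abs_le_square_iff[of "Z p" "zh (X p)"] abs_le_square_iff[of "zh (X p)" "Z p"]
    by (simp_all flip: not_le)
  show 2: "HH p < 0 \<longleftrightarrow> \<bar>Z p\<bar> < zh (X p)" "0 < HH p \<longleftrightarrow> zh (X p) < \<bar>Z p\<bar>"
    unfolding HH_zh 1[symmetric] using pos by (simp_all add: mult_less_0_iff zero_less_mult_iff)
  then show "HH p = 0 \<longleftrightarrow> \<bar>Z p\<bar> = zh (X p)" by auto
qed

lemma P23s_param:
  assumes "s = 1 \<or> s = -1"
  shows "P23s s = range (\<lambda>x. Phi x 0 (s * zh x))"
proof (intro equalityI subsetI)
  fix p assume "p \<in> P23s s"
  then have p: "p \<in> M" "Y p = 0" "\<bar>Z p\<bar> = zh (X p)" "0 < s * Z p" unfolding P23s_coord using HH_zero by auto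
  then have "Z p = s * zh (X p)" using abs_sz[OF assms p(4)] by simp
  then have "p = Phi (X p) 0 (s * zh (X p))" using p by (intro M_eqI) auto
  then show "p \<in> range (\<lambda>x. Phi x 0 (s * zh x))" by blast
next
  fix p assume "p \<in> range (\<lambda>x. Phi x 0 (s * zh x))"
  then obtain x where "p = Phi x 0 (s * zh x)" by blast
  moreover have "\<bar>s * zh x\<bar> = zh x" "s * (s * zh x) > 0" using assms zh_pos[of x] by auto
  ultimately show "p \<in> P23s s" unfolding P23s_coord using HH_zero by auto
qed

lemma P23s_diffeomorphic:
  assumes "s = 1 \<or> s = -1"
  shows "diffeomorphic (P23s s) (UNIV :: real set)"
proof (rule diffeomorphicI)
  show "smooth_map_on (P23s s) X" by (rule smooth_map_onI[of UNIV]) (auto intro!: smooth_intros)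
  show "smooth_map_on UNIV (\<lambda>x. Phi x 0 (s * zh x))" by (rule smooth_map_onI[of UNIV]) (auto intro!: smooth_intros)
qed (auto simp: P23s_param[OF assms])

lemma connected_P23s:
  assumes "s = 1 \<or> s = -1"
  shows "connected (P23s s)" "P23s s \<noteq> {}"
proof -
  have "continuous_on UNIV (\<lambda>x. Phi x 0 (s * zh x))"
    by (rule smooth_on_continuous) (auto intro!: smooth_intros)
  then show "connected (P23s s)"
    unfolding P23s_param[OF assms] by (intro connected_continuous_image) auto
  show "P23s s \<noteq> {}" unfolding P23s_param[OF assms] by simp
qed

lemma P23s_regular:
  assumes "s = 1 \<or> s = -1"
  shows "regular_curve (P23s s)"
  unfolding regular_curve_def
  using connected_P23s[OF assms] P23s_diffeomorphic[OF assms] by (metis Int_UNIV_right UNIV_I open_UNIV)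

lemma P23_union: "{p \<in> M. mu p $ 2 = mu p $ 3} = P23s 1 \<union> P23s (-1)"
proof -
  have "Z p \<noteq> 0" if "p \<in> M" "mu p $ 2 = mu p $ 3" for p
    using XYZ_zero_iff(3)[OF that(1)] P23_mu_eq[OF that(1)] that(2) pos by auto
  then show ?thesis unfolding P23s_def by (auto simp: neq_iff)
qed

lemma components_P23: "components (P23s 1 \<union> P23s (-1)) = {P23s 1, P23s (-1)}"
  by (rule components_two_signs[where f = Z])
    (auto simp: connected_P23s, auto simp: P23s_def intro: continuous_intros)

lemma P12_param:
  "{p \<in> M. X p = 0 \<and> FF p = 0} = {Phi 0 (sqrt (B - C) * y) (sqrt (B - D) * z) |y z. y^2 + z^2 = 1}"
proof -
  have k: "FF (Phi x (sqrt (B - C) * y) (sqrt (B - D) * z)) = (y^2 + z^2 - 1) * ((B - C) * (B - D))" for x y z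
    using pos by (simp add: FF_def power_mult_distrib algebra_simps)
  have nz: "(B - C) * (B - D) \<noteq> 0" using pos by simp
  show ?thesis
  proof (intro equalityI subsetI)
    fix p assume p: "p \<in> {p \<in> M. X p = 0 \<and> FF p = 0}"
    define y z where "y = Y p / sqrt (B - C)" and "z = Z p / sqrt (B - D)"
    have e: "p = Phi 0 (sqrt (B - C) * y) (sqrt (B - D) * z)"
      using p pos by (intro M_eqI) (auto simp: y_def z_def)
    then have "y^2 + z^2 = 1" using p k[of 0 y z] nz by simp
    then show "p \<in> {Phi 0 (sqrt (B - C) * y) (sqrt (B - D) * z) |y z. y^2 + z^2 = 1}" using e by blast
  qed (auto simp: k)
qed

lemma P12_connected: "connected {p \<in> M. X p = 0 \<and> FF p = 0}" "{p \<in> M. X p = 0 \<and> FF p = 0} \<noteq> {}"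
proof -
  have "{p \<in> M. X p = 0 \<and> FF p = 0} = range (\<lambda>t. Phi 0 (sqrt (B - C) * cos t) (sqrt (B - D) * sin t))"
    unfolding P12_param
  proof (intro equalityI subsetI)
    fix p assume "p \<in> {Phi 0 (sqrt (B - C) * y) (sqrt (B - D) * z) |y z. y^2 + z^2 = 1}"
    then obtain y z where p: "p = Phi 0 (sqrt (B - C) * y) (sqrt (B - D) * z)" "y^2 + z^2 = 1" by blast
    then obtain t where "y = cos t" "z = sin t" using sincos_total_2pi by metis
    then show "p \<in> range (\<lambda>t. Phi 0 (sqrt (B - C) * cos t) (sqrt (B - D) * sin t))" using p by blast
  next
    fix p assume "p \<in> range (\<lambda>t. Phi 0 (sqrt (B - C) * cos t) (sqrt (B - D) * sin t))"
    then obtain t where "p = Phi 0 (sqrt (B - C) * cos t) (sqrt (B - D) * sin t)" by blast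
    then show "p \<in> {Phi 0 (sqrt (B - C) * y) (sqrt (B - D) * z) |y z. y^2 + z^2 = 1}"
      using sin_cos_squared_add2[of t] by blast
  qed
  moreover have "continuous_on UNIV (\<lambda>t. Phi 0 (sqrt (B - C) * cos t) (sqrt (B - D) * sin t))"
    by (intro continuous_intros)
  ultimately show "connected {p \<in> M. X p = 0 \<and> FF p = 0}" "{p \<in> M. X p = 0 \<and> FF p = 0} \<noteq> {}"
    using connected_continuous_image[OF _ connected_UNIV] by simp_all
qed

text \<open>Near a point of the ellipse, the ellipse is parametrized by the slope in a frame rotated to
  that point.\<close>

lemma P12_regular: "regular_curve {p \<in> M. X p = 0 \<and> FF p = 0}" (is "regular_curve ?P")
  unfolding regular_curve_def
proof (intro conjI ballI)
  show "?P \<noteq> {}" "connected ?P" using P12_connected by auto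
  fix p assume "p \<in> ?P"
  then obtain y0 z0 where p: "p = Phi 0 (sqrt (B - C) * y0) (sqrt (B - D) * z0)" "y0^2 + z0^2 = 1"
    unfolding P12_param by blast
  define f where "f q = Y q / sqrt (B - C)" for q
  define h where "h q = Z q / sqrt (B - D)" for q
  have fh: "f (Phi x (sqrt (B - C) * y) (sqrt (B - D) * z)) = y" "h (Phi x (sqrt (B - C) * y) (sqrt (B - D) * z)) = z" for x y z
    using pos by (auto simp: f_def h_def)
  have sf: "smooth_on U f" "smooth_on U h" if "open U" for U
    unfolding f_def h_def using that pos by (auto intro!: smooth_intros)
  define V where "V = {q. 0 < f q * y0 + h q * z0}"
  have "continuous_on UNIV (\<lambda>q. f q * y0 + h q * z0)"
    using sf[OF open_UNIV] by (intro continuous_intros smooth_on_continuous)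
  then have V: "open V" unfolding V_def by (intro open_Collect_less continuous_on_const)
  \<comment> \<open>In the frame \<open>(y0, z0)\<close>, \<open>(- z0, y0)\<close>,
    \<open>t\<close> is the tangent of the angle to the base point and
    \<open>1 / sqrt (1 + t^2)\<close> its cosine; \<open>V\<close> is where the cosine is
    positive.\<close>
  define g where "g t = Phi 0 (sqrt (B - C) * ((y0 - t * z0) / sqrt (1 + t^2)))
     (sqrt (B - D) * ((z0 + t * y0) / sqrt (1 + t^2)))" for t
  have t1: "1 + t^2 > 0" "sqrt (1 + t^2) \<noteq> 0" "(sqrt (1 + t^2))^2 = 1 + t^2" "1 + t^2 \<noteq> 0" for t :: real
    using add_pos_nonneg[OF zero_less_one zero_le_power2[of t]] by simp_all
  have fg: "f (g t) * y0 + h (g t) * z0 = 1 / sqrt (1 + t^2)"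
    "h (g t) * y0 - f (g t) * z0 = t / sqrt (1 + t^2)" for t
  proof -
    have n: "(y0 - t * z0) * y0 + (z0 + t * y0) * z0 = 1" "(z0 + t * y0) * y0 - (y0 - t * z0) * z0 = t"
      using p(2) by algebra+
    have e: "f (g t) = (y0 - t * z0) / sqrt (1 + t^2)" "h (g t) = (z0 + t * y0) / sqrt (1 + t^2)"
      unfolding g_def fh by auto
    have q: "u / r * y0 + w / r * z0 = (u * y0 + w * z0) / r" "u / r * y0 - w / r * z0 = (u * y0 - w * z0) / r" for u w r
      by (simp_all add: add_divide_distrib diff_divide_distrib)
    show "f (g t) * y0 + h (g t) * z0 = 1 / sqrt (1 + t^2)"
      "h (g t) * y0 - f (g t) * z0 = t / sqrt (1 + t^2)"
      unfolding e q n by (rule refl)+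
  qed
  have "diffeomorphic (?P \<inter> V) (UNIV :: real set)"
  proof (rule diffeomorphicI)
    show "smooth_map_on (?P \<inter> V) (\<lambda>q. (h q * y0 - f q * z0) / (f q * y0 + h q * z0))"
      by (rule smooth_map_onI[OF V]) (auto intro!: smooth_intros sf V, auto simp: V_def)
    show "smooth_map_on UNIV g"
      unfolding g_def by (rule smooth_map_onI[of UNIV]) (auto intro!: smooth_intros simp: t1)
    fix t :: real
    show "(h (g t) * y0 - f (g t) * z0) / (f (g t) * y0 + h (g t) * z0) = t"
      unfolding fg using t1[of t] by simp
    have "((y0 - t * z0) / sqrt (1 + t^2))^2 + ((z0 + t * y0) / sqrt (1 + t^2))^2
        = ((y0 - t * z0)^2 + (z0 + t * y0)^2) / (1 + t^2)"
      unfolding power_divide t1(3) by (rule add_divide_distrib[symmetric])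
    also have "(y0 - t * z0)^2 + (z0 + t * y0)^2 = 1 + t^2" using p(2) by algebra
    finally have "((y0 - t * z0) / sqrt (1 + t^2))^2 + ((z0 + t * y0) / sqrt (1 + t^2))^2 = 1"
      using t1(1)[of t] by simp
    then have "g t \<in> ?P" unfolding P12_param g_def by blast
    moreover have "g t \<in> V" unfolding V_def using fg(1)[of t] t1(1)[of t] by simp
    ultimately show "g t \<in> ?P \<inter> V" by blast
  next
    fix q assume q: "q \<in> ?P \<inter> V"
    then obtain y z where e: "q = Phi 0 (sqrt (B - C) * y) (sqrt (B - D) * z)" "y^2 + z^2 = 1"
      unfolding P12_param by blast
    define k where "k = y * y0 + z * z0"
    have k: "k > 0" using IntD2[OF q] unfolding V_def e(1) mem_Collect_eq fh k_def .
    define t where "t = (z * y0 - y * z0) / k"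
    have tk: "t * k = z * y0 - y * z0" using k by (simp add: t_def)
    have k2: "k^2 * (1 + t^2) = 1" using tk k_def e(2) p(2) by algebra
    have "sqrt (1 + t^2) = 1 / k"
    proof (rule real_sqrt_unique)
      show "(1 / k)^2 = 1 + t^2" using k k2 by (simp add: power_divide field_simps)
    qed (use k in simp)
    then have "(y0 - t * z0) / sqrt (1 + t^2) = y0 * k - t * k * z0" "(z0 + t * y0) / sqrt (1 + t^2) = z0 * k + t * k * y0"
      by (simp_all add: algebra_simps)
    moreover have "y0 * k - t * k * z0 = y" "z0 * k + t * k * y0 = z" using tk k_def p(2) by algebra+
    ultimately have "g t = q" unfolding g_def e(1) by simp
    moreover have "(h q * y0 - f q * z0) / (f q * y0 + h q * z0) = t" unfolding e(1) fh t_def k_def ..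
    ultimately show "g ((h q * y0 - f q * z0) / (f q * y0 + h q * z0)) = q" by simp
  qed auto
  moreover have "p \<in> V" unfolding V_def p(1) fh mem_Collect_eq using p(2) by (simp add: power2_eq_square)
  ultimately show "\<exists>V. open V \<and> p \<in> V \<and> diffeomorphic (?P \<inter> V) (UNIV :: real set)" using V by blast
qed

text \<open>Dividing Z by the height of the branch straightens the region between the branches into
  a strip.\<close>

lemma W23_band: "diffeomorphic {p \<in> M. Y p = 0 \<and> HH p < 0} ((UNIV :: real set) \<times> {0<..<1::real})"
proof (rule diffeomorphicI)
  show "smooth_map_on {p \<in> M. Y p = 0 \<and> HH p < 0} (\<lambda>p. (X p, (Z p / zh (X p) + 1) / 2))"
    using zh_pos by (intro smooth_map_onI[of UNIV]) (auto intro!: smooth_intros simp: less_imp_neq[symmetric])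
  show "smooth_map_on (UNIV \<times> {0<..<1}) (\<lambda>(x, t). Phi x 0 (zh x * (2 * t - 1)))"
    unfolding case_prod_unfold by (rule smooth_map_onI[of UNIV]) (auto intro!: smooth_intros)
  show "(X p, (Z p / zh (X p) + 1) / 2) \<in> UNIV \<times> {0<..<1}" if "p \<in> {p \<in> M. Y p = 0 \<and> HH p < 0}" for p
  proof -
    have "\<bar>Z p\<bar> < zh (X p)" using that HH_neg by auto
    then have "- zh (X p) < Z p" "Z p < zh (X p)" by auto
    then have "-1 < Z p / zh (X p)" "Z p / zh (X p) < 1"
      using zh_pos[of "X p"] by (simp_all add: pos_less_divide_eq pos_divide_less_eq)
    then show ?thesis by auto
  qed
  show "(case q of (x, t) \<Rightarrow> Phi x 0 (zh x * (2 * t - 1))) \<in> {p \<in> M. Y p = 0 \<and> HH p < 0}"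
    if q: "q \<in> UNIV \<times> {0<..<1}" for q
  proof -
    obtain x t where [simp]: "q = (x, t)" by (cases q)
    have "\<bar>2 * t - 1\<bar> < 1" using q by auto
    then have "\<bar>zh x * (2 * t - 1)\<bar> < zh x" using zh_pos[of x] by (simp add: abs_mult)
    then show ?thesis by (simp add: HH_neg)
  qed
  show "(case (X p, (Z p / zh (X p) + 1) / 2) of (x, t) \<Rightarrow> Phi x 0 (zh x * (2 * t - 1))) = p"
    if "p \<in> {p \<in> M. Y p = 0 \<and> HH p < 0}" for p
    using that zh_pos[of "X p"] by (intro M_eqI) (auto simp: field_simps)
  show "(\<lambda>p. (X p, (Z p / zh (X p) + 1) / 2)) (case q of (x, t) \<Rightarrow> Phi x 0 (zh x * (2 * t - 1))) = q" for q
    using zh_pos[of "fst q"] by (cases q) (simp add: field_simps)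
qed

text \<open>The region beyond a branch is mapped onto the plane by X and the logarithm of the height
  above the branch, with the removed point sent to the origin.\<close>

lemma W23s_disk:
  assumes s: "s = 1 \<or> s = -1"
  shows "diffeomorphic {p \<in> M. Y p = 0 \<and> 0 < HH p \<and> 0 < s * Z p \<and> \<not> (X p = 0 \<and> FF p = 0)}
    (ball (0::real^2) 1 - {0})" (is "diffeomorphic ?W _")
proof -
  have ss: "s * s = 1" using s by auto
  \<comment> \<open>The height of the removed point above the branch, taken as unit so that its
    logarithm is 0.\<close>
  define k where "k = sqrt (B - D) - zh 0"
  have z0: "zh 0 = sqrt (C - D)" by (simp add: zh_def)
  have k: "k > 0" using pos by (simp add: k_def z0)
  have W: "?W = {p \<in> M. Y p = 0 \<and> zh (X p) < s * Z p \<and> \<not> (X p = 0 \<and> s * Z p = sqrt (B - D))}"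
  proof -
    have "0 < HH p \<and> 0 < s * Z p \<longleftrightarrow> zh (X p) < s * Z p" for p
      using s zh_pos[of "X p"] unfolding HH_pos by (auto simp: abs_if split: if_splits)
    moreover have "FF p = 0 \<longleftrightarrow> s * Z p = sqrt (B - D)" if "Y p = 0" "0 < s * Z p" for p
    proof -
      have "FF p = 0 \<longleftrightarrow> (Z p)^2 * (B - C) = (B - D) * (B - C)" using that by (simp add: FF_def mult.commute)
      also have "\<dots> \<longleftrightarrow> (s * Z p)^2 = B - D" using pos s by (auto simp: power_mult_distrib)
      also have "\<dots> \<longleftrightarrow> s * Z p = sqrt (B - D)"
        using that(2) pos by (metis less_imp_le real_sqrt_pow2 real_sqrt_unique)
      finally show ?thesis .
    qed
    ultimately show ?thesis by blast
  qed
  have "diffeomorphic ?W (UNIV - {0::real^2})"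
    unfolding W
  proof (rule diffeomorphicI)
    let ?U = "{p. zh (X p) < s * Z p}"
    have "continuous_on UNIV (\<lambda>p. zh (X p))" "continuous_on UNIV (\<lambda>p. s * Z p)"
      by (intro smooth_on_continuous smooth_intros open_UNIV)+
    then have U: "open ?U" by (rule open_Collect_less)
    show "smooth_map_on {p \<in> M. Y p = 0 \<and> zh (X p) < s * Z p \<and> \<not> (X p = 0 \<and> s * Z p = sqrt (B - D))}
        (\<lambda>p. vector [X p, ln ((s * Z p - zh (X p)) / k)] :: real^2)"
      by (rule smooth_map_onI[OF U]) (use U k in \<open>auto intro!: smooth_intros\<close>)
    show "smooth_map_on (UNIV - {0}) (\<lambda>v::real^2. Phi (v$1) 0 (s * (zh (v$1) + k * exp (v$2))))"
      by (rule smooth_map_onI[of UNIV]) (auto intro!: smooth_intros)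
    show "(vector [X p, ln ((s * Z p - zh (X p)) / k)] :: real^2) \<in> UNIV - {0}"
      if "p \<in> {p \<in> M. Y p = 0 \<and> zh (X p) < s * Z p \<and> \<not> (X p = 0 \<and> s * Z p = sqrt (B - D))}" for p
    proof -
      have "(s * Z p - zh 0) / k \<noteq> 1 \<or> X p \<noteq> 0" using that k by (auto simp: k_def)
      then have "X p \<noteq> 0 \<or> ln ((s * Z p - zh (X p)) / k) \<noteq> 0" using that k by auto
      then show ?thesis by (auto simp: vec_eq_iff forall_2)
    qed
    show "Phi (v$1) 0 (s * (zh (v$1) + k * exp (v$2))) \<in>
        {p \<in> M. Y p = 0 \<and> zh (X p) < s * Z p \<and> \<not> (X p = 0 \<and> s * Z p = sqrt (B - D))}"
      if "v \<in> UNIV - {0}" for v :: "real^2"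
    proof -
      have v: "v$1 \<noteq> 0 \<or> v$2 \<noteq> 0" using that by (auto simp: vec_eq_iff forall_2)
      have e: "s * Z (Phi (v$1) 0 (s * (zh (v$1) + k * exp (v$2)))) = zh (v$1) + k * exp (v$2)"
        using s by auto
      have "0 < k * exp (v$2)" using k by simp
      moreover have "v$1 = 0 \<Longrightarrow> zh (v$1) + k * exp (v$2) \<noteq> sqrt (B - D)"
      proof
        assume "v$1 = 0" "zh (v$1) + k * exp (v$2) = sqrt (B - D)"
        moreover have "sqrt (B - D) = zh 0 + k" by (simp add: k_def)
        ultimately have "k * exp (v$2) = k * 1" by simp
        then have "v$2 = 0" using k by simp
        then show False using v \<open>v$1 = 0\<close> by simp
      qed
      ultimately show ?thesis unfolding mem_Collect_eq e by auto
    qed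
    show "Phi ((vector [X p, ln ((s * Z p - zh (X p)) / k)] :: real^2)$1) 0
        (s * (zh ((vector [X p, ln ((s * Z p - zh (X p)) / k)] :: real^2)$1) + k * exp ((vector [X p, ln ((s * Z p - zh (X p)) / k)] :: real^2)$2))) = p"
      if "p \<in> {p \<in> M. Y p = 0 \<and> zh (X p) < s * Z p \<and> \<not> (X p = 0 \<and> s * Z p = sqrt (B - D))}" for p
    proof -
      have "s * (s * Z p) = Z p" using ss by (simp flip: mult.assoc)
      then show ?thesis using that k by (intro M_eqI) auto
    qed
    show "(vector [X (Phi (v$1) 0 (s * (zh (v$1) + k * exp (v$2)))),
        ln ((s * Z (Phi (v$1) 0 (s * (zh (v$1) + k * exp (v$2)))) - zh (X (Phi (v$1) 0 (s * (zh (v$1) + k * exp (v$2)))))) / k)] :: real^2) = v" for v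
    proof -
      show ?thesis using s k by (auto simp: vec_eq_iff forall_2)
    qed
  qed
  then show ?thesis using diffeomorphic_punctured_plane_disk diffeomorphic_trans by blast
qed

text \<open>The points of the Z-axis beyond the removed one belong to the surface.\<close>

lemma W23s_unbounded:
  assumes s: "s = 1 \<or> s = -1"
  shows "\<not> bounded {p \<in> M. Y p = 0 \<and> 0 < HH p \<and> 0 < s * Z p \<and> \<not> (X p = 0 \<and> FF p = 0)}" (is "\<not> bounded ?W")
proof
  assume "bounded ?W"
  then have "bounded (Z ` ?W)" by (rule bounded_linear_image[OF _ bounded_linear_XYZ(3)])
  then obtain K where K: "\<And>p. p \<in> ?W \<Longrightarrow> \<bar>Z p\<bar> \<le> K" unfolding bounded_iff by auto
  define t where "t = \<bar>K\<bar> + sqrt (B - D) + 1"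
  have sp: "sqrt (C - D) < sqrt (B - D)" "0 < sqrt (B - D)" using pos by auto
  have t: "t > 0" "t > sqrt (B - D)" "t > K" "t > sqrt (C - D)" using sp unfolding t_def by linarith+
  have st: "\<bar>s * t\<bar> = t" "s * (s * t) = t" "(s * t)^2 = t^2" using s t(1) by auto
  have "(sqrt (B - D))^2 < t^2" using t sp by (intro power_strict_mono) auto
  then have "B - D < t^2" using pos by simp
  then have "(B - D) * (B - C) < t^2 * (B - C)" using pos by simp
  then have "FF (Phi 0 0 (s * t)) \<noteq> 0" using s by (auto simp: FF_def algebra_simps)
  then have "Phi 0 0 (s * t) \<in> ?W" using s t st by (auto simp: HH_pos zh_def)
  from K[OF this] show False using st t by simp
qed

lemma W12_disk: "\<exists>p\<in>ball 0 1. \<exists>q\<in>ball 0 1. p \<noteq> q \<and>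
    diffeomorphic {p \<in> M. X p = 0 \<and> FF p < 0 \<and> \<not> (Y p = 0 \<and> HH p = 0)} (ball (0::real^2) 1 - {p, q})"
proof -
  \<comment> \<open>The hyperbola crosses X = 0 at heights \<open>sqrt (C - D)\<close> of both
    signs; dividing by the semi-axis of the ellipse places these points in the unit disk.\<close>
  define k where "k = sqrt (C - D) / sqrt (B - D)"
  have k: "0 < k" "k < 1" using pos by (auto simp: k_def)
  define p0 p1 where "p0 = (vector [0, k] :: real^2)" and "p1 = (vector [0, - k] :: real^2)"
  have nr: "v \<in> ball 0 1 \<longleftrightarrow> (v$1)^2 + (v$2)^2 < 1" for v :: "real^2"
    by (simp add: norm_vec_def L2_set_def sum_2)
  have "p0 \<in> ball 0 1" "p1 \<in> ball 0 1" unfolding nr p0_def p1_def using k by (auto simp: abs_square_less_1)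
  moreover have "p0 \<noteq> p1" using k by (simp add: p0_def p1_def vec_eq_iff forall_2)
  moreover have "diffeomorphic {p \<in> M. X p = 0 \<and> FF p < 0 \<and> \<not> (Y p = 0 \<and> HH p = 0)} (ball (0::real^2) 1 - {p0, p1})"
  proof -
    define f where "f p = (vector [Y p / sqrt (B - C), Z p / sqrt (B - D)] :: real^2)" for p
    define g where "g v = Phi 0 (sqrt (B - C) * v$1) (sqrt (B - D) * v$2)" for v :: "real^2"
    have fg: "f (g v) = v" for v using pos by (simp add: f_def g_def vec_eq_iff forall_2)
    have gf: "g (f p) = p" if "p \<in> M" "X p = 0" for p
      using that pos by (intro M_eqI) (auto simp: f_def g_def)
    have in1: "FF (g v) < 0 \<longleftrightarrow> v \<in> ball 0 1" for v
    proof -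
      have "FF (g v) = ((v$1)^2 + (v$2)^2 - 1) * ((B - C) * (B - D))"
        using pos by (simp add: FF_def g_def power_mult_distrib algebra_simps)
      then show ?thesis unfolding nr using pos by (simp add: mult_less_0_iff)
    qed
    have in2: "(Y (g v) = 0 \<and> HH (g v) = 0) \<longleftrightarrow> v \<in> {p0, p1}" for v
    proof -
      have "\<bar>sqrt (B - D) * v$2\<bar> = sqrt (C - D) \<longleftrightarrow> \<bar>v$2\<bar> = k"
        using pos by (auto simp: k_def abs_mult field_simps)
      then have "(Y (g v) = 0 \<and> HH (g v) = 0) \<longleftrightarrow> v$1 = 0 \<and> \<bar>v$2\<bar> = k"
        using pos by (simp add: g_def HH_zero zh_def)
      then show ?thesis using k by (auto simp: p0_def p1_def vec_eq_iff forall_2 abs_if)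
    qed
    show ?thesis
    proof (rule diffeomorphicI)
      show "smooth_map_on {p \<in> M. X p = 0 \<and> FF p < 0 \<and> \<not> (Y p = 0 \<and> HH p = 0)} f"
        unfolding f_def using pos by (intro smooth_map_onI[of UNIV]) (auto intro!: smooth_intros)
      show "smooth_map_on (ball 0 1 - {p0, p1}) g"
        unfolding g_def by (rule smooth_map_onI[of UNIV]) (auto intro!: smooth_intros)
      show "g v \<in> {p \<in> M. X p = 0 \<and> FF p < 0 \<and> \<not> (Y p = 0 \<and> HH p = 0)}" if "v \<in> ball 0 1 - {p0, p1}" for v
      proof -
        have "g v \<in> M" "X (g v) = 0" by (simp_all add: g_def)
        then show ?thesis using that in1[of v] in2[of v] by blast
      qed
      show "f p \<in> ball 0 1 - {p0, p1}" if "p \<in> {p \<in> M. X p = 0 \<and> FF p < 0 \<and> \<not> (Y p = 0 \<and> HH p = 0)}" for p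
        using that in1[of "f p"] in2[of "f p"] gf[of p] by auto
    qed (auto simp: fg gf)
  qed
  ultimately show ?thesis by blast
qed

text \<open>The surfaces lie in the planes Y = 0 and X = 0, so they meet on the Z-axis. The strict
  bounds by hyperbola and ellipse exclude the removed points by themselves.\<close>

lemma W_inter:
  assumes s: "s = 1 \<or> s = -1"
  shows "{p \<in> M. Y p = 0 \<and> 0 < HH p \<and> 0 < s * Z p \<and> \<not> (X p = 0 \<and> FF p = 0)} \<inter>
     {p \<in> M. X p = 0 \<and> FF p < 0 \<and> \<not> (Y p = 0 \<and> HH p = 0)} =
     {p \<in> M. X p = 0 \<and> Y p = 0 \<and> sqrt (C - D) < s * Z p \<and> s * Z p < sqrt (B - D)}" (is "?L = ?R")
proof -
  have h: "0 < HH p \<and> 0 < s * Z p \<longleftrightarrow> sqrt (C - D) < s * Z p" if "X p = 0" for p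
  proof -
    obtain k where k: "k = sqrt (C - D)" "0 < k" using pos by auto
    then have "zh 0 = k" by (simp add: zh_def)
    then show ?thesis using s k unfolding HH_pos that k(1)[symmetric] by (auto simp: abs_if split: if_splits)
  qed
  have f: "FF p < 0 \<longleftrightarrow> s * Z p < sqrt (B - D)" if "Y p = 0" "0 < s * Z p" for p
  proof -
    have "FF p = ((s * Z p)^2 - (sqrt (B - D))^2) * (B - C)"
      using that s pos by (auto simp: FF_def algebra_simps)
    then have "FF p < 0 \<longleftrightarrow> (s * Z p)^2 < (sqrt (B - D))^2" using pos by (simp add: mult_less_0_iff)
    also have "\<dots> \<longleftrightarrow> s * Z p < sqrt (B - D)"
      using that(2) pos by (metis diff_gt_0_iff_gt less_imp_le power2_less_imp_less power_strict_mono real_sqrt_ge_zero zero_less_numeral)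
    finally show ?thesis .
  qed
  have c0: "0 < sqrt (C - D)" using pos by simp
  show ?thesis
  proof (intro equalityI subsetI)
    fix p assume p: "p \<in> ?L"
    then show "p \<in> ?R" using h[of p] f[of p] by blast
  next
    fix p assume p: "p \<in> ?R"
    then have "sqrt (C - D) < s * Z p" by blast
    with c0 have "0 < s * Z p" by (rule less_trans)
    then show "p \<in> ?L" using h[of p] f[of p] p by auto
  qed
qed

lemma W_inter_diffeomorphic:
  assumes s: "s = 1 \<or> s = -1"
  shows "diffeomorphic {p \<in> M. X p = 0 \<and> Y p = 0 \<and> sqrt (C - D) < s * Z p \<and> s * Z p < sqrt (B - D)} (UNIV :: real set)"
    (is "diffeomorphic ?W _")
proof -
  have ss: "s * (s * t) = t" for t using s by auto
  have "diffeomorphic ?W {sqrt (C - D)<..<sqrt (B - D)}"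
  proof (rule diffeomorphicI)
    show "smooth_map_on ?W (\<lambda>p. s * Z p)" by (rule smooth_map_onI[of UNIV]) (auto intro!: smooth_intros)
    show "smooth_map_on {sqrt (C - D)<..<sqrt (B - D)} (\<lambda>t. Phi 0 0 (s * t))"
      by (rule smooth_map_onI[of UNIV]) (auto intro!: smooth_intros)
    show "Phi 0 0 (s * (s * Z p)) = p" if "p \<in> ?W" for p
      using that ss by (intro M_eqI) auto
  qed (auto simp: ss)
  moreover have "sqrt (C - D) < sqrt (B - D)" using pos by simp
  ultimately show ?thesis using diffeomorphic_interval_UNIV diffeomorphic_trans by blast
qed

section \<open>Transversality and the boundary of the band\<close>

lemma tangent_space_mono: "S \<subseteq> T \<Longrightarrow> tangent_space S p \<subseteq> tangent_space T p"
  unfolding tangent_space_def using eventually_mono[of _ "nhds 0"] by (smt (verit) mem_Collect_eq subset_iff)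

lemma continuous_on_FF_HH:
  "continuous_on UNIV f \<Longrightarrow> continuous_on UNIV (\<lambda>s::real. FF (f s))"
  "continuous_on UNIV f \<Longrightarrow> continuous_on UNIV (\<lambda>s::real. HH (f s))"
  unfolding FF_def HH_def by (intro continuous_intros; assumption)+

lemma tangent_vector_curve:
  fixes x y z :: real
  assumes S: "\<forall>\<^sub>F t in nhds (0::real). Phi (x0 + t * x) (y0 + t * y) (z0 + t * z) \<in> S"
  obtains v where "v \<in> tangent_space S (Phi x0 y0 z0)" "X v = x" "Y v = y" "Z v = z"
proof -
  let ?g = "\<lambda>t. Phi (x0 + t * x) (y0 + t * y) (z0 + t * z)"
  have "smooth_on UNIV ?g" by (intro smooth_intros open_UNIV)
  then have d: "(?g has_vector_derivative vector_derivative ?g (at 0)) (at 0)"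
    by (rule smooth_on_has_vector_derivative) simp
  have D: "((\<lambda>t. x0 + t * x) has_real_derivative x) (at 0)" for x0 x :: real
    by (auto intro!: derivative_eq_intros)
  have "vector_derivative ?g (at 0) \<in> tangent_space S (Phi x0 y0 z0)"
    unfolding tangent_space_def using S d by (intro CollectI exI[of _ ?g]) auto
  moreover have "X (vector_derivative ?g (at 0)) = x" "Y (vector_derivative ?g (at 0)) = y" "Z (vector_derivative ?g (at 0)) = z"
    by (rule DERIV_unique[OF _ D]; use has_real_derivative_XYZ[OF d] in simp)+
  ultimately show ?thesis using that by blast
qed

lemma eventually_nhds_pos:
  assumes "continuous_on UNIV f" "f (0::real) > (0::real)"
  shows "\<forall>\<^sub>F t in nhds 0. f t > 0"
proof -
  have "open {t. 0 < f t}" using assms(1) by (intro open_Collect_less continuous_on_const)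
  then show ?thesis using assms(2) unfolding eventually_nhds by blast
qed

text \<open>Near a common point all conditions besides Y = 0 or X = 0 follow from strict
  inequalities, so each surface is locally a full coordinate plane, and the two planes span.\<close>

lemma W_transversal:
  assumes s: "s = 1 \<or> s = -1"
  shows "transversal_in M {p \<in> M. Y p = 0 \<and> 0 < HH p \<and> 0 < s * Z p \<and> \<not> (X p = 0 \<and> FF p = 0)}
     {p \<in> M. X p = 0 \<and> FF p < 0 \<and> \<not> (Y p = 0 \<and> HH p = 0)}" (is "transversal_in M ?W1 ?W2")
  unfolding transversal_in_def
proof
  fix p assume p: "p \<in> ?W1 \<inter> ?W2"
  then have pM: "p \<in> M" and XY: "X p = 0" "Y p = 0" and ineq: "0 < HH p" "0 < s * Z p" "FF p < 0" by auto
  have pe: "p = Phi 0 0 (Z p)" using pM XY by (intro M_eqI) auto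
  have T: "tangent_space M p = {v. v \<bullet> G p = 0}" by (rule tangent_space_M[OF pM])
  have sub: "tangent_space ?W1 p \<subseteq> {v. v \<bullet> G p = 0}" "tangent_space ?W2 p \<subseteq> {v. v \<bullet> G p = 0}"
    unfolding T[symmetric] by (rule tangent_space_mono; blast)+
  show "{v + w |v w. v \<in> tangent_space ?W1 p \<and> w \<in> tangent_space ?W2 p} = tangent_space M p"
    unfolding T
  proof (intro equalityI subsetI)
    fix u assume "u \<in> {v + w |v w. v \<in> tangent_space ?W1 p \<and> w \<in> tangent_space ?W2 p}"
    then obtain v w where "u = v + w" "v \<bullet> G p = 0" "w \<bullet> G p = 0" using sub by blast
    then show "u \<in> {v. v \<bullet> G p = 0}" by (simp add: inner_add_left)
  next
    fix u assume u: "u \<in> {v. v \<bullet> G p = 0}"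
    \<comment> \<open>In linear coordinates \<open>u\<close> splits into (X u, 0, Z u) along the
      first surface and (0, Y u, 0) along the second.\<close>
    let ?g = "\<lambda>t. Phi (0 + t * X u) (0 + t * 0) (Z p + t * Z u)"
    let ?h = "\<lambda>t. Phi (0 + t * 0) (0 + t * Y u) (Z p + t * 0)"
    have g: "continuous_on UNIV ?g" and h: "continuous_on UNIV ?h" by (intro continuous_intros)+
    have g0: "?g 0 = p" "?h 0 = p" using pe by simp_all
    have "\<forall>\<^sub>F t in nhds 0. HH (?g t) > 0"
    proof (rule eventually_nhds_pos)
      show "continuous_on UNIV (\<lambda>t. HH (?g t))" by (rule continuous_on_FF_HH(2)[OF g])
      show "HH (?g 0) > 0" unfolding g0 by (rule ineq)
    qed
    moreover have "\<forall>\<^sub>F t in nhds 0. - FF (?g t) > 0"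
    proof (rule eventually_nhds_pos)
      show "continuous_on UNIV (\<lambda>t. - FF (?g t))" by (intro continuous_on_minus continuous_on_FF_HH(1)[OF g])
      show "- FF (?g 0) > 0" unfolding g0 using ineq by simp
    qed
    moreover have "\<forall>\<^sub>F t in nhds 0. s * Z (?g t) > 0"
    proof (rule eventually_nhds_pos)
      show "continuous_on UNIV (\<lambda>t. s * Z (?g t))" by (intro continuous_intros)
      show "s * Z (?g 0) > 0" unfolding g0 by (rule ineq)
    qed
    ultimately have "\<forall>\<^sub>F t in nhds 0. ?g t \<in> ?W1" by eventually_elim auto
    then obtain v where v: "v \<in> tangent_space ?W1 (Phi 0 0 (Z p))" "X v = X u" "Y v = 0" "Z v = Z u"
      by (rule tangent_vector_curve)
    have "\<forall>\<^sub>F t in nhds 0. HH (?h t) > 0"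
    proof (rule eventually_nhds_pos)
      show "continuous_on UNIV (\<lambda>t. HH (?h t))" by (rule continuous_on_FF_HH(2)[OF h])
      show "HH (?h 0) > 0" unfolding g0 by (rule ineq)
    qed
    moreover have "\<forall>\<^sub>F t in nhds 0. - FF (?h t) > 0"
    proof (rule eventually_nhds_pos)
      show "continuous_on UNIV (\<lambda>t. - FF (?h t))" by (intro continuous_on_minus continuous_on_FF_HH(1)[OF h])
      show "- FF (?h 0) > 0" unfolding g0 using ineq by simp
    qed
    ultimately have "\<forall>\<^sub>F t in nhds 0. ?h t \<in> ?W2" by eventually_elim auto
    then obtain w where w: "w \<in> tangent_space ?W2 (Phi 0 0 (Z p))" "X w = 0" "Y w = Y u" "Z w = 0"
      by (rule tangent_vector_curve)
    have vw: "v \<in> tangent_space ?W1 p" "w \<in> tangent_space ?W2 p" using v(1) w(1) unfolding pe[symmetric] .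
    have "v \<bullet> G p = 0" "w \<bullet> G p = 0" using vw sub by blast+
    then have "(v + w - u) \<bullet> G p = 0" using u by (simp add: inner_add_left inner_diff_left)
    moreover have "X (v + w - u) = 0" "Y (v + w - u) = 0" "Z (v + w - u) = 0"
      using v w by (simp_all add: linear_diff[OF linear_XYZ(1)] linear_diff[OF linear_XYZ(2)] linear_diff[OF linear_XYZ(3)]
          linear_add[OF linear_XYZ(1)] linear_add[OF linear_XYZ(2)] linear_add[OF linear_XYZ(3)])
    ultimately have "v + w - u = 0" by (rule tangent_zero[OF pM])
    then have "u = v + w" by simp
    then show "u \<in> {v + w |v w. v \<in> tangent_space ?W1 p \<and> w \<in> tangent_space ?W2 p}" using vw by blast
  qed
qed

text \<open>On the quadric the open condition on the sign of the first coordinate is equivalent to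
  the closed condition \<open>a \<le> \<sigma> * p$1\<close>.\<close>

lemma closed_M: "closed M"
proof -
  have "M = {p. Q3_form a b c d p - 1 = 0} \<inter> {p. a \<le> \<sigma> * p$1}"
  proof (intro equalityI subsetI IntI)
    fix p assume p: "p \<in> M"
    then show "p \<in> {p. Q3_form a b c d p - 1 = 0}" using M_iff by (simp add: Q3_def)
    have "p$1 ^ 2 = a^2 * (1 + (p$2/b)^2 + (p$3/c)^2 + (p$4/d)^2)" using p M_iff Q3_eq by blast
    also have "\<dots> \<ge> a^2 * 1" by (intro mult_left_mono) auto
    finally have "a^2 \<le> (\<sigma> * p$1)^2" using s1 by (auto simp: power_mult_distrib)
    moreover have "0 < \<sigma> * p$1" using p unfolding M_iff by blast
    ultimately show "p \<in> {p. a \<le> \<sigma> * p$1}" using power2_le_imp_le[of a "\<sigma> * p$1"] by simp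
  next
    fix p assume "p \<in> {p. Q3_form a b c d p - 1 = 0} \<inter> {p. a \<le> \<sigma> * p$1}"
    then show "p \<in> M" unfolding M_iff using a0 by (simp add: Q3_def)
  qed
  moreover have "closed {p. Q3_form a b c d p - 1 = 0}"
    unfolding Q3_form_def by (intro closed_Collect_eq continuous_intros) (use a0 pos0 d0 in auto)
  moreover have "closed {p::real^4. a \<le> \<sigma> * p$1}" by (intro closed_Collect_le continuous_intros)
  ultimately show ?thesis by (metis closed_Int)
qed

text \<open>Limit points satisfy \<open>HH p \<le> 0\<close>. Conversely each point of the hyperbola
  is reached from inside the strip by letting the factor of Z grow to 1 at fixed X.\<close>

lemma W23_boundary:
  "(top_of_set (Q3 a b c d)) closure_of {p \<in> M. Y p = 0 \<and> HH p < 0} - {p \<in> M. Y p = 0 \<and> HH p < 0}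
    = {p \<in> M. Y p = 0 \<and> HH p = 0}" (is "_ closure_of ?W - _ = _")
proof -
  have MQ: "M \<subseteq> Q3 a b c d" using M_iff by blast
  have cHH: "continuous_on UNIV HH" "continuous_on UNIV Y"
    unfolding HH_def by (intro continuous_intros)+
  have "closed (M \<inter> ({p. Y p = 0} \<inter> {p. HH p \<le> 0}))"
    by (intro closed_Int closed_M closed_Collect_eq closed_Collect_le continuous_on_const cHH)
  then have sub: "closure ?W \<subseteq> M \<inter> ({p. Y p = 0} \<inter> {p. HH p \<le> 0})"
    by (intro closure_minimal) auto
  have sup: "p \<in> closure ?W" if p: "p \<in> M" "Y p = 0" "HH p = 0" for p
  proof -
    let ?g = "\<lambda>t. Phi (X p) 0 (t * Z p)"
    have "continuous_on {0..1} ?g" by (intro continuous_intros)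
    then have "(?g \<longlongrightarrow> ?g 1) (at 1 within {0..1})" unfolding continuous_on_def by (rule bspec) simp
    then have l: "(?g \<longlongrightarrow> p) (at_left 1)"
      using p Phi_XYZ[OF p(1)] by (simp add: at_within_Icc_at_left)
    have "\<forall>\<^sub>F t in at_left 1. t \<in> {0<..<1::real}" using eventually_at_left_real[of 0 1] by simp
    then have "\<forall>\<^sub>F t in at_left 1. ?g t \<in> closure ?W"
    proof eventually_elim
      case (elim t)
      have "\<bar>t * Z p\<bar> < zh (X p)"
        using elim zh_pos[of "X p"] p(3) unfolding HH_zero by (simp add: abs_mult)
      then have "?g t \<in> ?W" by (simp add: HH_neg)
      then show ?case by (rule subsetD[OF closure_subset])
    qed
    then show ?thesis by (rule Lim_in_closed_set[OF closed_closure _ trivial_limit_at_left_real l])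
  qed
  have "(top_of_set (Q3 a b c d)) closure_of ?W = Q3 a b c d \<inter> closure ?W"
    using MQ by (simp add: closure_of_subtopology inf_absorb2 Collect_mono_iff subset_iff Int_absorb1)
  then show ?thesis using sub sup MQ by force
qed

lemma connected_M: "connected M" "M \<noteq> {}"
proof -
  have "M = (\<lambda>t::real \<times> real \<times> real. Phi (fst t) (fst (snd t)) (snd (snd t))) ` UNIV"
  proof (intro equalityI subsetI)
    fix p assume "p \<in> M"
    then have "p = (\<lambda>t::real \<times> real \<times> real. Phi (fst t) (fst (snd t)) (snd (snd t))) (X p, Y p, Z p)"
      using Phi_XYZ by simp
    then show "p \<in> (\<lambda>t::real \<times> real \<times> real. Phi (fst t) (fst (snd t)) (snd (snd t))) ` UNIV" by blast
  qed auto
  moreover have "continuous_on UNIV (\<lambda>t::real \<times> real \<times> real. Phi (fst t) (fst (snd t)) (snd (snd t)))"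
    by (intro continuous_intros)
  ultimately show "connected M" using connected_continuous_image[OF _ connected_UNIV] by simp
  show "M \<noteq> {}" using Phi_in_M by blast
qed

end

subsection \<open>The partially umbilic curves of type D1\<close>

text \<open>The root that vanishes with \<open>Q\<close>, rationalized so that \<open>\<nu>\<close>
  is never a divisor; the positive sign of \<open>\<nu> * y + P\<close> tells it from any other
  root.\<close>

lemma quadratic_branch:
  fixes \<nu> P Q :: real
  assumes P: "P > 0" and disc: "P^2 - \<nu> * Q > 0"
  defines "h \<equiv> - Q / (P + sqrt (P^2 - \<nu> * Q))"
  shows "\<nu> * h + P = sqrt (P^2 - \<nu> * Q)" "\<nu> * h^2 + 2 * P * h + Q = 0"
    "\<nu> * y^2 + 2 * P * y + Q = 0 \<Longrightarrow> \<nu> * y + P > 0 \<Longrightarrow> y = h"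
proof -
  define R where "R = sqrt (P^2 - \<nu> * Q)"
  have R: "R > 0" "R^2 = P^2 - \<nu> * Q" using disc by (auto simp: R_def)
  have h: "h * (P + R) = - Q" using P R unfolding h_def R_def[symmetric] by simp
  have "(\<nu> * h + P) * (P + R) = R * (P + R)" using h R(2) by algebra
  then show 1: "\<nu> * h + P = sqrt (P^2 - \<nu> * Q)" using P R unfolding R_def[symmetric] by simp
  have "h * (P + (\<nu> * h + P)) = - Q" using 1 h unfolding R_def[symmetric] by simp
  then show "\<nu> * h^2 + 2 * P * h + Q = 0" by (simp add: algebra_simps power2_eq_square)
  assume y: "\<nu> * y^2 + 2 * P * y + Q = 0" "\<nu> * y + P > 0"
  have "(\<nu> * y + P)^2 = R^2" using y(1) R(2) by algebra
  then have "\<nu> * y + P = R" using y(2) R(1) by (simp add: power2_eq_iff)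
  moreover have "y * (P + (\<nu> * y + P)) = - Q" using y(1) by (simp add: algebra_simps power2_eq_square)
  ultimately have "y * (P + R) = h * (P + R)" using h by simp
  then show "y = h" using P R by simp
qed

lemma derivative_of_zero:
  fixes F :: "real \<Rightarrow> real"
  assumes "open J" "s \<in> J" "\<And>t. t \<in> J \<Longrightarrow> F t = 0" "(F has_real_derivative D) (at s)"
  shows "D = 0"
proof -
  have "((\<lambda>_. 0) has_real_derivative D) (at s)"
    using has_field_derivative_transform_within_open[OF assms(4,1,2)] assms(3) by simp
  then show ?thesis using DERIV_unique DERIV_const by blast
qed

lemma smooth_on_dir_deriv: "smooth_on U f \<Longrightarrow> smooth_on U (dir_deriv v f)"
  unfolding smooth_on_def by (metis Ck_on.simps(2))

lemma dir_deriv_line: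
  fixes f :: "'a::euclidean_space \<Rightarrow> real"
  assumes "smooth_on U f" "s *\<^sub>R v \<in> U"
  shows "((\<lambda>t. f (t *\<^sub>R v)) has_real_derivative dir_deriv v f (s *\<^sub>R v)) (at s)"
proof -
  have "Ck_on (Suc 0) U f" using assms(1) unfolding smooth_on_def by blast
  then have f': "(f has_derivative (\<lambda>u. dir_deriv u f (s *\<^sub>R v))) (at (s *\<^sub>R v))"
    using Ck_on_SucD(1) assms(2) by blast
  have "((\<lambda>t. t *\<^sub>R v) has_derivative (\<lambda>t. t *\<^sub>R v)) (at s)"
    by (auto intro!: derivative_eq_intros)
  from has_derivative_compose[OF this f']
  have "((\<lambda>t. f (t *\<^sub>R v)) has_derivative (\<lambda>t. dir_deriv (t *\<^sub>R v) f (s *\<^sub>R v))) (at s)" .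
  moreover have "dir_deriv (t *\<^sub>R v) f (s *\<^sub>R v) = dir_deriv v f (s *\<^sub>R v) * t" for t
    using linear_cmul[OF has_derivative_linear[OF f'], of t v] by simp
  ultimately show ?thesis by (simp add: has_field_derivative_def)
qed

text \<open>Three differentiations of the quadratic equation along a line through the origin.\<close>

lemma taylor_part3_quadratic_branch:
  fixes h :: "'a::euclidean_space \<Rightarrow> real"
  assumes U: "open U" "0 \<in> U" "smooth_on U h" "h 0 = 0" and n: "n \<noteq> 0"
    and eq: "\<And>s. s *\<^sub>R v \<in> U \<Longrightarrow> \<nu> * (h (s *\<^sub>R v))^2 + 2 * (n + l * s) * h (s *\<^sub>R v) + q * s^2 = 0"
  shows "taylor_part 3 h 0 v = q * l / (2 * n^2)"
proof -
  define J where "J = (\<lambda>s. s *\<^sub>R v) -` U"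
  have J: "open J" "0 \<in> J" using U unfolding J_def by (auto intro!: open_vimage continuous_intros)
  define f0 where "f0 s = h (s *\<^sub>R v)" for s
  define f1 where "f1 s = dir_deriv v h (s *\<^sub>R v)" for s
  define f2 where "f2 s = dir_deriv v (dir_deriv v h) (s *\<^sub>R v)" for s
  define f3 where "f3 s = dir_deriv v (dir_deriv v (dir_deriv v h)) (s *\<^sub>R v)" for s
  have d: "(f0 has_real_derivative f1 s) (at s)" "(f1 has_real_derivative f2 s) (at s)"
    "(f2 has_real_derivative f3 s) (at s)" if "s \<in> J" for s
    using that U(3) unfolding f0_def[abs_def] f1_def[abs_def] f2_def[abs_def] f3_def J_def
    by (auto intro!: dir_deriv_line[of U] smooth_on_dir_deriv)
  have e0: "\<nu> * (f0 s)^2 + 2 * (n + l * s) * f0 s + q * s^2 = 0" if "s \<in> J" for s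
    using eq that unfolding J_def f0_def by simp
  have e1: "2 * \<nu> * f0 s * f1 s + 2 * l * f0 s + 2 * (n + l * s) * f1 s + 2 * q * s = 0" if s: "s \<in> J" for s
  proof (rule derivative_of_zero[OF J(1) s e0])
    show "((\<lambda>s. \<nu> * (f0 s)^2 + 2 * (n + l * s) * f0 s + q * s^2) has_real_derivative
      2 * \<nu> * f0 s * f1 s + 2 * l * f0 s + 2 * (n + l * s) * f1 s + 2 * q * s) (at s)"
      by (rule derivative_eq_intros refl d[OF s] | simp add: algebra_simps)+
  qed
  have e2: "2 * \<nu> * (f1 s * f1 s + f0 s * f2 s) + 4 * l * f1 s + 2 * (n + l * s) * f2 s + 2 * q = 0" if s: "s \<in> J" for s
  proof (rule derivative_of_zero[OF J(1) s e1])
    show "((\<lambda>s. 2 * \<nu> * f0 s * f1 s + 2 * l * f0 s + 2 * (n + l * s) * f1 s + 2 * q * s) has_real_derivative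
      2 * \<nu> * (f1 s * f1 s + f0 s * f2 s) + 4 * l * f1 s + 2 * (n + l * s) * f2 s + 2 * q) (at s)"
      by (rule derivative_eq_intros refl d[OF s] | simp add: algebra_simps)+
  qed
  have e3: "2 * \<nu> * (3 * f1 s * f2 s + f0 s * f3 s) + 6 * l * f2 s + 2 * (n + l * s) * f3 s = 0" if s: "s \<in> J" for s
  proof (rule derivative_of_zero[OF J(1) s e2])
    show "((\<lambda>s. 2 * \<nu> * (f1 s * f1 s + f0 s * f2 s) + 4 * l * f1 s + 2 * (n + l * s) * f2 s + 2 * q) has_real_derivative
      2 * \<nu> * (3 * f1 s * f2 s + f0 s * f3 s) + 6 * l * f2 s + 2 * (n + l * s) * f3 s) (at s)"
      by (rule derivative_eq_intros refl d[OF s] | simp add: algebra_simps)+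
  qed
  have z0: "f0 0 = 0" using U(4) by (simp add: f0_def)
  have z1: "f1 0 = 0" using e1[OF J(2)] z0 n by simp
  have z2: "n * f2 0 = - q" using e2[OF J(2)] z0 z1 by simp
  have z3: "n * f3 0 = - 3 * l * f2 0" using e3[OF J(2)] z0 z1 by simp
  \<comment> \<open>The branch starts with \<open>- q * s^2 / (2 * n)\<close>, and the slope
    \<open>l\<close> alone produces its cubic term; \<open>\<nu>\<close> enters from fourth order
    on.\<close>
  have "n^2 * f3 0 = 3 * l * q" using z2 z3 by algebra
  then have "f3 0 = 3 * l * q / n^2" using n by (simp add: field_simps)
  moreover have "(dir_deriv v ^^ 3) h 0 = f3 0"
    by (simp add: numeral_3_eq_3 f3_def)
  ultimately show ?thesis by (simp add: taylor_part_def fact_numeral)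
qed

context quadric
begin

section \<open>The quadric as a graph over its tangent space\<close>

lemma Q3_G: "q \<in> Q3 a b c d \<longleftrightarrow> q \<bullet> G q = 2"
  by (auto simp: Q3_def Q3_form_def inner_G power2_eq_square)

lemma N_decomposition:
  fixes e :: "3 \<Rightarrow> real^4"
  assumes p: "p \<in> M" and ort: "\<And>i j. e i \<bullet> e j = (if i = j then 1 else 0)"
    and span: "span (range e) = tangent_space M p"
  shows "v = (v \<bullet> e 1) *\<^sub>R e 1 + (v \<bullet> e 2) *\<^sub>R e 2 + (v \<bullet> e 3) *\<^sub>R e 3 + (v \<bullet> N p) *\<^sub>R N p"
    "e i \<bullet> N p = 0"
proof -
  have n: "norm (G p) \<noteq> 0" using G_nonzero[OF p] by simp
  have NN: "N p \<bullet> N p = 1" using N_unit[OF p] by (simp add: dot_square_norm)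
  have "e i \<in> tangent_space M p" for i unfolding span[symmetric] by (simp add: span_base)
  then have eG: "e i \<bullet> G p = 0" for i unfolding tangent_space_M[OF p] by simp
  then show eN: "e i \<bullet> N p = 0" for i by (simp add: N_eq)
  have "(v - (v \<bullet> N p) *\<^sub>R N p) \<bullet> G p = norm (G p) * ((v - (v \<bullet> N p) *\<^sub>R N p) \<bullet> N p)"
    using n by (simp add: N_eq)
  also have "\<dots> = 0" using NN by (simp add: inner_diff_left)
  finally have "v - (v \<bullet> N p) *\<^sub>R N p \<in> span (range e)"
    unfolding span tangent_space_M[OF p] by simp
  from orthonormal3_expansion[OF ort this]
  have "v - (v \<bullet> N p) *\<^sub>R N p = (v \<bullet> e 1) *\<^sub>R e 1 + (v \<bullet> e 2) *\<^sub>R e 2 + (v \<bullet> e 3) *\<^sub>R e 3"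
    using eN by (simp add: inner_diff_left inner_commute[of "N p"])
  then show "v = (v \<bullet> e 1) *\<^sub>R e 1 + (v \<bullet> e 2) *\<^sub>R e 2 + (v \<bullet> e 3) *\<^sub>R e 3 + (v \<bullet> N p) *\<^sub>R N p"
    by (simp add: algebra_simps)
qed

text \<open>Inserting \<open>p + w + y *\<^sub>R N p\<close> into the equation of the quadric gives
  a quadratic equation for the height \<open>y\<close>, whose branch through 0 is \<open>h\<close>.
  Its cubic part is the product of a quadratic and a linear form in \<open>w\<close>.\<close>

lemma local_graph_exists:
  fixes e :: "3 \<Rightarrow> real^4"
  assumes p: "p \<in> M" and ort: "\<And>i j. e i \<bullet> e j = (if i = j then 1 else 0)"
    and span: "span (range e) = tangent_space M p"
  obtains h where "local_graph M N p e h"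
    "\<And>v. taylor_part 3 h 0 v = (let w = v$1 *\<^sub>R e 1 + v$2 *\<^sub>R e 2 + v$3 *\<^sub>R e 3 in
       (w \<bullet> G w) * (w \<bullet> G (N p)) / (2 * (norm (G p))^2))"
proof -
  let ?n = "norm (G p)"
  have n: "?n > 0" using G_nonzero[OF p] by simp
  define w where "w x = x$1 *\<^sub>R e 1 + x$2 *\<^sub>R e 2 + x$3 *\<^sub>R e 3" for x :: "real^3"
  define P where "P x = ?n + w x \<bullet> G (N p)" for x
  define Q where "Q x = w x \<bullet> G (w x)" for x
  define \<nu> where "\<nu> = N p \<bullet> G (N p)"
  define h where "h x = - Q x / (P x + sqrt ((P x)^2 - \<nu> * Q x))" for x
  define pt where "pt x y = p + w x + y *\<^sub>R N p" for x y
  note dec = N_decomposition[OF p ort span]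
  have NN: "N p \<bullet> N p = 1" using N_unit[OF p] by (simp add: dot_square_norm)
  have NG: "N p \<bullet> G p = ?n" using n by (simp add: N_eq dot_square_norm power2_eq_square)
  have eG: "e i \<bullet> G p = 0" for i using dec(2)[of i] n by (simp add: N_eq)
  have wG: "w x \<bullet> G p = 0" for x using eG by (simp add: w_def inner_add_left)
  have lG: "G (u + v) = G u + G v" "G (k *\<^sub>R u) = k *\<^sub>R G u" for u v k
    using linear_add[OF linear_G] linear_cmul[OF linear_G] by auto
  have quad: "pt x y \<bullet> G (pt x y) = 2 + (\<nu> * y^2 + 2 * P x * y + Q x)" for x y
  proof -
    have "pt x y \<bullet> G (pt x y) = p \<bullet> G p + 2 * (w x \<bullet> G p) + 2 * y * (N p \<bullet> G p)
       + w x \<bullet> G (w x) + 2 * y * (w x \<bullet> G (N p)) + y^2 * (N p \<bullet> G (N p))"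
      unfolding pt_def lG inner_add_left inner_add_right inner_scaleR_left inner_scaleR_right
      using G_sym[of p "w x"] G_sym[of p "N p"] G_sym[of "w x" "N p"]
      by (simp add: inner_commute power2_eq_square algebra_simps)
    moreover have "p \<bullet> G p = 2" using G_self p M_iff by blast
    ultimately show ?thesis unfolding wG NG by (simp add: P_def Q_def \<nu>_def algebra_simps)
  qed
  define xi where "xi q = (vector [(q - p) \<bullet> e 1, (q - p) \<bullet> e 2, (q - p) \<bullet> e 3] :: real^3)" for q
  define et where "et q = (q - p) \<bullet> N p" for q
  have pt_xi: "pt (xi q) (et q) = q" for q
  proof -
    have "w (xi q) + et q *\<^sub>R N p = q - p"
      unfolding w_def xi_def et_def vector_3 by (rule dec(1)[symmetric])
    then show ?thesis unfolding pt_def by (simp add: add.assoc)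
  qed
  have xi_pt: "xi (pt x y) = x" "et (pt x y) = y" for x y
  proof -
    have "N p \<bullet> e i = 0" for i using dec(2)[of i] by (simp add: inner_commute)
    then show "xi (pt x y) = x" "et (pt x y) = y"
      using dec(2) NN ort by (simp_all add: xi_def et_def pt_def w_def vec_eq_iff forall_3 inner_add_left)
  qed
  have sP: "smooth_on A P" if "open A" for A
    unfolding P_def w_def using that by (intro smooth_intros) 
  have sQ: "smooth_on A Q" if A: "open A" for A
  proof -
    have "Q x = (\<Sum>i\<in>UNIV. \<Sum>j\<in>UNIV. x$i * x$j * (e i \<bullet> G (e j)))" for x
      unfolding Q_def w_def lG by (simp add: sum_3 inner_add_left inner_add_right algebra_simps)
    then have "Q = (\<lambda>x. \<Sum>i\<in>UNIV. \<Sum>j\<in>UNIV. x$i * x$j * (e i \<bullet> G (e j)))" by (simp add: fun_eq_iff)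
    then show ?thesis using A unfolding sum_3 by (auto intro!: smooth_intros)
  qed
  define U0 where "U0 = {x. 0 < P x} \<inter> {x. 0 < (P x)^2 - \<nu> * Q x}"
  have cP: "continuous_on UNIV P" and cQ: "continuous_on UNIV Q"
    using sP sQ smooth_on_continuous by blast+
  have U0: "open U0"
    unfolding U0_def by (intro open_Int open_Collect_less continuous_intros cP cQ)
  have pos_den: "P x + sqrt ((P x)^2 - \<nu> * Q x) \<noteq> 0" "0 < (P x)^2 - \<nu> * Q x" if "x \<in> U0" for x
  proof -
    show 1: "0 < (P x)^2 - \<nu> * Q x" using that by (simp add: U0_def)
    have "0 < P x" using that by (simp add: U0_def)
    moreover have "0 < sqrt ((P x)^2 - \<nu> * Q x)" using 1 by simp
    ultimately show "P x + sqrt ((P x)^2 - \<nu> * Q x) \<noteq> 0" by linarith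
  qed
  have sh: "smooth_on U0 h"
    unfolding h_def by (intro smooth_intros sP sQ U0 pos_den)
  \<comment> \<open>The quadratic equation describes both sheets; the sign of the first coordinate
    selects the right one.\<close>
  define U where "U = U0 \<inter> (\<lambda>x. \<sigma> * pt x (h x) $ 1) -` {0<..}"
  have "continuous_on U0 (\<lambda>x. \<sigma> * pt x (h x) $ 1)"
    unfolding pt_def w_def by (intro continuous_intros smooth_on_continuous[OF sh])
  then have U: "open U" unfolding U_def by (rule continuous_open_preimage[OF _ U0]) simp
  have sU: "smooth_on U h" by (rule smooth_on_subset[OF sh]) (auto simp: U_def)
  have w0: "w 0 = 0" by (simp add: w_def)
  have G0: "G 0 = 0" by (rule linear_0[OF linear_G])
  have P0: "P 0 = ?n" "Q 0 = 0" by (simp_all add: P_def Q_def w0)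
  have h0: "h 0 = 0" by (simp add: h_def P0)
  have "pt 0 0 = p" by (simp add: pt_def w0)
  then have "0 \<in> U" using n p M_iff by (simp add: U_def U0_def P0 h0)
  \<comment> \<open>The third condition excludes points of the quadric that lie on the other root of
    the quadratic.\<close>
  define V where "V = {q. 0 < P (xi q)} \<inter> {q. 0 < (P (xi q))^2 - \<nu> * Q (xi q)} \<inter>
     {q. 0 < \<nu> * et q + P (xi q)} \<inter> {q. 0 < \<sigma> * q$1}"
  have cxi: "continuous_on UNIV xi"
    unfolding xi_def by (intro smooth_on_continuous smooth_intros open_UNIV)
  have cPx: "continuous_on UNIV (\<lambda>q. P (xi q))" "continuous_on UNIV (\<lambda>q. Q (xi q))"
    using continuous_on_compose2[OF cP cxi] continuous_on_compose2[OF cQ cxi] by auto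
  have "open V"
    unfolding V_def et_def by (intro open_Int open_Collect_less continuous_intros cPx)
  have "p \<in> V"
  proof -
    have "xi p = 0" "et p = 0" by (simp_all add: xi_def et_def vec_eq_iff forall_3)
    then show ?thesis using n p M_iff by (simp add: V_def P0)
  qed
  have "M \<inter> V = (\<lambda>x. pt x (h x)) ` U"
  proof (intro equalityI subsetI)
    fix q assume q: "q \<in> M \<inter> V"
    have "pt (xi q) (et q) \<bullet> G (pt (xi q) (et q)) = 2" using q M_iff Q3_G pt_xi by auto
    then have "\<nu> * (et q)^2 + 2 * P (xi q) * et q + Q (xi q) = 0" unfolding quad by simp
    then have "et q = h (xi q)"
      unfolding h_def by (intro quadratic_branch(3)) (use q in \<open>auto simp: V_def\<close>)
    then have "q = pt (xi q) (h (xi q))" using pt_xi by metis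
    moreover have "xi q \<in> U" using q calculation unfolding U_def U0_def V_def by auto
    ultimately show "q \<in> (\<lambda>x. pt x (h x)) ` U" by blast
  next
    fix q assume "q \<in> (\<lambda>x. pt x (h x)) ` U"
    then obtain x where x: "x \<in> U" "q = pt x (h x)" by blast
    have x0: "0 < P x" "0 < (P x)^2 - \<nu> * Q x" "0 < \<sigma> * q$1" using x by (auto simp: U_def U0_def)
    have "\<nu> * (h x)^2 + 2 * P x * h x + Q x = 0" unfolding h_def by (rule quadratic_branch(2)[OF x0(1,2)])
    then have "q \<in> Q3 a b c d" unfolding x(2) Q3_G quad by simp
    moreover have "\<nu> * h x + P x = sqrt ((P x)^2 - \<nu> * Q x)" unfolding h_def by (rule quadratic_branch(1)[OF x0(1,2)])
    then have "0 < \<nu> * h x + P x" using x0(2) by simp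
    moreover have "q \<in> M" unfolding M_iff using calculation(1) x0(3) by blast
    ultimately show "q \<in> M \<inter> V" using x0 unfolding V_def by (simp add: x(2) xi_pt)
  qed
  then have "local_graph M N p e h"
    unfolding local_graph_def
    using U \<open>0 \<in> U\<close> \<open>open V\<close> \<open>p \<in> V\<close> sU by (intro exI[of _ U] exI[of _ V]) (simp add: pt_def w_def add.assoc)
  moreover have "taylor_part 3 h 0 v = (let w = v$1 *\<^sub>R e 1 + v$2 *\<^sub>R e 2 + v$3 *\<^sub>R e 3 in
       (w \<bullet> G w) * (w \<bullet> G (N p)) / (2 * (norm (G p))^2))" for v
  proof -
    have "taylor_part 3 h 0 v = Q v * (w v \<bullet> G (N p)) / (2 * ?n^2)"
    proof (rule taylor_part3_quadratic_branch[OF U \<open>0 \<in> U\<close> sU h0])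
      fix s assume s: "s *\<^sub>R v \<in> U"
      have ws: "w (s *\<^sub>R v) = s *\<^sub>R w v" by (simp add: w_def scaleR_add_right)
      have "\<nu> * (h (s *\<^sub>R v))^2 + 2 * P (s *\<^sub>R v) * h (s *\<^sub>R v) + Q (s *\<^sub>R v) = 0"
        unfolding h_def by (rule quadratic_branch(2)) (use s in \<open>auto simp: U_def U0_def\<close>)
      then show "\<nu> * (h (s *\<^sub>R v))^2 + 2 * (?n + (w v \<bullet> G (N p)) * s) * h (s *\<^sub>R v) + Q v * s^2 = 0"
        by (simp add: P_def Q_def ws lG power2_eq_square mult_ac)
    qed (use n in simp)
    then show ?thesis by (simp add: w_def Q_def Let_def)
  qed
  ultimately show ?thesis using that by blast
qed

text \<open>The cubic part of a quadric as a graph is the product of its quadratic part, a multiple of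
  \<open>x\<^sub>1\<^sup>2 + x\<^sub>2\<^sup>2\<close> on the eigenspace, with a linear form. The reflection in the third ambient
  coordinate removes \<open>x\<^sub>2\<close> from the linear form, whence \<open>A / B = 3\<close> and \<open>C = 0\<close>.\<close>

lemma type_D1_M:
  assumes p: "p \<in> M" and m: "mu p $ 2 = C" "mu p $ 3 = C"
  shows "type_D1_point M N p"
proof -
  let ?n = "norm (G p)"
  let ?T = "{v. v \<bullet> G p = 0}"
  let ?E = "eigenspace M N p (principal_curvatures M N p $ 2)"
  have n: "?n > 0" using G_nonzero[OF p] by simp
  have C0: "C > 0" using pos0 by simp
  have Yp: "Y p = 0" using XYZ_zero_iff(2)[OF p] m by simp
  then have p3: "p$3 = 0" using roots_pos(2) pos0(2) by (auto simp: Y_def)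
  have k2: "principal_curvatures M N p $ 2 = 2 / (?n * C)" unfolding principal_curvatures_M[OF p] m ..
  have E: "?E = {v. v \<bullet> G p = 0 \<and> (\<exists>\<mu>. G v + (2 / C) *\<^sub>R v = \<mu> *\<^sub>R G p)}"
    unfolding eigenspace_def k2 tangent_space_M[OF p] using shape_eigen_aux[OF p] n by auto
  obtain k f where f: "principal_frame p k f" using principal_frame_exists[OF p] .
  have fort: "f i \<bullet> f j = (if i = j then 1 else 0)" for i j using f by (simp add: principal_frame_def)
  have fspan: "span (range f) = tangent_space M p" using f by (simp add: principal_frame_def)
  have fT: "f i \<bullet> G p = 0" for i
  proof -
    have "f i \<in> span (range f)" by (simp add: span_base)
    then show ?thesis unfolding fspan tangent_space_M[OF p] by simp
  qed
  have k: "k$i = 2 / (?n * mu p $ i)" for i by (rule principal_frame_curvatures[OF p f])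
  have fE: "f 2 \<in> ?E" "f 3 \<in> ?E"
    using f fT k m unfolding eigenspace_def principal_frame_def tangent_space_M[OF p] k2 by auto
  obtain \<mu>1 where f1: "G (f 1) + (2 / mu p $ 1) *\<^sub>R f 1 = \<mu>1 *\<^sub>R G p"
  proof -
    have "shape_operator M N p (f 1) = k$1 *\<^sub>R f 1" using f by (simp add: principal_frame_def)
    then show ?thesis using that n unfolding shape_eigen_aux[OF p fT] k by auto
  qed
  have m1: "mu p $ 1 > C" using mu_ranges[OF p] pos by simp
  \<comment> \<open>Eigenvectors for different curvatures are orthogonal because \<open>G\<close> is
    self-adjoint.\<close>
  have Ef1: "v \<bullet> f 1 = 0" if v: "v \<in> ?E" for v
  proof -
    obtain \<mu> where \<mu>: "v \<bullet> G p = 0" "G v + (2 / C) *\<^sub>R v = \<mu> *\<^sub>R G p" using v unfolding E by blast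
    have "G v \<bullet> f 1 + (2 / C) * (v \<bullet> f 1) = 0"
    proof -
      have "G p \<bullet> f 1 = 0" using fT[of 1] by (simp add: inner_commute)
      then show ?thesis using arg_cong[OF \<mu>(2), of "\<lambda>u. u \<bullet> f 1"] by (simp add: inner_add_left)
    qed
    moreover have "v \<bullet> G (f 1) + (2 / mu p $ 1) * (v \<bullet> f 1) = 0"
      using arg_cong[OF f1, of "\<lambda>u. v \<bullet> u"] \<mu>(1) by (simp add: inner_add_right)
    ultimately have "(2 / C - 2 / mu p $ 1) * (v \<bullet> f 1) = 0" unfolding left_diff_distrib using G_sym[of v "f 1"] by linarith
    moreover have "2 / mu p $ 1 < 2 / C"
      using m1 C0 mu_pos[OF p, of 1] by (intro divide_strict_left_mono mult_pos_pos) auto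
    ultimately show ?thesis using m1 by auto
  qed
  \<comment> \<open>Since \<open>p$3 = 0\<close>, the third ambient axis is tangent, and
    \<open>G\<close> multiplies it by \<open>- 2 / C\<close>, which makes it an eigenvector for the
    double curvature.\<close>
  define a3 where "a3 = (axis 3 1 :: real^4)"
  have a3n: "a3$1 = 0" "a3$2 = 0" "a3$3 = 1" "a3$4 = 0" by (simp_all add: a3_def axis_def)
  have a3E: "a3 \<in> ?E"
  proof -
    have "a3 \<bullet> G p = 0" by (simp add: inner_G a3n p3)
    moreover have "G a3 + (2 / C) *\<^sub>R a3 = 0 *\<^sub>R G p"
      by (simp add: vec_eq_iff forall_4 a3n)
    ultimately show ?thesis unfolding E by blast
  qed
  have a31: "a3 \<bullet> a3 = 1" by (simp add: inner4 a3n)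
  define \<alpha> \<beta> where "\<alpha> = a3 \<bullet> f 2" and "\<beta> = a3 \<bullet> f 3"
  have a3f: "a3 = \<alpha> *\<^sub>R f 2 + \<beta> *\<^sub>R f 3"
  proof -
    have "a3 \<in> span (range f)" using a3E unfolding fspan eigenspace_def by blast
    from orthonormal3_expansion[OF fort this] show ?thesis using Ef1[OF a3E] by (simp add: \<alpha>_def \<beta>_def)
  qed
  have ab: "\<alpha> * \<alpha> + \<beta> * \<beta> = 1"
    using a31 unfolding a3f by (simp add: inner_add_left inner_add_right fort)
  \<comment> \<open>The quarter turn of \<open>a3\<close> within the eigenspace.\<close>
  define e1 where "e1 = \<alpha> *\<^sub>R f 3 - \<beta> *\<^sub>R f 2"
  have subE: "subspace ?E"
    unfolding E
  proof (intro subspaceI)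
    show "0 \<in> {v. v \<bullet> G p = 0 \<and> (\<exists>\<mu>. G v + (2 / C) *\<^sub>R v = \<mu> *\<^sub>R G p)}"
      using linear_0[OF linear_G] by (auto intro!: exI[of _ 0])
  next
    fix u v assume "u \<in> {v. v \<bullet> G p = 0 \<and> (\<exists>\<mu>. G v + (2 / C) *\<^sub>R v = \<mu> *\<^sub>R G p)}"
      "v \<in> {v. v \<bullet> G p = 0 \<and> (\<exists>\<mu>. G v + (2 / C) *\<^sub>R v = \<mu> *\<^sub>R G p)}"
    then obtain \<mu> \<mu>' where uv: "u \<bullet> G p = 0" "v \<bullet> G p = 0" "G u + (2 / C) *\<^sub>R u = \<mu> *\<^sub>R G p" "G v + (2 / C) *\<^sub>R v = \<mu>' *\<^sub>R G p" by blast
    have "(u + v) \<bullet> G p = 0" using uv by (simp add: inner_add_left)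
    moreover have "G (u + v) + (2 / C) *\<^sub>R (u + v) = (G u + (2 / C) *\<^sub>R u) + (G v + (2 / C) *\<^sub>R v)"
      by (simp add: linear_add[OF linear_G] scaleR_add_right)
    then have "G (u + v) + (2 / C) *\<^sub>R (u + v) = (\<mu> + \<mu>') *\<^sub>R G p"
      unfolding uv by (simp add: scaleR_add_left)
    ultimately show "u + v \<in> {v. v \<bullet> G p = 0 \<and> (\<exists>\<mu>. G v + (2 / C) *\<^sub>R v = \<mu> *\<^sub>R G p)}" by blast
  next
    fix r v assume "v \<in> {v. v \<bullet> G p = 0 \<and> (\<exists>\<mu>. G v + (2 / C) *\<^sub>R v = \<mu> *\<^sub>R G p)}"
    then obtain \<mu> where v: "v \<bullet> G p = 0" "G v + (2 / C) *\<^sub>R v = \<mu> *\<^sub>R G p" by blast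
    have "G (r *\<^sub>R v) + (2 / C) *\<^sub>R (r *\<^sub>R v) = r *\<^sub>R (G v + (2 / C) *\<^sub>R v)"
      by (simp add: linear_cmul[OF linear_G] scaleR_add_right)
    also have "\<dots> = (r * \<mu>) *\<^sub>R G p" unfolding v by simp
    finally show "r *\<^sub>R v \<in> {v. v \<bullet> G p = 0 \<and> (\<exists>\<mu>. G v + (2 / C) *\<^sub>R v = \<mu> *\<^sub>R G p)}" using v(1) by auto
  qed
  have e1E: "e1 \<in> ?E" unfolding e1_def by (intro subspace_diff[OF subE] subspace_scale[OF subE] fE)
  have e11: "e1 \<bullet> e1 = 1" "e1 \<bullet> a3 = 0" "e1 \<bullet> f 1 = 0" "a3 \<bullet> f 1 = 0"
    using ab Ef1[OF e1E] Ef1[OF a3E]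
    by (simp_all add: e1_def a3f inner_diff_left inner_diff_right inner_add_right fort)
  define e :: "3 \<Rightarrow> real^4" where "e i = (if i = 1 then e1 else if i = 2 then a3 else f 1)" for i
  have e: "e 1 = e1" "e 2 = a3" "e 3 = f 1" by (auto simp: e_def)
  have ort: "e i \<bullet> e j = (if i = j then 1 else 0)" for i j
    using exhaust_3[of i] exhaust_3[of j] e11 a31 fort[of 1 1]
    by (auto simp: e inner_commute[of a3 e1] inner_commute[of "f 1" e1] inner_commute[of "f 1" a3])
  have "range e \<subseteq> ?T" using e1E a3E fT unfolding E by (auto simp: e_def)
  moreover have "subspace ?T" by (auto simp: subspace_def inner_add_left)
  ultimately have span: "span (range e) = tangent_space M p"
    unfolding tangent_space_M[OF p] by (intro orthonormal3_span[OF ort _ dim_tangent[OF p]])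
  have span2: "span {e 1, e 2} = ?E"
  proof
    show "span {e 1, e 2} \<subseteq> ?E" by (rule span_minimal[OF _ subE]) (use e1E a3E in \<open>simp add: e\<close>)
    show "?E \<subseteq> span {e 1, e 2}"
    proof
      fix v assume v: "v \<in> ?E"
      then have "v \<in> span (range e)" unfolding span eigenspace_def by blast
      from orthonormal3_expansion[OF ort this] have "v = (v \<bullet> e 1) *\<^sub>R e 1 + (v \<bullet> e 2) *\<^sub>R e 2"
        using Ef1[OF v] by (simp add: e)
      moreover have "(v \<bullet> e 1) *\<^sub>R e 1 + (v \<bullet> e 2) *\<^sub>R e 2 \<in> span {e 1, e 2}"
        by (intro span_add span_scale span_base) auto
      ultimately show "v \<in> span {e 1, e 2}" by simp
    qed
  qed
  obtain h where h: "local_graph M N p e h"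
    "\<And>v. taylor_part 3 h 0 v = (let w = v$1 *\<^sub>R e 1 + v$2 *\<^sub>R e 2 + v$3 *\<^sub>R e 3 in
       (w \<bullet> G w) * (w \<bullet> G (N p)) / (2 * (norm (G p))^2))"
    using local_graph_exists[OF p ort span] by blast
  have EE: "u \<bullet> G v = - (2 / C) * (u \<bullet> v)" if "u \<in> ?E" "v \<in> ?E" for u v
  proof -
    obtain \<mu> where "G v + (2 / C) *\<^sub>R v = \<mu> *\<^sub>R G p" using \<open>v \<in> ?E\<close> unfolding E by blast
    from arg_cong[OF this, of "\<lambda>x. u \<bullet> x"] have "u \<bullet> G v + (2 / C) * (u \<bullet> v) = 0"
      using \<open>u \<in> ?E\<close> unfolding E by (simp add: inner_add_right)
    then show ?thesis by simp
  qed
  define l where "l = e1 \<bullet> G (N p)"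
  have l2: "a3 \<bullet> G (N p) = 0" by (simp add: inner_G a3n N_eq p3)
  \<comment> \<open>If the linear form vanished, \<open>e1\<close> would be an eigenvector of the
    diagonal map \<open>G\<close> with the eigenvalue of the third axis. The other eigenvalues
    differ, so \<open>e1\<close> would lie on that axis, to which it is orthogonal.\<close>
  have l: "l \<noteq> 0"
  proof
    assume "l = 0"
    obtain \<mu> where \<mu>: "G e1 + (2 / C) *\<^sub>R e1 = \<mu> *\<^sub>R G p" using e1E unfolding E by blast
    have "e1 \<bullet> N p = 0" using e1E unfolding E by (simp add: N_eq)
    moreover have "G p \<bullet> N p = ?n" using n by (simp add: N_eq dot_square_norm power2_eq_square)
    ultimately have "\<mu> * ?n = 0"
      using arg_cong[OF \<mu>, of "\<lambda>u. u \<bullet> N p"] \<open>l = 0\<close> by (simp add: inner_add_left G_sym l_def)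
    then have "G e1 + (2 / C) *\<^sub>R e1 = 0" using \<mu> n by simp
    then have z: "2 * e1$1 / a^2 + 2 / C * e1$1 = 0" "- 2 * e1$2 / B + 2 / C * e1$2 = 0" "- 2 * e1$4 / D + 2 / C * e1$4 = 0"
      by (auto simp: vec_eq_iff forall_4)
    have "e1$1 * (1 / a^2 + 1 / C) = 0" "e1$2 * (1 / C - 1 / B) = 0" "e1$4 * (1 / D - 1 / C) = 0"
    proof -
      have "2 * (e1$1 * (1 / a^2 + 1 / C)) = 0" using z(1) by (simp add: distrib_left)
      then show "e1$1 * (1 / a^2 + 1 / C) = 0" by simp
      have "2 * (e1$2 * (1 / C - 1 / B)) = 0" using z(2) by (simp add: right_diff_distrib)
      then show "e1$2 * (1 / C - 1 / B) = 0" by simp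
      have "- 2 * (e1$4 * (1 / D - 1 / C)) = 0" using z(3) by (simp add: right_diff_distrib)
      then show "e1$4 * (1 / D - 1 / C) = 0" by simp
    qed
    moreover have "1 / a^2 + 1 / C > 0" "1 / C - 1 / B > 0" "1 / D - 1 / C > 0"
      using a0 C0 D0 BC CD by (auto intro!: add_pos_pos divide_strict_left_mono mult_pos_pos simp: power_strict_mono)
    ultimately have "e1$1 = 0" "e1$2 = 0" "e1$4 = 0" by auto
    moreover have "e1$3 = 0" using e11(2) by (simp add: inner4 a3n)
    ultimately show False using e11(1) by (simp add: inner4)
  qed
  \<comment> \<open>On the eigenspace the cubic part is
    \<open>- (2 / C) * (x1^2 + x2^2) * (l * x1) / (2 * ?n^2)\<close>; the normal form multiplies its
    two equal coefficients by 6 and by 2.\<close>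
  define A Bc where "A = - 6 * l / (C * ?n^2)" and "Bc = - 2 * l / (C * ?n^2)"
  have Bc: "Bc \<noteq> 0" "A = 3 * Bc" using l C0 n by (auto simp: Bc_def A_def)
  have tay: "taylor_part 3 h 0 (vector [x1, x2, 0]) = (A * x1^3 + 3 * Bc * x1 * x2^2 + 0 * x2^3) / 6" for x1 x2
  proof -
    define w where "w = x1 *\<^sub>R e1 + x2 *\<^sub>R a3"
    have wE: "w \<in> ?E" unfolding w_def by (intro subspace_add[OF subE] subspace_scale[OF subE] e1E a3E)
    have "w \<bullet> w = x1 * x1 + x2 * x2"
      using e11 a31 by (simp add: w_def inner_add_left inner_add_right inner_commute[of a3 e1])
    then have "w \<bullet> G w = - (2 / C) * (x1 * x1 + x2 * x2)" using EE[OF wE wE] by simp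
    moreover have "w \<bullet> G (N p) = x1 * l" using l2 by (simp add: w_def inner_add_left l_def)
    ultimately have "taylor_part 3 h 0 (vector [x1, x2, 0]) = - (2 / C) * (x1 * x1 + x2 * x2) * (x1 * l) / (2 * ?n^2)"
      unfolding h(2) Let_def by (simp add: e w_def)
    also have "\<dots> = (A * x1^3 + 3 * Bc * x1 * x2^2 + 0 * x2^3) / 6"
    proof -
      have "- (2 / u) * (x1 * x1 + x2 * x2) * (x1 * l) / (2 * v)
          = (- 6 * l / (u * v) * x1^3 + 3 * (- 2 * l / (u * v)) * x1 * x2^2 + 0 * x2^3) / 6"
        if "u \<noteq> 0" "v \<noteq> 0" for u v
        using that by (simp add: field_simps power2_eq_square power3_eq_cube)
      from this[of C "?n^2"] show ?thesis using C0 n by (simp only: A_def Bc_def) simp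
    qed
    finally show ?thesis .
  qed
  have "Bc * (Bc - A) \<noteq> 0" "A / Bc > (0 / (2 * Bc))^2 + 2" using Bc by auto
  moreover have "p \<in> partially_umbilic_set12 M N \<union> partially_umbilic_set23 M N"
    unfolding P23_mu using p m by simp
  ultimately show ?thesis
    unfolding type_D1_point_def using ort span span2 h(1) tay by blast
qed

section \<open>The curves in the chart and the final assembly\<close>

lemma chart_Phi: "Q3_chart a b c d \<sigma> u v w = Phi (sqrt (a^2 + B) * u) (sqrt (a^2 + C) * v) (sqrt (a^2 + D) * w)"
  using roots_pos a0 by (simp add: Phi_def)

lemma M_chart: "{Q3_chart a b c d \<sigma> u v w |u v w. R u v w} =
    {p \<in> M. R (X p / sqrt (a^2 + B)) (Y p / sqrt (a^2 + C)) (Z p / sqrt (a^2 + D))}"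
proof (intro equalityI subsetI)
  fix p assume "p \<in> {p \<in> M. R (X p / sqrt (a^2 + B)) (Y p / sqrt (a^2 + C)) (Z p / sqrt (a^2 + D))}"
  moreover from this have "p = Q3_chart a b c d \<sigma> (X p / sqrt (a^2 + B)) (Y p / sqrt (a^2 + C)) (Z p / sqrt (a^2 + D))"
    using Phi_XYZ[of p] by (simp add: Phi_def)
  ultimately show "p \<in> {Q3_chart a b c d \<sigma> u v w |u v w. R u v w}" by blast
next
  fix p assume "p \<in> {Q3_chart a b c d \<sigma> u v w |u v w. R u v w}"
  then obtain u v w where "p = Q3_chart a b c d \<sigma> u v w" "R u v w" by blast
  then show "p \<in> {p \<in> M. R (X p / sqrt (a^2 + B)) (Y p / sqrt (a^2 + C)) (Z p / sqrt (a^2 + D))}"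
    unfolding chart_Phi using roots_pos a0 by simp
qed

lemma scaled: "u \<noteq> 0 \<Longrightarrow> v \<noteq> 0 \<Longrightarrow> y * v + z * u - u * v = (y / u + z / v - 1) * (u * v)" for u v y z :: real
  by (simp add: field_simps)

lemma P12_chart: "{Q3_chart a b c d \<sigma> u v w |u v w. E_fun a b c d v w = 0 \<and> u = 0} = {p \<in> M. X p = 0 \<and> FF p = 0}"
proof -
  have s: "a^2 + C > 0" "a^2 + D > 0" using roots_pos by simp_all
  have "FF p = E_fun a b c d (Y p / sqrt (a^2 + C)) (Z p / sqrt (a^2 + D)) * ((B - C) * (B - D))" for p
  proof -
    have "(a^2 + C) * (Y p / sqrt (a^2 + C))^2 = (Y p)^2" "(a^2 + D) * (Z p / sqrt (a^2 + D))^2 = (Z p)^2"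
      using s a0 by (simp_all add: power_divide)
    then show ?thesis
      unfolding E_fun_def using scaled[of "B - C" "B - D" "(Y p)^2" "(Z p)^2"] pos by (simp add: FF_def)
  qed
  then show ?thesis unfolding M_chart using roots_pos pos by auto
qed

lemma P23_chart: "{Q3_chart a b c d \<sigma> u v w |u v w. H_fun a b c d u w = 0 \<and> v = 0} = {p \<in> M. Y p = 0 \<and> HH p = 0}"
proof -
  have s: "a^2 + B > 0" "a^2 + D > 0" using roots_pos by simp_all
  have "HH p = H_fun a b c d (X p / sqrt (a^2 + B)) (Z p / sqrt (a^2 + D)) * ((B - C) * (C - D))" for p
  proof -
    have "(a^2 + B) * (X p / sqrt (a^2 + B))^2 = (X p)^2" "(a^2 + D) * (Z p / sqrt (a^2 + D))^2 = (Z p)^2"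
      using s a0 by (simp_all add: power_divide)
    then show ?thesis
      unfolding H_fun_def using scaled[of "B - C" "C - D" "- ((X p)^2)" "(Z p)^2"] pos by (simp add: HH_def)
  qed
  then show ?thesis unfolding M_chart using roots_pos pos by auto
qed

lemma P23s_D1: "s = 1 \<or> s = -1 \<Longrightarrow> type_D1_curve M N (P23s s)"
  unfolding type_D1_curve_def
  using P23s_regular type_D1_M P23_mu_eq by (auto simp: P23s_def)

text \<open>A leaf with \<open>m$2 = C\<close> contains its base point, which lies in the band; a
  leaf that avoids the band is therefore generic.\<close>

lemma leaves3_compact:
  assumes "L \<in> leaves M N 3" "L \<inter> {p \<in> M. mu p $ 2 = C \<and> mu p $ 3 < C} = {}"
  shows "compact L"
proof -
  obtain p where p: "p \<in> foliation_domain M N 3" "L = leaf M N 3 p" using assms(1) unfolding leaves_def by blast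
  note R = mu_ranges[OF domM[OF p(1)]]
  have "mu p $ 2 \<noteq> C"
  proof
    assume m: "mu p $ 2 = C"
    have "mu p $ 3 < C" using p(1) m R by (auto simp: foliation_domain_M forall_3)
    then have "p \<notin> L" using assms(2) m domM[OF p(1)] by blast
    then show False using leaf3_separatrix(1)[OF p(1) m] p(2) by simp
  qed
  then show ?thesis using leaf3_generic[OF p(1)] R p(2) by simp
qed

text \<open>Through its base point, a leaf that avoids the surfaces excludes first
  \<open>m$3 = C\<close> and then \<open>m$1 = B\<close>, which leaves the generic case.\<close>

lemma leaves2_closed:
  assumes "L \<in> leaves M N 2" "L \<inter> (separatrix_surface M N 2 (P23s 1) \<union> separatrix_surface M N 2 (P23s (-1))
     \<union> separatrix_surface M N 2 {p \<in> M. mu p $ 1 = mu p $ 2}) = {}"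
  shows "closed_leaf L"
proof -
  obtain p where p: "p \<in> foliation_domain M N 2" "L = leaf M N 2 p" using assms(1) unfolding leaves_def by blast
  note pM = domM[OF p(1)]
  note R = mu_ranges[OF pM]
  have d: "mu p $ 1 \<noteq> mu p $ 2" "mu p $ 3 \<noteq> mu p $ 2" using p(1) by (auto simp: foliation_domain_M forall_3)
  have "mu p $ 3 < C"
  proof (rule ccontr)
    assume "\<not> mu p $ 3 < C"
    then have m: "mu p $ 3 = C" using R by simp
    have "p \<in> L" using leaf2_separatrix23(1)[OF p(1) m] leaf2_separatrix_both(1)[OF p(1) _ m] R p(2) by fastforce
    moreover have "Z p \<noteq> 0" using XYZ_zero_iff(3)[OF pM] m pos by simp
    then have "0 < 1 * Z p \<or> 0 < - 1 * Z p" by auto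
    then have "p \<in> separatrix_surface M N 2 (P23s 1) \<union> separatrix_surface M N 2 (P23s (-1))"
      unfolding separatrix2_P23s[of 1, simplified] separatrix2_P23s[of "-1", simplified] using pM m d R by auto
    ultimately show False using assms(2) by blast
  qed
  moreover have "B < mu p $ 1"
  proof (rule ccontr)
    assume "\<not> B < mu p $ 1"
    then have m: "mu p $ 1 = B" using R by simp
    have "p \<in> L" using leaf2_separatrix12(1)[OF p(1) m calculation] p(2) by simp
    moreover have "p \<in> separatrix_surface M N 2 {p \<in> M. mu p $ 1 = mu p $ 2}"
      unfolding separatrix2_P12 using pM m d R by auto
    ultimately show False using assms(2) by blast
  qed
  ultimately show ?thesis using leaf2_generic[OF p(1)] p(2) by simp
qed

end

lemma components_Q3:
  fixes a b c d :: real
  assumes "a > 0" "b > c" "c > d" "d > 0"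
  shows "components (Q3 a b c d) = {Q3_sheet a b c d 1, Q3_sheet a b c d (-1)}"
proof -
  interpret pos: quadric a b c d 1 by unfold_locales (use assms in auto)
  interpret neg: quadric a b c d "-1" by unfold_locales (use assms in auto)
  have "p$1 \<noteq> 0" if "p \<in> Q3 a b c d" for p
  proof
    assume z: "p$1 = 0"
    have "0 < a^2 * (1 + (p$2/b)^2 + (p$3/c)^2 + (p$4/d)^2)"
      using assms by (intro mult_pos_pos add_pos_nonneg) auto
    also have "\<dots> = (p$1)^2" using that pos.Q3_eq by metis
    finally show False using z by simp
  qed
  then have eq: "Q3 a b c d = Q3_sheet a b c d 1 \<union> Q3_sheet a b c d (-1)"
    using pos.M_iff neg.M_iff by (auto simp: neq_iff)
  show ?thesis
    unfolding eq
    by (rule components_two_signs[where f = "\<lambda>p. p$1"])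
      (use pos.connected_M neg.connected_M pos.M_iff neg.M_iff in \<open>auto intro!: continuous_intros\<close>)
qed

theorem theorem4:
  fixes a b c d :: real
  assumes "a > 0" and "b > c" and "c > d" and "d > 0"
  shows "components (Q3 a b c d) = {Q3_sheet a b c d 1, Q3_sheet a b c d (-1)} \<and>
    (\<forall>\<sigma>\<in>{1, -1}.
      let N = Q3_normal a b c d;
          M = Q3_sheet a b c d \<sigma>;
          P12 = {Q3_chart a b c d \<sigma> u v w |u v w. E_fun a b c d v w = 0 \<and> u = 0};
          P23 = {Q3_chart a b c d \<sigma> u v w |u v w. H_fun a b c d u w = 0 \<and> v = 0}
      in
        umbilic_set M N = {} \<and>
        partially_umbilic_set12 M N = P12 \<and> regular_curve P12 \<and>
        partially_umbilic_set23 M N = P23 \<and>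
        (\<exists>P23_1 P23_2.
          P23_1 \<noteq> P23_2 \<and> components P23 = {P23_1, P23_2} \<and>
          regular_curve P23_1 \<and> regular_curve P23_2 \<and>
          (singular_set M N 1 = P12 \<and>
           singular_set M N 3 = P23_1 \<union> P23_2 \<and>
           singular_set M N 2 = P12 \<union> P23_1 \<union> P23_2 \<and>
           type_D1_curve M N P23_1 \<and> type_D1_curve M N P23_2 \<and>
           (let W23 = separatrix_surface M N 3 P23_1 \<union> separatrix_surface M N 3 P23_2 in
              diffeomorphic W23 ((UNIV :: real set) \<times> {0<..<1::real}) \<and>
              (top_of_set (Q3 a b c d)) closure_of W23 - W23 = P23_1 \<union> P23_2 \<and>
              (\<forall>L\<in>leaves M N 1. diffeomorphic L (UNIV :: real set)) \<and>
              (\<forall>L\<in>leaves M N 3. L \<inter> W23 = {} \<longrightarrow> compact L))) \<and>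
          (let W23_1 = separatrix_surface M N 2 P23_1;
               W23_2 = separatrix_surface M N 2 P23_2;
               W12 = separatrix_surface M N 2 P12
           in
              \<not> bounded W23_1 \<and> diffeomorphic W23_1 (ball (0::real^2) 1 - {0}) \<and>
              \<not> bounded W23_2 \<and> diffeomorphic W23_2 (ball (0::real^2) 1 - {0}) \<and>
              (\<exists>p\<in>ball 0 1. \<exists>q\<in>ball 0 1. p \<noteq> q \<and>
                 diffeomorphic W12 (ball (0::real^2) 1 - {p, q})) \<and>
              (\<forall>L\<in>leaves M N 2. L \<inter> (W23_1 \<union> W23_2 \<union> W12) = {} \<longrightarrow> closed_leaf L) \<and>
              transversal_in M W23_1 W12 \<and>
              diffeomorphic (W23_1 \<inter> W12) (UNIV :: real set) \<and>
              transversal_in M W23_2 W12 \<and>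
              diffeomorphic (W23_2 \<inter> W12) (UNIV :: real set))))"
    (is "_ \<and> (\<forall>\<sigma>\<in>_. ?P \<sigma>)")
proof (intro conjI ballI)
  show "components (Q3 a b c d) = {Q3_sheet a b c d 1, Q3_sheet a b c d (-1)}"
    by (rule components_Q3[OF assms])
next
  fix \<sigma> :: real assume "\<sigma> \<in> {1, -1}"
  then interpret quadric a b c d \<sigma> by unfold_locales (use assms in auto)
  have o: "(1::real) = 1 \<or> (1::real) = -1" "(-1::real) = 1 \<or> (-1::real) = -1" by auto
  note P12 = P12_chart P12_coord[symmetric]
  note P23 = P23_chart P23_coord[symmetric] P23_union
  have ne: "P23s 1 \<noteq> P23s (-1)"
    using connected_P23s(2)[OF o(1)] by (force simp: P23s_def)
  have sing: "singular_set M N 1 = {p \<in> M. mu p $ 1 = mu p $ 2}" "singular_set M N 3 = P23s 1 \<union> P23s (-1)"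
    "singular_set M N 2 = {p \<in> M. mu p $ 1 = mu p $ 2} \<union> P23s 1 \<union> P23s (-1)"
    unfolding singular_set_def umbilic_empty P12_mu P23_mu P23_union by auto
  have lv1: "\<forall>L\<in>leaves M N 1. diffeomorphic L (UNIV :: real set)"
    using leaf1 unfolding leaves_def by blast
  have lv3: "\<forall>L\<in>leaves M N 3. L \<inter> {p \<in> M. mu p $ 2 = C \<and> mu p $ 3 < C} = {} \<longrightarrow> compact L"
    using leaves3_compact by blast
  have s3: "separatrix_surface M N 3 (P23s 1) \<union> separatrix_surface M N 3 (P23s (-1)) = {p \<in> M. mu p $ 2 = C \<and> mu p $ 3 < C}"
    unfolding separatrix3[OF o(1)] separatrix3[OF o(2)] by blast
  have band: "diffeomorphic {p \<in> M. mu p $ 2 = C \<and> mu p $ 3 < C} ((UNIV :: real set) \<times> {0<..<1::real})"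
    unfolding W23_coord by (rule W23_band)
  have bd: "(top_of_set (Q3 a b c d)) closure_of {p \<in> M. mu p $ 2 = C \<and> mu p $ 3 < C}
      - {p \<in> M. mu p $ 2 = C \<and> mu p $ 3 < C} = P23s 1 \<union> P23s (-1)"
    unfolding W23_coord W23_boundary P23 ..
  have W2: "separatrix_surface M N 2 (P23s s) = {p \<in> M. Y p = 0 \<and> 0 < HH p \<and> 0 < s * Z p \<and> \<not> (X p = 0 \<and> FF p = 0)}"
    if "s = 1 \<or> s = -1" for s
    unfolding separatrix2_P23s[OF that] W23s_coord ..
  have W12: "separatrix_surface M N 2 {p \<in> M. mu p $ 1 = mu p $ 2} = {p \<in> M. X p = 0 \<and> FF p < 0 \<and> \<not> (Y p = 0 \<and> HH p = 0)}"
    unfolding separatrix2_P12 W12_coord ..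
  have W: "\<not> bounded (separatrix_surface M N 2 (P23s s))"
    "diffeomorphic (separatrix_surface M N 2 (P23s s)) (ball (0::real^2) 1 - {0})"
    "transversal_in M (separatrix_surface M N 2 (P23s s)) (separatrix_surface M N 2 {p \<in> M. mu p $ 1 = mu p $ 2})"
    "diffeomorphic (separatrix_surface M N 2 (P23s s) \<inter> separatrix_surface M N 2 {p \<in> M. mu p $ 1 = mu p $ 2}) (UNIV :: real set)"
    if s: "s = 1 \<or> s = -1" for s
    unfolding W2[OF s] W12 W_inter[OF s]
    by (rule W23s_unbounded[OF s] W23s_disk[OF s] W_transversal[OF s] W_inter_diffeomorphic[OF s])+
  have disk: "\<exists>p\<in>ball 0 1. \<exists>q\<in>ball 0 1. p \<noteq> q \<and>
      diffeomorphic (separatrix_surface M N 2 {p \<in> M. mu p $ 1 = mu p $ 2}) (ball (0::real^2) 1 - {p, q})"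
    unfolding W12 by (rule W12_disk)
  have lv2: "\<forall>L\<in>leaves M N 2. L \<inter> (separatrix_surface M N 2 (P23s 1) \<union> separatrix_surface M N 2 (P23s (-1))
     \<union> separatrix_surface M N 2 {p \<in> M. mu p $ 1 = mu p $ 2}) = {} \<longrightarrow> closed_leaf L"
    using leaves2_closed by blast
  have reg: "regular_curve {p \<in> M. mu p $ 1 = mu p $ 2}" unfolding P12_coord by (rule P12_regular)
  show "?P \<sigma>"
    \<comment> \<open>The chart equations become coincidences of roots, the form in which all facts
      above are stated; the witnesses are the branches with positive and with negative Z.\<close>
    unfolding Let_def P12 P23 P12_mu P23_mu
    by (intro conjI exI[of _ "P23s 1"] exI[of _ "P23s (-1)"], unfold s3)
      (rule umbilic_empty refl reg ne components_P23 P23s_regular[OF o(1)] P23s_regular[OF o(2)] sing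
        P23s_D1[OF o(1)] P23s_D1[OF o(2)] band bd lv1 lv3 W[OF o(1)] W[OF o(2)] disk lv2)+
qed

end
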